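(* Let $G$ be a non-elementary group admitting a geometric (i.e. proper and cocompact) isometric action on a CAT(0) space $(Y,d)$. If $G$ contains a rank-1 element, then $G$ is growth tight with respect to $d$; that is, for every infinite normal subgroup $\Gamma$ of $G$, with $\bar G=G/\Gamma$, one has $\delta_G>\delta_{\bar G}$.
   Context: A group is non-elementary if it is not a finite extension of a cyclic group (not virtually cyclic). The action is proper if $\{g\in G: d(o,go)\le n\}$ is finite for all $o\in Y$ and $n\ge 0$. A rank-1 element is an element acting as a hyperbolic isometry of $Y$ such that none of its axes bounds a (flat) half plane in $Y$. Growth rates: fix $o\in Y$ and set $B(o,n)=\{go: g\in G,\ d(o,go)\le n\}$. For $A\subset G$, $\delta_A=\limsup_{n\to\infty} n^{-1}\ln \sharp(B(o,n)\cap Ao)$ (independent of $o$). For a normal subgroup $\Gamma$ of $G$, $\bar G=G/\Gamma$ acts on $\bar Y=Y/\Gamma$ by $\Gamma g\cdot \Gamma x=\Gamma gx$; equip $\bar Y$ with the quotient metric $\bar d(\Gamma x,\Gamma y)=d(\Gamma x,\Gamma y)$ (the distance between the two orbits). Then $\delta_{\bar G}$ is the growth rate of $\bar G$ for this action, relative to $\bar d$. *)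

theory Defs
  imports "HOL-Analysis.Analysis" "HOL-Algebra.Group_Action" "HOL-Algebra.Elementary_Groups"
begin

section \<open>CAT(0) spaces\<close>

context Metric_space
begin

definition geodesic_segment :: "'a \<Rightarrow> 'a \<Rightarrow> 'a set \<Rightarrow> bool" where
  "geodesic_segment x y S \<longleftrightarrow>
     (\<exists>c. c ` {0..d x y} = S \<and> S \<subseteq> M \<and> c 0 = x \<and> c (d x y) = y \<and>
          (\<forall>s\<in>{0..d x y}. \<forall>t\<in>{0..d x y}. d (c s) (c t) = \<bar>s - t\<bar>))"

definition geodesic_line :: "(real \<Rightarrow> 'a) \<Rightarrow> bool" where
  "geodesic_line c \<longleftrightarrow> range c \<subseteq> M \<and> (\<forall>s t. d (c s) (c t) = \<bar>s - t\<bar>)"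

definition bounds_flat_half_plane :: "(real \<Rightarrow> 'a) \<Rightarrow> bool" where
  "bounds_flat_half_plane c \<longleftrightarrow>
     (\<exists>f :: real^2 \<Rightarrow> 'a.
        (\<forall>u\<in>{u. u $ 2 \<ge> 0}. f u \<in> M) \<and>
        (\<forall>u\<in>{u. u $ 2 \<ge> 0}. \<forall>v\<in>{v. v $ 2 \<ge> 0}. d (f u) (f v) = dist u v) \<and>
        f ` {u. u $ 2 = 0} = range c)"

end

text \<open>
  In the comparison axiom, \<^term>\<open>x'\<close>, \<^term>\<open>y'\<close>, \<^term>\<open>z'\<close> are the vertices of a comparison
  triangle and \<^term>\<open>p'\<close>, \<^term>\<open>q'\<close> are the comparison points of \<^term>\<open>p\<close>, \<^term>\<open>q\<close>. It is enough to
  take \<^term>\<open>p\<close> and \<^term>\<open>q\<close> on the two sides issuing from \<^term>\<open>x\<close>: any two distinct sides share a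
  vertex, and for two points of the same side the inequality is an equality. Completeness
  is not part of the definition.
\<close>

locale CAT0_space = Metric_space +
  assumes geodesic: "\<And>x y. \<lbrakk>x \<in> M; y \<in> M\<rbrakk> \<Longrightarrow> \<exists>S. geodesic_segment x y S"
    and comparison:
      "\<And>x y z S\<^sub>x\<^sub>y S\<^sub>x\<^sub>z S\<^sub>y\<^sub>z p q (x' :: real^2) y' z' p' q'.
        \<lbrakk>x \<in> M; y \<in> M; z \<in> M;
         geodesic_segment x y S\<^sub>x\<^sub>y; geodesic_segment x z S\<^sub>x\<^sub>z; geodesic_segment y z S\<^sub>y\<^sub>z;
         dist x' y' = d x y; dist x' z' = d x z; dist y' z' = d y z;
         p \<in> S\<^sub>x\<^sub>y; p' \<in> closed_segment x' y'; dist x' p' = d x p;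
         q \<in> S\<^sub>x\<^sub>z; q' \<in> closed_segment x' z'; dist x' q' = d x q\<rbrakk>
        \<Longrightarrow> d p q \<le> dist p' q'"


section \<open>Isometries\<close>

context Metric_space
begin

text \<open>The displacement function attains its infimum, and the infimum is positive.\<close>

definition hyperbolic_isometry :: "('a \<Rightarrow> 'a) \<Rightarrow> bool" where
  "hyperbolic_isometry f \<longleftrightarrow>
     bij_betw f M M \<and> (\<forall>x\<in>M. \<forall>y\<in>M. d (f x) (f y) = d x y) \<and>
     (\<exists>x\<in>M. 0 < d x (f x) \<and> (\<forall>y\<in>M. d x (f x) \<le> d y (f y)))"

definition axis :: "('a \<Rightarrow> 'a) \<Rightarrow> (real \<Rightarrow> 'a) \<Rightarrow> bool" where
  "axis f c \<longleftrightarrow> geodesic_line c \<and> (\<exists>a. a \<noteq> 0 \<and> (\<forall>t. f (c t) = c (t + a)))"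

definition rank_one :: "('a \<Rightarrow> 'a) \<Rightarrow> bool" where
  "rank_one f \<longleftrightarrow> hyperbolic_isometry f \<and> (\<forall>c. axis f c \<longrightarrow> \<not> bounds_flat_half_plane c)"

end


section \<open>Groups and their actions\<close>

definition virtually_cyclic :: "('a, 'b) monoid_scheme \<Rightarrow> bool" where
  "virtually_cyclic G \<longleftrightarrow>
     (\<exists>H. subgroup H G \<and> finite (rcosets\<^bsub>G\<^esub> H) \<and> cyclic_group (G\<lparr>carrier := H\<rparr>))"

abbreviation non_elementary :: "('a, 'b) monoid_scheme \<Rightarrow> bool" where
  "non_elementary G \<equiv> \<not> virtually_cyclic G"

locale isometric_action = Metric_space Y d + group_action G Y \<phi>
  for Y :: "'b set" and d and G :: "('a, 'c) monoid_scheme" and \<phi> +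
  assumes isometric:
    "\<And>g x y. \<lbrakk>g \<in> carrier G; x \<in> Y; y \<in> Y\<rbrakk> \<Longrightarrow> d (\<phi> g x) (\<phi> g y) = d x y"

locale geometric_action = isometric_action +
  assumes proper:
    "\<And>x (n::real). \<lbrakk>x \<in> Y; n \<ge> 0\<rbrakk> \<Longrightarrow> finite {g \<in> carrier G. d x (\<phi> g x) \<le> n}"
    and cocompact: "\<exists>K. compactin mtopology K \<and> (\<Union>g\<in>carrier G. \<phi> g ` K) = Y"


section \<open>Growth rates\<close>

definition orbit_ball ::
  "('a, 'c) monoid_scheme \<Rightarrow> ('a \<Rightarrow> 'b \<Rightarrow> 'b) \<Rightarrow> ('b \<Rightarrow> 'b \<Rightarrow> real) \<Rightarrow> 'b \<Rightarrow> nat \<Rightarrow> 'b set" where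
  "orbit_ball G \<phi> d x n = {\<phi> g x | g. g \<in> carrier G \<and> d x (\<phi> g x) \<le> real n}"

text \<open>
  As \<^const>\<open>card\<close> is 0 on infinite sets, this is meaningful only if the orbit balls are finite.
  For a proper action they are, and so are those of the induced action of a quotient group.
\<close>

definition growth_rate ::
  "('a, 'c) monoid_scheme \<Rightarrow> ('a \<Rightarrow> 'b \<Rightarrow> 'b) \<Rightarrow> ('b \<Rightarrow> 'b \<Rightarrow> real) \<Rightarrow> 'b \<Rightarrow> 'a set \<Rightarrow> ereal" where
  "growth_rate G \<phi> d x A =
     limsup (\<lambda>n. ereal (ln (real (card (orbit_ball G \<phi> d x n \<inter> (\<lambda>g. \<phi> g x) ` A))) / real n))"

abbreviation quotient_space ::
  "('a, 'c) monoid_scheme \<Rightarrow> 'b set \<Rightarrow> ('a \<Rightarrow> 'b \<Rightarrow> 'b) \<Rightarrow> 'a set \<Rightarrow> 'b set set" where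
  "quotient_space G Y \<phi> \<Gamma> \<equiv> orbits (G\<lparr>carrier := \<Gamma>\<rparr>) Y \<phi>"

definition quotient_dist :: "('b \<Rightarrow> 'b \<Rightarrow> real) \<Rightarrow> 'b set \<Rightarrow> 'b set \<Rightarrow> real" where
  "quotient_dist d P Q = Inf {d x y | x y. x \<in> P \<and> y \<in> Q}"

text \<open>
  Cosets act on orbits by elementwise products, just as \<^const>\<open>set_mult\<close> multiplies cosets
  in \<^const>\<open>FactGroup\<close>.
\<close>

definition quotient_action :: "('a \<Rightarrow> 'b \<Rightarrow> 'b) \<Rightarrow> 'a set \<Rightarrow> 'b set \<Rightarrow> 'b set" where
  "quotient_action \<phi> C P = {\<phi> g x | g x. g \<in> C \<and> x \<in> P}"

lemma (in group_action) quotient_action_coset_orbit: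
  assumes "\<Gamma> \<lhd> G" "g \<in> carrier G" "x \<in> E"
  shows "quotient_action \<phi> (\<Gamma> #>\<^bsub>G\<^esub> g) (orbit (G\<lparr>carrier := \<Gamma>\<rparr>) \<phi> x)
           = orbit (G\<lparr>carrier := \<Gamma>\<rparr>) \<phi> (\<phi> g x)"
proof -
  interpret normal \<Gamma> G by fact
  have gx: "\<phi> g x \<in> E" using element_image assms by blast
  have 1: "\<exists>k\<in>\<Gamma>. \<phi> (a \<otimes> g) (\<phi> b x) = \<phi> k (\<phi> g x)" if ab: "a \<in> \<Gamma>" "b \<in> \<Gamma>" for a b
  proof
    let ?k = "a \<otimes> (g \<otimes> b \<otimes> inv g)"
    have c: "a \<in> carrier G" "b \<in> carrier G" using ab subset by auto
    show k: "?k \<in> \<Gamma>" using ab assms inv_op_closed2 by blast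
    have "a \<otimes> g \<otimes> b = ?k \<otimes> g" using c assms by (simp add: m_assoc)
    then show "\<phi> (a \<otimes> g) (\<phi> b x) = \<phi> ?k (\<phi> g x)"
      using c assms composition_rule by (metis m_closed k mem_carrier)
  qed
  have 2: "\<phi> a (\<phi> g x) = \<phi> (a \<otimes> g) (\<phi> \<one> x)" if "a \<in> \<Gamma>" for a
    using that assms composition_rule subset by (metis mem_carrier m_closed one_closed r_one)
  have L: "quotient_action \<phi> (\<Gamma> #> g) (orbit (G\<lparr>carrier := \<Gamma>\<rparr>) \<phi> x)
             = {\<phi> (a \<otimes> g) (\<phi> b x) | a b. a \<in> \<Gamma> \<and> b \<in> \<Gamma>}"
    unfolding quotient_action_def orbit_def r_coset_def by auto
  have R: "orbit (G\<lparr>carrier := \<Gamma>\<rparr>) \<phi> (\<phi> g x) = {\<phi> k (\<phi> g x) | k. k \<in> \<Gamma>}"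
    unfolding orbit_def by simp
  show ?thesis
    unfolding L R
  proof (intro equalityI subsetI)
    fix y assume "y \<in> {\<phi> (a \<otimes> g) (\<phi> b x) | a b. a \<in> \<Gamma> \<and> b \<in> \<Gamma>}"
    then obtain a b where "y = \<phi> (a \<otimes> g) (\<phi> b x)" "a \<in> \<Gamma>" "b \<in> \<Gamma>" by blast
    with 1[of a b] show "y \<in> {\<phi> k (\<phi> g x) | k. k \<in> \<Gamma>}" by auto
  next
    fix y assume "y \<in> {\<phi> k (\<phi> g x) | k. k \<in> \<Gamma>}"
    then obtain a where "y = \<phi> a (\<phi> g x)" "a \<in> \<Gamma>" by blast
    with 2[of a] subgroup.one_closed[OF subgroup_axioms] show "y \<in> {\<phi> (a \<otimes> g) (\<phi> b x) | a b. a \<in> \<Gamma> \<and> b \<in> \<Gamma>}"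
      by blast
  qed
qed

definition growth_tight ::
  "('a, 'c) monoid_scheme \<Rightarrow> 'b set \<Rightarrow> ('a \<Rightarrow> 'b \<Rightarrow> 'b) \<Rightarrow> ('b \<Rightarrow> 'b \<Rightarrow> real) \<Rightarrow> bool" where
  "growth_tight G Y \<phi> d \<longleftrightarrow>
     (\<forall>\<Gamma>. \<Gamma> \<lhd> G \<and> infinite \<Gamma> \<longrightarrow>
       (\<forall>x\<in>Y. \<forall>p\<in>quotient_space G Y \<phi> \<Gamma>.
          growth_rate G \<phi> d x (carrier G)
            > growth_rate (G Mod \<Gamma>) (quotient_action \<phi>) (quotient_dist d) p (carrier (G Mod \<Gamma>))))"

end

theory Submission
  imports Defs
begin

text \<open>
  The axis of a rank-one isometry is contracting: otherwise there are almost flat strips of arbitrary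
  width and height along it, and a limit of their translates is a flat half plane bounded by the
  axis. Since \<open>G\<close> is non-elementary, some element \<open>x\<close> of the infinite normal subgroup \<open>\<Gamma>\<close> moves the
  axis of the given rank-one element \<open>h\<close> to a line with bounded projection, and for large \<open>n\<close> the
  commutator \<open>f = x h\<^sup>n x\<^sup>-\<^sup>1 h\<^sup>-\<^sup>n \<in> \<Gamma>\<close> is again of rank one. Shortest representatives \<open>a\<close> of the cosets
  of \<open>\<Gamma>\<close> have bounded projections to all translates of the axis of \<open>f\<close>. Hence the elements
  \<open>a f\<^sup>n\<close>, for \<open>a\<close> in a separated set of long shortest representatives, play ping-pong, so the
  products \<open>a\<^sub>1 f\<^sup>n a\<^sub>2 f\<^sup>n \<dots>\<close> with a given number of factors are distinct. The number of cosets in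
  balls is almost submultiplicative, so the Poincare series of the quotient diverges at its critical
  exponent \<open>\<delta>\<close>. If \<open>\<delta> > 0\<close> this makes the Poincare series of these products diverge slightly above
  \<open>\<delta>\<close>; if \<open>\<delta> = 0\<close>, it is enough that \<open>y f\<^sup>n\<close> and \<open>y f\<^sup>2\<^sup>n\<close> generate a free semigroup, where \<open>y\<close> moves
  the axis of \<open>f\<close> as \<open>x\<close> moves that of \<open>h\<close>.
\<close>

section \<open>Geometry of CAT(0) spaces\<close>

text \<open>All geometry relative to the axis \<open>c\<close> is carried by two real functions, the
  parameter \<open>b\<close> of the nearest point and the height \<open>H\<close>. A translate of
  the axis by \<open>g\<close> is handled by applying \<open>inv g\<close> to the points, so that
  bounded projections and ping-pong sets become inequalities between reals. The hypothesis excludes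
  exact half planes only, while the later steps need a uniform constant. Cocompactness bridges the
  gap: closed balls are compact and the axis is periodic, so recentred strips have a limit. Once
  strips of a single size are missing, the excess length of a geodesic at height \<rho> grows
  linearly in \<rho>, which controls balls of every radius at once. The rank-one element has to lie
  in \<Gamma> because only elements of \<Gamma> may be used to shorten a representative of a coset.
  Strictness comes from divergence at the exponent \<delta> itself: a finite alphabet already has
  weight at least 2 there, and a finite sum of exponentials is continuous in the exponent.\<close>

lemma stewart:
  fixes x y z :: "'v::real_inner"
  shows "(dist ((1 - s) *\<^sub>R x + s *\<^sub>R y) z)\<^sup>2
           = (1 - s) * (dist x z)\<^sup>2 + s * (dist y z)\<^sup>2 - s * (1 - s) * (dist x y)\<^sup>2"
proof -
  define u v where "u = x - z" and "v = y - z"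
  have 1: "(1 - s) *\<^sub>R x + s *\<^sub>R y - z = (1 - s) *\<^sub>R u + s *\<^sub>R v" "x - y = u - v"
    unfolding u_def v_def by (simp_all add: algebra_simps)
  have "(norm ((1 - s) *\<^sub>R u + s *\<^sub>R v))\<^sup>2
          = (1 - s) * (norm u)\<^sup>2 + s * (norm v)\<^sup>2 - s * (1 - s) * (norm (u - v))\<^sup>2"
    unfolding power2_norm_eq_inner by (simp add: inner_simps inner_commute algebra_simps)
  then show ?thesis
    unfolding dist_norm 1 by (simp add: u_def v_def)
qed

text \<open>The law of cosines forces the first coordinate \<open>u\<close> of \<open>z\<close>; the
  triangle inequalities give \<open>-b \<le> u \<le> b\<close>, so the second coordinate is the root
  of a nonnegative number.\<close>

lemma comparison_triangle:
  fixes a b e :: real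
  assumes "0 < a" "0 \<le> b" "0 \<le> e" "a \<le> b + e" "b \<le> a + e" "e \<le> a + b"
  obtains x y z :: "real^2" where "dist x y = a" "dist x z = b" "dist y z = e"
proof -
  define u where "u = (a\<^sup>2 + b\<^sup>2 - e\<^sup>2) / (2 * a)"
  have "(a - b)\<^sup>2 \<le> e\<^sup>2" using assms by (intro abs_le_square_iff[THEN iffD1]) auto
  then have 1: "u \<le> b" using assms unfolding u_def by (simp add: field_simps power2_eq_square)
  have "e\<^sup>2 \<le> (a + b)\<^sup>2" using assms by (intro power_mono) auto
  then have 2: "- b \<le> u" using assms unfolding u_def by (simp add: field_simps power2_eq_square)
  have "u\<^sup>2 \<le> b\<^sup>2" using 1 2 assms by (intro abs_le_square_iff[THEN iffD1]) auto
  then have v: "(sqrt (b\<^sup>2 - u\<^sup>2))\<^sup>2 = b\<^sup>2 - u\<^sup>2" by simp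
  define x y z :: "real^2" where "x = 0" and "y = vector [a, 0]" and "z = vector [u, sqrt (b\<^sup>2 - u\<^sup>2)]"
  have au: "2 * a * u = a\<^sup>2 + b\<^sup>2 - e\<^sup>2" using assms unfolding u_def by simp
  have "dist x y = a" "dist x z = b"
    using assms v unfolding x_def y_def z_def
    by (simp_all add: dist_vec_def L2_set_def sum_2 dist_real_def)
  moreover have "(a - u)\<^sup>2 + (b\<^sup>2 - u\<^sup>2) = e\<^sup>2" using au by (simp add: power2_eq_square algebra_simps)
  then have "dist y z = e"
    using assms v unfolding x_def y_def z_def
    by (simp add: dist_vec_def L2_set_def sum_2 dist_real_def)
  ultimately show thesis using that by blast
qed

lemma multiple_below:
  fixes \<tau> x :: real
  assumes "0 < \<tau>"
  obtains j :: int where "of_int j * \<tau> \<le> x" "x < of_int j * \<tau> + \<tau>"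
proof -
  define j where "j = \<lfloor>x / \<tau>\<rfloor>"
  have "of_int j \<le> x / \<tau>" "x / \<tau> < of_int j + 1" unfolding j_def by linarith+
  then have "of_int j * \<tau> \<le> x" "x < of_int j * \<tau> + \<tau>" using assms by (simp_all add: field_simps)
  then show thesis by (rule that)
qed

text \<open>The passage to the limit \<open>l = 0\<close>, made with one explicit \<open>l\<close>
  for which \<open>l * B\<close> is smaller than the supposed gap.\<close>

lemma le_from_contraction_limit:
  fixes A B C :: real
  assumes "0 \<le> B" and "\<And>l. 0 < l \<Longrightarrow> l \<le> 1 \<Longrightarrow> A + (1 - l) * B \<le> C"
  shows "A + B \<le> C"
proof (rule ccontr)
  assume "\<not> A + B \<le> C"
  define e where "e = A + B - C"
  have e: "e > 0" using \<open>\<not> A + B \<le> C\<close> unfolding e_def by simp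
  define l where "l = e / (e + B + 1)"
  have "0 < l" "l \<le> 1" using e assms(1) unfolding l_def by auto
  from assms(2)[OF this] have "e \<le> l * B" unfolding e_def by (simp add: algebra_simps)
  moreover have "l * B < e"
  proof -
    have "e * B < e * (e + B + 1)" using e by (intro mult_strict_left_mono) auto
    then show ?thesis using e assms(1) unfolding l_def by (simp add: field_simps)
  qed
  ultimately show False by simp
qed

section \<open>Geodesics and convexity of the metric\<close>

context CAT0_space
begin

lemma geodesic_path:
  assumes "x \<in> M" "y \<in> M"
  obtains c where "c 0 = x" "c (d x y) = y" "geodesic_segment x y (c ` {0..d x y})"
    "\<And>s. s \<in> {0..d x y} \<Longrightarrow> c s \<in> M"
    "\<And>s t. s \<in> {0..d x y} \<Longrightarrow> t \<in> {0..d x y} \<Longrightarrow> d (c s) (c t) = \<bar>s - t\<bar>"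
proof -
  obtain S where S: "geodesic_segment x y S" using geodesic assms by blast
  then obtain c where c: "c ` {0..d x y} = S" "S \<subseteq> M" "c 0 = x" "c (d x y) = y"
      "\<forall>s\<in>{0..d x y}. \<forall>t\<in>{0..d x y}. d (c s) (c t) = \<bar>s - t\<bar>"
    unfolding geodesic_segment_def by blast
  show thesis using that[of c] c S by blast
qed

text \<open>In the comparison axiom the second point is the vertex \<open>z\<close>, whose
  comparison point is \<open>z'\<close>; Stewart's identity evaluates the Euclidean side. The
  degenerate case is separate because \<open>comparison_triangle\<close> divides by the
  side.\<close>

lemma CN_segment:
  assumes S: "geodesic_segment x y S" and p: "p \<in> S" and xyz: "x \<in> M" "y \<in> M" "z \<in> M"
    and s: "0 \<le> s" "s \<le> 1" and dp: "d x p = s * d x y"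
  shows "(d p z)\<^sup>2 \<le> (1 - s) * (d x z)\<^sup>2 + s * (d y z)\<^sup>2 - s * (1 - s) * (d x y)\<^sup>2"
proof (cases "d x y = 0")
  case True
  have "S \<subseteq> M" using S unfolding geodesic_segment_def by blast
  then have "p = x" "y = x" using True p dp xyz zero by auto
  then show ?thesis using xyz by (simp add: algebra_simps)
next
  case False
  have pos: "0 < d x y" using False nonneg[of x y] by linarith
  have "d x y \<le> d x z + d y z" using xyz triangle[of x z y] commute by simp
  moreover have "d x z \<le> d x y + d y z" using xyz triangle[of x y z] by simp
  moreover have "d y z \<le> d x y + d x z" using xyz triangle[of y x z] commute by simp
  ultimately obtain x' y' z' :: "real^2"
    where E: "dist x' y' = d x y" "dist x' z' = d x z" "dist y' z' = d y z"
    using comparison_triangle[OF pos nonneg nonneg] by blast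
  obtain Sxz where Sxz: "geodesic_segment x z Sxz" using geodesic xyz by blast
  obtain Syz where Syz: "geodesic_segment y z Syz" using geodesic xyz by blast
  have z: "z \<in> Sxz"
  proof -
    obtain c where "c ` {0..d x z} = Sxz" "c (d x z) = z" using Sxz unfolding geodesic_segment_def by blast
    then show ?thesis using nonneg[of x z] by (metis atLeastAtMost_iff image_eqI order_refl)
  qed
  let ?p = "(1 - s) *\<^sub>R x' + s *\<^sub>R y'"
  have p': "?p \<in> closed_segment x' y'" using s by (auto simp: in_segment)
  have "dist x' ?p = norm (s *\<^sub>R (x' - y'))"
    unfolding dist_norm by (simp add: algebra_simps)
  also have "\<dots> = s * dist x' y'" using s by (simp add: dist_norm)
  finally have dp': "dist x' ?p = d x p" using E dp by simp
  have "d p z \<le> dist ?p z'"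
    using comparison[OF xyz S Sxz Syz E p p' dp' z, of z'] E by simp
  then have "(d p z)\<^sup>2 \<le> (dist ?p z')\<^sup>2" by (intro power_mono) auto
  then show ?thesis unfolding stewart E .
qed

text \<open>With \<open>z = p\<close> the right-hand side of \<open>CN_segment\<close> vanishes. So
  a point of a geodesic is determined by its distances to the ends.\<close>

lemma CN_unique:
  assumes xyz: "x \<in> M" "y \<in> M" "p \<in> M" "q \<in> M" and s: "0 \<le> s" "s \<le> 1"
    and p: "d x p = s * d x y" "d p y = (1 - s) * d x y"
    and S: "geodesic_segment x y S" "q \<in> S" and q: "d x q = s * d x y"
  shows "p = q"
proof -
  have "(d q p)\<^sup>2 \<le> (1 - s) * (d x p)\<^sup>2 + s * (d y p)\<^sup>2 - s * (1 - s) * (d x y)\<^sup>2"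
    by (rule CN_segment[OF S _ _ _ s q]) (use assms in auto)
  also have "\<dots> = 0" unfolding p(1) commute[of y p] p(2) by (simp add: power2_eq_square algebra_simps)
  finally show ?thesis using xyz zero by (simp add: commute)
qed

text \<open>For \<open>s\<close> in [0,1] the choice is unique by \<open>CN_unique\<close>, so
  \<open>pt x y\<close> is the geodesic parametrized proportionally to arc length. This spares the
  segments that witness \<open>geodesic_segment\<close>.\<close>

definition pt :: "'a \<Rightarrow> 'a \<Rightarrow> real \<Rightarrow> 'a" where
  "pt x y s = (SOME p. p \<in> M \<and> d x p = s * d x y \<and> d p y = (1 - s) * d x y)"

lemma pt_geodesic:
  assumes xy: "x \<in> M" "y \<in> M" and st: "0 \<le> s" "s \<le> 1" "0 \<le> t" "t \<le> 1"
  shows "pt x y s \<in> M" "d x (pt x y s) = s * d x y" "d (pt x y s) y = (1 - s) * d x y"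
    and "d (pt x y s) (pt x y t) = \<bar>s - t\<bar> * d x y"
    and "z \<in> M \<Longrightarrow> (d (pt x y s) z)\<^sup>2 \<le> (1 - s) * (d x z)\<^sup>2 + s * (d y z)\<^sup>2 - s * (1 - s) * (d x y)\<^sup>2"
    and "p \<in> M \<Longrightarrow> d x p = s * d x y \<Longrightarrow> d p y = (1 - s) * d x y \<Longrightarrow> pt x y s = p"
proof -
  let ?D = "d x y"
  obtain c where c: "c 0 = x" "c ?D = y" "geodesic_segment x y (c ` {0..?D})"
    "\<And>s. s \<in> {0..?D} \<Longrightarrow> c s \<in> M"
    "\<And>s t. s \<in> {0..?D} \<Longrightarrow> t \<in> {0..?D} \<Longrightarrow> d (c s) (c t) = \<bar>s - t\<bar>"
    using geodesic_path[OF xy] by blast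
  have r: "u * ?D \<in> {0..?D}" if "0 \<le> u" "u \<le> 1" for u using that by (auto simp: mult_left_le_one_le)
  have q: "c (u * ?D) \<in> M" "d x (c (u * ?D)) = u * ?D" "d (c (u * ?D)) y = (1 - u) * ?D" if u: "0 \<le> u" "u \<le> 1" for u
    using c(4)[OF r[OF u]] c(5)[OF r[OF u], of ?D] c(5)[OF _ r[OF u], of 0] c(1,2) r[OF u] u
    by (simp_all add: algebra_simps)
  have pt: "pt x y u = c (u * ?D)" if u: "0 \<le> u" "u \<le> 1" for u
  proof -
    have "pt x y u \<in> M \<and> d x (pt x y u) = u * ?D \<and> d (pt x y u) y = (1 - u) * ?D"
      unfolding pt_def by (rule someI[of _ "c (u * ?D)"]) (use q[OF u] in auto)
    then show ?thesis using CN_unique[of x y "pt x y u" "c (u * ?D)" u "c ` {0..?D}"] xy u c(3) r[OF u] q[OF u] by blast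
  qed
  show "pt x y s \<in> M" "d x (pt x y s) = s * ?D" "d (pt x y s) y = (1 - s) * ?D"
    unfolding pt[OF st(1,2)] using q[OF st(1,2)] by simp_all
  have "d (pt x y s) (pt x y t) = \<bar>s * ?D - t * ?D\<bar>"
    using pt[OF st(1,2)] pt[OF st(3,4)] c(5)[OF r[OF st(1,2)] r[OF st(3,4)]] by simp
  also have "\<dots> = \<bar>s - t\<bar> * ?D" by (simp add: left_diff_distrib[symmetric] abs_mult)
  finally show "d (pt x y s) (pt x y t) = \<bar>s - t\<bar> * ?D" .
  show "(d (pt x y s) z)\<^sup>2 \<le> (1 - s) * (d x z)\<^sup>2 + s * (d y z)\<^sup>2 - s * (1 - s) * ?D\<^sup>2" if "z \<in> M"
    by (rule CN_segment[OF c(3) _ xy that st(1,2)]) (use pt[OF st(1,2)] r[OF st(1,2)] q[OF st(1,2)] in auto)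
  show "pt x y s = p" if "p \<in> M" "d x p = s * ?D" "d p y = (1 - s) * ?D"
    using CN_unique[OF xy that(1) q(1)[OF st(1,2)] st(1,2) that(2,3) c(3)] r[OF st(1,2)] q(2)[OF st(1,2)] pt[OF st(1,2)]
    by auto
qed

lemmas pt_props = pt_geodesic(1-3)[OF _ _ _ _ order_refl zero_le_one]
lemmas pt_dist = pt_geodesic(4)

lemma pt_unique:
  assumes "x \<in> M" "y \<in> M" "p \<in> M" "0 \<le> s" "s \<le> 1" "d x p = s * d x y" "d p y = (1 - s) * d x y"
  shows "pt x y s = p"
  using pt_geodesic(6)[OF assms(1,2,4,5) order_refl zero_le_one assms(3,6,7)] .

lemma pt_endpoints [simp]:
  assumes "x \<in> M" "y \<in> M" shows "pt x y 0 = x" "pt x y 1 = y"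
  using pt_unique[of x y x 0] pt_unique[of x y y 1] assms by auto

lemma pt_sym:
  assumes "x \<in> M" "y \<in> M" "0 \<le> s" "s \<le> 1" shows "pt y x s = pt x y (1 - s)"
  using assms pt_props[of x y "1 - s"] by (intro pt_unique) (auto simp: commute)

theorem CN:
  assumes "x \<in> M" "y \<in> M" "z \<in> M" "0 \<le> s" "s \<le> 1"
  shows "(d (pt x y s) z)\<^sup>2 \<le> (1 - s) * (d x z)\<^sup>2 + s * (d y z)\<^sup>2 - s * (1 - s) * (d x y)\<^sup>2"
  using pt_geodesic(5)[OF assms(1,2,4,5) order_refl zero_le_one assms(3)] .

lemma unit_speed:
  assumes M: "x \<in> M" "y \<in> M" and D: "0 < d x y"
  shows "\<exists>\<sigma>. (\<forall>u\<in>{0..d x y}. \<sigma> u \<in> M \<and> \<sigma> u \<in> pt x y ` {0..1} \<and> d x (\<sigma> u) = u \<and> d (\<sigma> u) y = d x y - u) \<and>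
    (\<forall>u\<in>{0..d x y}. \<forall>v\<in>{0..d x y}. d (\<sigma> u) (\<sigma> v) = \<bar>u - v\<bar>) \<and> \<sigma> 0 = x \<and> \<sigma> (d x y) = y"
proof (intro exI[of _ "\<lambda>u. pt x y (u / d x y)"] conjI ballI)
  let ?D = "d x y"
  have r: "0 \<le> u / ?D" "u / ?D \<le> 1" if "u \<in> {0..?D}" for u using that D by auto
  fix u assume u: "u \<in> {0..?D}"
  note p = pt_props[OF M r[OF u]]
  have e: "u / ?D * ?D = u" "(1 - u / ?D) * ?D = ?D - u" using D by (simp_all add: left_diff_distrib)
  show "pt x y (u / ?D) \<in> M" "pt x y (u / ?D) \<in> pt x y ` {0..1}" "d x (pt x y (u / ?D)) = u"
    "d (pt x y (u / ?D)) y = ?D - u"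
    using p r[OF u] unfolding e by auto
  fix v assume v: "v \<in> {0..?D}"
  have "d (pt x y (u / ?D)) (pt x y (v / ?D)) = \<bar>u / ?D - v / ?D\<bar> * ?D" using pt_dist M r[OF u] r[OF v] by simp
  also have "\<dots> = \<bar>u - v\<bar>" using D by (simp add: diff_divide_distrib[symmetric] abs_divide)
  finally show "d (pt x y (u / ?D)) (pt x y (v / ?D)) = \<bar>u - v\<bar>" .
next
  show "pt x y (0 / d x y) = x" "pt x y (d x y / d x y) = y" using M D by simp_all
qed

text \<open>\<open>CN\<close> is used twice: it bounds the distance from \<open>z\<close> to the
  point on the side \<open>x y\<close>, and this bound is inserted into \<open>CN\<close> on the
  side \<open>x z\<close>. Everything but the square of \<open>s * d y z\<close> cancels.\<close>

lemma pt_fan: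
  assumes "x \<in> M" "y \<in> M" "z \<in> M" "0 \<le> s" "s \<le> 1"
  shows "d (pt x y s) (pt x z s) \<le> s * d y z"
proof -
  let ?p = "pt x y s"
  note p = pt_props[OF assms(1,2,4,5)]
  have 1: "(d z ?p)\<^sup>2 \<le> (1 - s) * (d x z)\<^sup>2 + s * (d y z)\<^sup>2 - s * (1 - s) * (d x y)\<^sup>2"
    using CN[OF assms] by (simp add: commute)
  have "(d (pt x z s) ?p)\<^sup>2 \<le> (1 - s) * (d x ?p)\<^sup>2 + s * (d z ?p)\<^sup>2 - s * (1 - s) * (d x z)\<^sup>2"
    using CN[of x z ?p s] assms p by simp
  also have "\<dots> \<le> (1 - s) * (s * d x y)\<^sup>2 + s * ((1 - s) * (d x z)\<^sup>2 + s * (d y z)\<^sup>2 - s * (1 - s) * (d x y)\<^sup>2)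
       - s * (1 - s) * (d x z)\<^sup>2"
    using mult_left_mono[OF 1 assms(4)] p by simp
  also have "\<dots> = (s * d y z)\<^sup>2" by (simp add: power2_eq_square algebra_simps)
  finally have "d (pt x z s) ?p \<le> s * d y z" by (rule power2_le_imp_le) (use assms in auto)
  then show ?thesis by (simp add: commute)
qed

text \<open>The geodesic from \<open>x\<close> to \<open>y'\<close> cuts the quadrilateral into two
  triangles, each treated by \<open>pt_fan\<close>.\<close>

theorem pt_convex:
  assumes "x \<in> M" "y \<in> M" "x' \<in> M" "y' \<in> M" "0 \<le> s" "s \<le> 1"
  shows "d (pt x y s) (pt x' y' s) \<le> (1 - s) * d x x' + s * d y y'"
proof -
  have "d (pt x y s) (pt x y' s) \<le> s * d y y'" using pt_fan assms by simp
  moreover have "d (pt y' x (1 - s)) (pt y' x' (1 - s)) \<le> (1 - s) * d x x'" using pt_fan assms by simp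
  then have "d (pt x y' s) (pt x' y' s) \<le> (1 - s) * d x x'"
    using pt_sym[of x y' "1 - s"] pt_sym[of x' y' "1 - s"] assms by simp
  moreover have "d (pt x y s) (pt x' y' s) \<le> d (pt x y s) (pt x y' s) + d (pt x y' s) (pt x' y' s)"
    using assms pt_props by (intro triangle) auto
  ultimately show ?thesis by simp
qed

text \<open>\<open>CN\<close> at the midpoint \<open>m\<close> of \<open>x\<close> and
  \<open>z\<close> is applied to both \<open>y\<close> and \<open>w\<close>, and
  \<open>d y w\<close> is at most \<open>d m y + d m w\<close>.\<close>

lemma quadrilateral:
  assumes "x \<in> M" "y \<in> M" "z \<in> M" "w \<in> M"
  shows "(d x z)\<^sup>2 + (d y w)\<^sup>2 \<le> (d x y)\<^sup>2 + (d y z)\<^sup>2 + (d z w)\<^sup>2 + (d w x)\<^sup>2"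
proof -
  define m where "m = pt x z (1/2)"
  have m: "m \<in> M" unfolding m_def using pt_props assms by simp
  have 1: "(d m v)\<^sup>2 \<le> (d x v)\<^sup>2 / 2 + (d z v)\<^sup>2 / 2 - (d x z)\<^sup>2 / 4" if "v \<in> M" for v
    using CN[of x z v "1/2"] that assms unfolding m_def by simp
  have "d y w \<le> d m y + d m w" using triangle[of y m w] m assms by (simp add: commute)
  then have "(d y w)\<^sup>2 \<le> (d m y + d m w)\<^sup>2" by (intro power_mono) auto
  also have "\<dots> \<le> 2 * (d m y)\<^sup>2 + 2 * (d m w)\<^sup>2"
    using sum_squares_bound[of "d m y" "d m w"] by (simp add: power2_eq_square algebra_simps)
  finally show ?thesis using 1[of y] 1[of w] assms by (simp add: commute)
qed

section \<open>Nearest points of convex sets\<close>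

definition gconvex :: "'a set \<Rightarrow> bool" where
  "gconvex S \<longleftrightarrow> S \<subseteq> M \<and> (\<forall>x\<in>S. \<forall>y\<in>S. \<forall>s\<in>{0..1}. pt x y s \<in> S)"

text \<open>A relation and not a function, as a convex set need not contain a nearest point. For
  lines and tubes around them one is exhibited.\<close>

definition nearest :: "'a set \<Rightarrow> 'a \<Rightarrow> 'a \<Rightarrow> bool" where
  "nearest S x p \<longleftrightarrow> p \<in> S \<and> (\<forall>q\<in>S. d x p \<le> d x q)"

text \<open>Moving from \<open>p\<close> towards \<open>q\<close> by the fraction \<open>l\<close>
  does not bring \<open>p\<close> closer to \<open>x\<close>. Insert this into \<open>CN\<close>,
  divide by \<open>l\<close> and let \<open>l\<close> tend to 0.\<close>

lemma nearest_pythagoras: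
  assumes S: "gconvex S" and x: "x \<in> M" and p: "nearest S x p" and q: "q \<in> S"
  shows "(d x p)\<^sup>2 + (d p q)\<^sup>2 \<le> (d x q)\<^sup>2"
proof (rule le_from_contraction_limit)
  fix l :: real assume l: "0 < l" "l \<le> 1"
  have pS: "p \<in> S" and M: "p \<in> M" "q \<in> M" using p q S unfolding nearest_def gconvex_def by auto
  have "pt p q l \<in> S" using S pS q l unfolding gconvex_def by simp
  then have "d x p \<le> d x (pt p q l)" using p unfolding nearest_def by simp
  then have "(d x p)\<^sup>2 \<le> (d (pt p q l) x)\<^sup>2" by (intro power_mono) (auto simp: commute)
  also have "\<dots> \<le> (1 - l) * (d p x)\<^sup>2 + l * (d q x)\<^sup>2 - l * (1 - l) * (d p q)\<^sup>2"
    using CN[of p q x l] M x l by simp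
  finally have "l * ((d x p)\<^sup>2 + (1 - l) * (d p q)\<^sup>2) \<le> l * (d x q)\<^sup>2"
    by (simp add: commute algebra_simps)
  then show "(d x p)\<^sup>2 + (1 - l) * (d p q)\<^sup>2 \<le> (d x q)\<^sup>2" using l by simp
qed simp

lemma nearest_unique:
  assumes "gconvex S" "x \<in> M" "nearest S x p" "q \<in> S" "d x q \<le> d x p"
  shows "q = p"
proof -
  have "(d x q)\<^sup>2 \<le> (d x p)\<^sup>2" using assms by (intro power_mono) auto
  then have "(d p q)\<^sup>2 \<le> 0" using nearest_pythagoras[OF assms(1-4)] by linarith
  then have "d p q = 0" by simp
  then show ?thesis using assms zero[of p q] unfolding nearest_def gconvex_def by auto
qed

text \<open>Two Pythagorean inequalities bound the diagonals \<open>d x q\<close> and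
  \<open>d y p\<close> from below, and \<open>quadrilateral\<close> bounds them from above.\<close>

lemma nearest_lipschitz:
  assumes S: "gconvex S" and M: "x \<in> M" "y \<in> M" and p: "nearest S x p" and q: "nearest S y q"
  shows "d p q \<le> d x y"
proof -
  have pS: "p \<in> S" "q \<in> S" and M': "p \<in> M" "q \<in> M" using p q S unfolding nearest_def gconvex_def by auto
  have "(d x p)\<^sup>2 + (d p q)\<^sup>2 \<le> (d x q)\<^sup>2" "(d y q)\<^sup>2 + (d q p)\<^sup>2 \<le> (d y p)\<^sup>2"
    using nearest_pythagoras S M p q pS by auto
  moreover have "(d x q)\<^sup>2 + (d y p)\<^sup>2 \<le> (d x y)\<^sup>2 + (d y q)\<^sup>2 + (d q p)\<^sup>2 + (d p x)\<^sup>2"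
    using quadrilateral M M' by blast
  ultimately have "(d p q)\<^sup>2 \<le> (d x y)\<^sup>2" unfolding commute[of q p] commute[of p x] commute[of y p] by linarith
  then show ?thesis by (rule power2_le_imp_le) simp
qed

end

section \<open>Projection to a geodesic line and height above it\<close>

locale CAT0_line = CAT0_space M d for M :: "'a set" and d +
  fixes c :: "real \<Rightarrow> 'a"
  assumes line: "geodesic_line c"
begin

lemma c_in [simp, intro]: "c t \<in> M" using line unfolding geodesic_line_def by auto

lemma c_dist [simp]: "d (c s) (c t) = \<bar>s - t\<bar>" using line unfolding geodesic_line_def by auto

lemma pt_c:
  assumes "0 \<le> s" "s \<le> 1" shows "pt (c t) (c u) s = c ((1 - s) * t + s * u)"
proof (rule pt_unique)
  have "t - ((1 - s) * t + s * u) = s * (t - u)" by (simp add: algebra_simps)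
  then show "d (c t) (c ((1 - s) * t + s * u)) = s * d (c t) (c u)" using assms by (simp add: abs_mult)
  have "((1 - s) * t + s * u) - u = (1 - s) * (t - u)" by (simp add: algebra_simps)
  then show "d (c ((1 - s) * t + s * u)) (c u) = (1 - s) * d (c t) (c u)" using assms by (simp add: abs_mult)
qed (use assms in auto)

lemma gconvex_line: "gconvex (range c)"
  unfolding gconvex_def by (auto simp: pt_c)

lemma between_line:
  assumes z: "z \<in> M" "d (c t) z + d z (c u) = \<bar>t - u\<bar>"
  shows "\<exists>s. z = c s"
proof (cases "t = u")
  case True
  then have "d (c t) z = 0" using z(2) nonneg[of "c t" z] nonneg[of z "c u"] by linarith
  then show ?thesis using z(1) by (metis c_in zero)
next
  case False
  define s where "s = d (c t) z / \<bar>t - u\<bar>"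
  have st: "s * \<bar>t - u\<bar> = d (c t) z" unfolding s_def using False by simp
  have "d (c t) z \<le> \<bar>t - u\<bar>" using z(2) nonneg[of z "c u"] by linarith
  then have s: "0 \<le> s" "s \<le> 1" using False unfolding s_def by (auto simp: divide_le_eq)
  have "pt (c t) (c u) s = z"
    by (rule pt_unique) (use z s st in \<open>auto simp: left_diff_distrib\<close>)
  then show ?thesis unfolding pt_c[OF s] by metis
qed

text \<open>The projection is stored as a parameter of the line; the foot itself is
  \<open>c (b x)\<close>. A minimizing parameter exists by \<open>b_min\<close> and is unique by
  \<open>b_unique\<close>.\<close>

definition b :: "'a \<Rightarrow> real" where "b x = (SOME t. \<forall>s. d x (c t) \<le> d x (c s))"

definition H :: "'a \<Rightarrow> real" where "H x = d x (c (b x))"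

lemma b_min:
  assumes x: "x \<in> M" shows "d x (c (b x)) \<le> d x (c s)"
proof -
  let ?g = "\<lambda>t. d x (c t)"
  have lip: "\<bar>?g s - ?g t\<bar> \<le> \<bar>s - t\<bar>" for s t
    using triangle[of x "c s" "c t"] triangle[of x "c t" "c s"] x by simp
  have "continuous_on UNIV ?g"
    unfolding continuous_on_iff dist_real_def using lip by (meson le_less_trans)
  \<comment> \<open>Outside this interval the distance is at least its value at the parameter 0, so
    a minimum on the interval is global.\<close>
  then have "continuous_on {- 2 * ?g 0..2 * ?g 0} ?g" by (rule continuous_on_subset) simp
  then obtain t where t: "t \<in> {- 2 * ?g 0..2 * ?g 0}" "\<And>u. u \<in> {- 2 * ?g 0..2 * ?g 0} \<Longrightarrow> ?g t \<le> ?g u"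
    using continuous_attains_inf[of "{- 2 * ?g 0..2 * ?g 0}" ?g] by auto
  have "?g t \<le> ?g u" for u
  proof (cases "u \<in> {- 2 * ?g 0..2 * ?g 0}")
    case False
    have "\<bar>u\<bar> \<le> ?g u + ?g 0" using triangle[of "c u" x "c 0"] x by (simp add: commute)
    then have "?g 0 \<le> ?g u" using False by auto
    moreover have "?g t \<le> ?g 0" by (rule t(2)) auto
    ultimately show ?thesis by simp
  qed (use t in auto)
  then have "\<forall>s. d x (c (b x)) \<le> d x (c s)" unfolding b_def by (rule_tac someI[of _ t]) simp
  then show ?thesis by simp
qed

lemma b_nearest: "x \<in> M \<Longrightarrow> nearest (range c) x (c (b x))"
  unfolding nearest_def using b_min by auto

lemma H_le: "x \<in> M \<Longrightarrow> H x \<le> d x (c s)" unfolding H_def by (rule b_min)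

lemma H_nonneg [simp]: "0 \<le> H x" unfolding H_def by simp

lemma b_pythagoras:
  assumes "x \<in> M" shows "(H x)\<^sup>2 + (b x - s)\<^sup>2 \<le> (d x (c s))\<^sup>2"
  using nearest_pythagoras[OF gconvex_line assms b_nearest[OF assms], of "c s"] unfolding H_def by simp

lemma b_unique:
  assumes "x \<in> M" "d x (c s) \<le> H x" shows "b x = s"
proof -
  have "c s = c (b x)" using nearest_unique[OF gconvex_line assms(1) b_nearest[OF assms(1)], of "c s"]
    assms unfolding H_def by simp
  then have "d (c s) (c (b x)) = 0" by simp
  then show ?thesis unfolding c_dist by simp
qed

lemma b_uniqueI:
  assumes "x \<in> M" "\<And>t. d x (c s) \<le> d x (c t)" shows "b x = s" "H x = d x (c s)"
  using b_unique[of x s] assms unfolding H_def by auto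

lemma b_c [simp]: "b (c t) = t" by (rule b_uniqueI) auto

lemma H_c [simp]: "H (c t) = 0" unfolding H_def by simp

lemma b_lipschitz:
  assumes "x \<in> M" "y \<in> M" shows "\<bar>b x - b y\<bar> \<le> d x y"
  using nearest_lipschitz[OF gconvex_line assms b_nearest b_nearest] assms by simp

lemma H_lipschitz:
  assumes "x \<in> M" "y \<in> M" shows "\<bar>H x - H y\<bar> \<le> d x y"
proof -
  have "H x \<le> d x (c (b y))" "H y \<le> d y (c (b x))" using H_le assms by auto
  moreover have "d x (c (b y)) \<le> d x y + H y" "d y (c (b x)) \<le> d x y + H x"
    unfolding H_def using triangle[of x y "c (b y)"] triangle[of y x "c (b x)"] assms by (auto simp: commute)
  ultimately show ?thesis by simp
qed

lemma H_convex:
  assumes "x \<in> M" "y \<in> M" "0 \<le> s" "s \<le> 1"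
  shows "H (pt x y s) \<le> (1 - s) * H x + s * H y"
proof -
  have "H (pt x y s) \<le> d (pt x y s) (pt (c (b x)) (c (b y)) s)"
    unfolding pt_c[OF assms(3,4)] using assms pt_props by (intro H_le) auto
  also have "\<dots> \<le> (1 - s) * H x + s * H y" unfolding H_def using assms by (intro pt_convex) auto
  finally show ?thesis .
qed

text \<open>A point of the line closer to the point on the perpendicular than the foot of
  \<open>x\<close> would also be closer to \<open>x\<close> than this foot.\<close>

lemma pt_drop:
  assumes x: "x \<in> M" and s: "0 \<le> s" "s \<le> 1"
  shows "b (pt (c (b x)) x s) = b x" "H (pt (c (b x)) x s) = s * H x"
proof -
  let ?p = "pt (c (b x)) x s"
  note p = pt_props[OF c_in x s, of "b x"]
  have 1: "d ?p (c (b x)) = s * H x" using p(2) unfolding H_def by (simp add: commute)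
  have "d ?p (c (b x)) \<le> d ?p (c t)" for t
  proof -
    have "H x \<le> d x (c t)" using H_le x .
    also have "\<dots> \<le> d x ?p + d ?p (c t)" using x p by (intro triangle) auto
    also have "d x ?p = (1 - s) * H x" using p(3) unfolding H_def by (simp add: commute)
    finally show ?thesis unfolding 1 by (simp add: algebra_simps)
  qed
  then show "b ?p = b x" "H ?p = s * H x" using b_uniqueI[of ?p "b x"] p 1 by auto
qed

text \<open>For \<open>0 < r \<le> H x\<close> this is the point of height \<open>r\<close> on the
  perpendicular from \<open>x\<close>. It is also the nearest point of the tube of radius
  \<open>r\<close>, hence 1-Lipschitz in \<open>x\<close>.\<close>

definition lower :: "real \<Rightarrow> 'a \<Rightarrow> 'a" where "lower r x = pt (c (b x)) x (r / H x)"

lemma lower_props: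
  assumes "x \<in> M" "0 < r" "r \<le> H x"
  shows "lower r x \<in> M" "b (lower r x) = b x" "H (lower r x) = r" "d x (lower r x) = H x - r"
proof -
  have s: "0 \<le> r / H x" "r / H x \<le> 1" using assms by auto
  show "lower r x \<in> M" "b (lower r x) = b x" "H (lower r x) = r"
    unfolding lower_def using pt_props pt_drop assms s by auto
  have "d x (lower r x) = (1 - r / H x) * H x"
    unfolding lower_def using pt_props(3)[OF c_in assms(1) s, of "b x"]
    by (simp add: commute[of "c (b x)" x] commute[of _ x] H_def[symmetric])
  also have "\<dots> = H x - r" using assms by (simp add: field_simps)
  finally show "d x (lower r x) = H x - r" .
qed

lemma gconvex_tube: "gconvex {x \<in> M. H x \<le> r}"
  unfolding gconvex_def
proof (intro conjI ballI)
  fix x y s assume A: "x \<in> {x \<in> M. H x \<le> r}" "y \<in> {x \<in> M. H x \<le> r}" "s \<in> {0..1::real}"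
  have "H (pt x y s) \<le> (1 - s) * H x + s * H y" using H_convex A by simp
  also have "\<dots> \<le> (1 - s) * r + s * r" using A by (intro add_mono mult_left_mono) auto
  finally show "pt x y s \<in> {x \<in> M. H x \<le> r}" using A pt_props by (simp add: algebra_simps)
qed auto

lemma lower_nearest:
  assumes "x \<in> M" "0 < r" "r \<le> H x"
  shows "nearest {x \<in> M. H x \<le> r} x (lower r x)"
  unfolding nearest_def
proof (intro conjI ballI)
  show "lower r x \<in> {x \<in> M. H x \<le> r}" using lower_props[OF assms] by simp
  fix q assume "q \<in> {x \<in> M. H x \<le> r}"
  then show "d x (lower r x) \<le> d x q" using H_lipschitz[of x q] lower_props[OF assms] assms by simp
qed

lemma lower_lipschitz:
  assumes "x \<in> M" "y \<in> M" "0 < r" "r \<le> H x" "r \<le> H y"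
  shows "d (lower r x) (lower r y) \<le> d x y"
  by (rule nearest_lipschitz[OF gconvex_tube]) (use assms lower_nearest in auto)

text \<open>Lowering in two stages is the same as lowering at once, so convexity of the metric controls
  the lower level in terms of the upper one.\<close>

lemma lower_convex:
  assumes x: "x \<in> M" "y \<in> M" and r: "0 < r" "r \<le> R" "R \<le> H x" "R \<le> H y"
  shows "d (lower r x) (lower r y) \<le> (1 - r / R) * \<bar>b x - b y\<bar> + r / R * d (lower R x) (lower R y)"
proof -
  have s: "0 \<le> r / R" "r / R \<le> 1" using r by auto
  have *: "lower r z = pt (c (b z)) (lower R z) (r / R)" if z: "z \<in> M" "R \<le> H z" for z
  proof -
    have R: "0 < R" "0 < H z" "0 \<le> R / H z" "R / H z \<le> 1" "0 \<le> r / H z" "r / H z \<le> 1" using r z by auto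
    note L = pt_props[OF c_in z(1) R(3,4), of "b z"]
    have "pt (c (b z)) (lower R z) (r / R) = pt (c (b z)) z (r / H z)"
    proof (rule pt_unique)
      have e: "d (c (b z)) (lower R z) = R"
        using L(2) R unfolding lower_def by (simp add: commute[of "c (b z)" z] H_def[symmetric])
      then show "d (c (b z)) (pt (c (b z)) z (r / H z)) = r / R * d (c (b z)) (lower R z)"
        using pt_props(2)[OF c_in z(1) R(5,6), of "b z"] R
        by (simp add: commute[of "c (b z)" z] H_def[symmetric])
      have "d (pt (c (b z)) z (r / H z)) (lower R z) = \<bar>r / H z - R / H z\<bar> * H z"
        unfolding lower_def using pt_dist[OF c_in z(1) R(5,6,3,4), of "b z"]
        by (simp add: commute[of "c (b z)" z] H_def[symmetric])
      also have "\<dots> = R - r" using R r by (simp add: abs_if field_simps)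
      finally have X: "d (pt (c (b z)) z (r / H z)) (lower R z) = R - r" .
      show "d (pt (c (b z)) z (r / H z)) (lower R z) = (1 - r / R) * d (c (b z)) (lower R z)"
        unfolding e X using R by (simp add: field_simps)
    qed (use R s z pt_props in \<open>auto simp: lower_def\<close>)
    then show ?thesis unfolding lower_def by simp
  qed
  have R: "0 < R" using r by simp
  show ?thesis
    unfolding *[OF x(1) r(3)] *[OF x(2) r(4)]
    using pt_convex[OF c_in lower_props(1)[OF x(1) R r(3)] c_in lower_props(1)[OF x(2) R r(4)] s, of "b x" "b y"]
    by simp
qed

end

section \<open>Contracting lines\<close>

text \<open>By Tychonoff the families of points form a compact space, in which every stage
  \<open>n\<close> imposes closed conditions. \<open>nest\<close> makes the solution sets decrease,
  so their intersection is not empty. Unlike a diagonal sequence, this works for an uncountable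
  index set.\<close>

lemma (in Metric_space) compact_nested_limit:
  fixes P :: "nat \<Rightarrow> 'i \<Rightarrow> 'i \<Rightarrow> real \<Rightarrow> real \<Rightarrow> bool"
  assumes K: "\<And>i. compactin mtopology (K i)"
    and sol: "\<And>n. \<exists>f. (\<forall>i. f i \<in> K i) \<and> (\<forall>i j l u. P n i j l u \<longrightarrow> l \<le> d (f i) (f j) \<and> d (f i) (f j) \<le> u)"
    and nest: "\<And>m n i j l u. m \<le> n \<Longrightarrow> P m i j l u \<Longrightarrow> \<exists>l' u'. P n i j l' u' \<and> l \<le> l' \<and> u' \<le> u"
  shows "\<exists>f. (\<forall>i. f i \<in> K i) \<and> (\<forall>n i j l u. P n i j l u \<longrightarrow> l \<le> d (f i) (f j) \<and> d (f i) (f j) \<le> u)"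
proof -
  define X where "X = product_topology (\<lambda>i. subtopology mtopology (K i)) UNIV"
  define A where "A n = {f \<in> topspace X. \<forall>i j l u. P n i j l u \<longrightarrow> d (f i) (f j) \<in> {l..u}}" for n
  have KM: "K i \<subseteq> M" for i using compactin_subset_topspace[OF K[of i]] by simp
  have top: "topspace X = {f. \<forall>i. f i \<in> K i}"
    unfolding X_def using KM by (auto simp: PiE_def Pi_def)
  have comp: "compact_space X"
    unfolding X_def compact_space_product_topology using K by (simp add: compact_space_subtopology)
  have cont: "continuous_map X euclideanreal (\<lambda>f. d (f i) (f j))" for i j
  proof -
    have "continuous_map X (subtopology mtopology (K k)) (\<lambda>f. f k)" for k
      unfolding X_def by (rule continuous_map_product_projection) simp
    then have "continuous_map X (mtopology_of Self) (\<lambda>f. f k)" for k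
      unfolding mtopology_of_def mspace_Self mdist_Self by (rule continuous_map_into_fulltopology)
    from continuous_map_mdist[OF this this, of i j] show ?thesis by simp
  qed
  have "closedin X (A n)" for n
  proof -
    have "A n = topspace X \<inter> (\<Inter>(i, j, l, u)\<in>{(i, j, l, u). P n i j l u}.
                 {f \<in> topspace X. d (f i) (f j) \<in> {l..u}})"
      unfolding A_def by auto
    moreover have "closedin X {f \<in> topspace X. d (f i) (f j) \<in> {l..u}}" for i j l u
      using closedin_continuous_map_preimage[OF cont, of "{l..u}"] by simp
    \<comment> \<open>The empty family of conditions is separate because
      \<open>closedin_Inter\<close> asks for a nonempty one.\<close>
    ultimately show ?thesis
      by (cases "{(i, j, l, u). P n i j l u} = {}") (auto intro!: closedin_Int closedin_Inter)
  qed
  moreover have "A n \<noteq> {}" for n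
    using sol[of n] unfolding A_def top by fastforce
  moreover have "decseq A"
  proof (rule decseq_SucI)
    fix n show "A (Suc n) \<subseteq> A n"
      unfolding A_def using nest[of n "Suc n"] by fastforce
  qed
  ultimately have "(\<Inter>n. A n) \<noteq> {}" using compact_space_imp_nest comp by metis
  then obtain f where "\<And>n. f \<in> A n" by blast
  then show ?thesis unfolding A_def top by (intro exI[of _ f]) auto
qed

section \<open>Flat half planes as limits of flat strips\<close>

context CAT0_line
begin

text \<open>The diagonals of a right-angled quadrilateral are bounded below by the Pythagorean inequality
  and above by the quadrilateral inequality, which forces them to be Euclidean.\<close>

lemma half_plane_isometry:
  fixes g :: "real \<Rightarrow> real \<Rightarrow> 'a"
  assumes M: "\<And>t r. 0 \<le> r \<Longrightarrow> g t r \<in> M"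
    and vert: "\<And>t r q. 0 \<le> r \<Longrightarrow> 0 \<le> q \<Longrightarrow> d (g t r) (g t q) = \<bar>r - q\<bar>"
    and hor: "\<And>t s r. 0 \<le> r \<Longrightarrow> d (g t r) (g s r) \<le> \<bar>t - s\<bar>"
    and bot: "\<And>t. g t 0 = c t"
    and high: "\<And>t s r. 0 \<le> r \<Longrightarrow> r \<le> d (g t r) (c s)"
    and rq: "0 \<le> r" "0 \<le> q"
  shows "(d (g t r) (g s q))\<^sup>2 = (t - s)\<^sup>2 + (r - q)\<^sup>2"
proof -
  have bt: "b (g t r) = t" "H (g t r) = r" if "0 \<le> r" for t r
  proof -
    have e: "d (g t r) (c t) = r" using vert[of r 0 t] that bot by simp
    show "b (g t r) = t" "H (g t r) = r" using b_uniqueI[of "g t r" t] M high that e by auto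
  qed
  have hor': "(d (g t r) (g s r))\<^sup>2 = (t - s)\<^sup>2" if "0 \<le> r" for t s r
  proof -
    have "d (g t r) (g s r) = \<bar>t - s\<bar>"
      using b_lipschitz[of "g t r" "g s r"] hor[of r t s] bt M that by fastforce
    then show ?thesis by simp
  qed
  have diag: "(d (c s) (g t r))\<^sup>2 = (t - s)\<^sup>2 + r\<^sup>2" if r: "0 \<le> r" for s t r
  proof -
    have 1: "r\<^sup>2 + (t - s)\<^sup>2 \<le> (d (g t r) (c s))\<^sup>2" for s t
      using b_pythagoras[of "g t r" s] M r bt by simp
    have "(d (c t) (g s r))\<^sup>2 + (d (c s) (g t r))\<^sup>2
        \<le> (d (c t) (c s))\<^sup>2 + (d (c s) (g s r))\<^sup>2 + (d (g s r) (g t r))\<^sup>2 + (d (g t r) (c t))\<^sup>2"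
      using quadrilateral[of "c t" "c s" "g s r" "g t r"] M r by simp
    moreover have "d (g u r) (c u) = r" for u using vert[of r 0 u] r bot by simp
    then have "d (c s) (g s r) = r" "d (g t r) (c t) = r" by (simp_all add: commute)
    ultimately show ?thesis
      using 1[of t s] 1[of s t] hor'[OF r, of s t] by (simp add: commute power2_commute)
  qed
  have main: "(d (g t r) (g s q))\<^sup>2 = (t - s)\<^sup>2 + (r - q)\<^sup>2" if rq: "0 \<le> r" "r \<le> q" for t s r q
  proof (cases "r = 0")
    case True
    then show ?thesis using diag[of q t s] rq bot by (simp add: power2_commute)
  next
    case False
    define l where "l = r / q"
    have l: "0 < l" "l \<le> 1" and q: "0 < q" "r = l * q" using rq False unfolding l_def by auto
    have p: "pt (c u) (g u q) l = g u r" for u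
    proof (rule pt_unique)
      show "d (c u) (g u r) = l * d (c u) (g u q)"
        using vert[of 0 r u] vert[of 0 q u] rq bot q l by simp
      have "(1 - l) * q = q - r" using q by (simp add: algebra_simps)
      then show "d (g u r) (g u q) = (1 - l) * d (c u) (g u q)"
        using vert[of r q u] vert[of 0 q u] rq bot q l by simp
    qed (use M rq l in auto)
    have "(d (g t r) (g s q))\<^sup>2
        \<le> (1 - l) * (d (c t) (g s q))\<^sup>2 + l * (d (g t q) (g s q))\<^sup>2 - l * (1 - l) * (d (c t) (g t q))\<^sup>2"
      using CN[of "c t" "g t q" "g s q" l] p M rq l by simp
    also have "\<dots> = (1 - l) * ((t - s)\<^sup>2 + q\<^sup>2) + l * (t - s)\<^sup>2 - l * (1 - l) * q\<^sup>2"
      using diag[of q t s] diag[of q t t] hor'[of q t s] rq by (simp add: power2_commute)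
    also have "\<dots> = (t - s)\<^sup>2 + (r - q)\<^sup>2" unfolding q(2) by (simp add: power2_eq_square algebra_simps)
    finally have up: "(d (g t r) (g s q))\<^sup>2 \<le> (t - s)\<^sup>2 + (r - q)\<^sup>2" .
    \<comment> \<open>The vertical at \<open>t\<close> gave the upper bound. On the vertical at
      \<open>s\<close>, \<open>CN\<close> bounds the known distance at equal height by an expression
      in the unknown one, which is the lower bound.\<close>
    have "(d (g s r) (g t r))\<^sup>2
        \<le> (1 - l) * (d (c s) (g t r))\<^sup>2 + l * (d (g s q) (g t r))\<^sup>2 - l * (1 - l) * (d (c s) (g s q))\<^sup>2"
      using CN[of "c s" "g s q" "g t r" l] p M rq l by simp
    then have "(t - s)\<^sup>2 \<le> (1 - l) * ((t - s)\<^sup>2 + r\<^sup>2) + l * (d (g t r) (g s q))\<^sup>2 - l * (1 - l) * q\<^sup>2"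
      using diag[of r s t] diag[of q s s] hor'[of r s t] rq by (simp add: power2_commute commute)
    then have "l * ((t - s)\<^sup>2 + (r - q)\<^sup>2) \<le> l * (d (g t r) (g s q))\<^sup>2"
      unfolding q(2) by (simp add: power2_eq_square algebra_simps)
    then show ?thesis using up l by simp
  qed
  show ?thesis
  proof (cases "r \<le> q")
    case True then show ?thesis using main rq by simp
  next
    case False
    then show ?thesis using main[of q r s t] rq by (simp add: commute power2_commute)
  qed
qed

text \<open>Only the upper edge of a strip is recorded, since perpendiculars fill the rest.
  Distances along the edge are at least those of the projections, so \<open>e\<close> is the defect
  from flatness.\<close>

definition flat_strips :: bool where
  "flat_strips \<longleftrightarrow> (\<forall>R>0. \<forall>T>0. \<forall>e>0. \<exists>t0 p.
     (\<forall>t\<in>{0..T}. p t \<in> M \<and> H (p t) = R \<and> b (p t) = t0 + t) \<and>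
     (\<forall>t\<in>{0..T}. \<forall>s\<in>{0..T}. d (p t) (p s) \<le> \<bar>t - s\<bar> + e))"

text \<open>This is what recentring of strips needs from the group: translations of the line by
  multiples of \<open>\<tau>\<close> extend to distance-preserving maps of the space.\<close>

definition periodic :: "real \<Rightarrow> bool" where
  "periodic \<tau> \<longleftrightarrow> (\<forall>k::int. \<exists>u. (\<forall>x\<in>M. u x \<in> M) \<and> (\<forall>x\<in>M. \<forall>y\<in>M. d (u x) (u y) = d x y) \<and>
     (\<forall>t. u (c t) = c (t + of_int k * \<tau>)))"

lemma b_translate:
  assumes u: "\<And>x. x \<in> M \<Longrightarrow> u x \<in> M" "\<And>x y. x \<in> M \<Longrightarrow> y \<in> M \<Longrightarrow> d (u x) (u y) = d x y"
    "\<And>t. u (c t) = c (t + a)" and x: "x \<in> M"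
  shows "b (u x) = b x + a" "H (u x) = H x"
proof -
  have *: "d (u x) (c t) = d x (c (t - a))" for t
    using u(2)[OF x c_in, of "t - a"] u(3)[of "t - a"] by simp
  have "d (u x) (c (b x + a)) \<le> d (u x) (c t)" for t
    unfolding * using b_min[OF x] by simp
  then show "b (u x) = b x + a" "H (u x) = H x"
    using b_uniqueI[of "u x" "b x + a"] u(1)[OF x] *[of "b x + a"] unfolding H_def by auto
qed

lemma flat_strips_centered:
  assumes S: "flat_strips" and P: "periodic \<tau>" "0 < \<tau>" and n: "0 < n"
  obtains q where "\<And>t. \<bar>t\<bar> \<le> n \<Longrightarrow> q t \<in> M \<and> H (q t) = n \<and> b (q t) = t"
    "\<And>t s. \<bar>t\<bar> \<le> n \<Longrightarrow> \<bar>s\<bar> \<le> n \<Longrightarrow> d (q t) (q s) \<le> \<bar>t - s\<bar> + 1 / n"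
proof -
  \<comment> \<open>A strip can be moved by multiples of \<open>\<tau>\<close> only, so the width
    \<open>2 * n\<close> needs the margin \<open>\<tau>\<close> in order to cover
    \<open>[-n, n]\<close>.\<close>
  define T where "T = 2 * n + \<tau>"
  have T: "0 < T" "0 < 1 / n" using n P unfolding T_def by auto
  obtain t0 p where p: "\<And>t. t \<in> {0..T} \<Longrightarrow> p t \<in> M \<and> H (p t) = n \<and> b (p t) = t0 + t"
     "\<And>t s. t \<in> {0..T} \<Longrightarrow> s \<in> {0..T} \<Longrightarrow> d (p t) (p s) \<le> \<bar>t - s\<bar> + 1 / n"
    using S n T unfolding flat_strips_def by (metis (no_types, lifting))
  obtain k :: int where k: "of_int k * \<tau> \<le> - n - t0" "- n - t0 < of_int k * \<tau> + \<tau>"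
    using multiple_below[OF P(2)] .
  obtain u where u: "\<And>x. x \<in> M \<Longrightarrow> u x \<in> M" "\<And>x y. x \<in> M \<Longrightarrow> y \<in> M \<Longrightarrow> d (u x) (u y) = d x y"
    "\<And>t. u (c t) = c (t + of_int k * \<tau>)"
    using P(1) unfolding periodic_def by metis
  let ?sh = "\<lambda>t. t - t0 - of_int k * \<tau>"
  have r: "?sh t \<in> {0..T}" if "\<bar>t\<bar> \<le> n" for t using k that unfolding T_def by auto
  show thesis
  proof
    fix t s assume t: "\<bar>t\<bar> \<le> n"
    show "u (p (?sh t)) \<in> M \<and> H (u (p (?sh t))) = n \<and> b (u (p (?sh t))) = t"
      using p(1)[OF r[OF t]] b_translate[of u, OF u] u by simp
    assume s: "\<bar>s\<bar> \<le> n"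
    show "d (u (p (?sh t))) (u (p (?sh s))) \<le> \<bar>t - s\<bar> + 1 / n"
      using p(1)[OF r[OF t]] p(1)[OF r[OF s]] p(2)[OF r[OF t] r[OF s]] u(2) by simp
  qed
qed

text \<open>The unknowns are points indexed by coordinates \<open>(t, r)\<close>, the bottom row
  being prescribed. The \<open>n\<close>-th strip solves the conditions in the window
  \<open>W n\<close>, and \<open>half_plane_isometry\<close> makes an isometry of the limit.\<close>

theorem flat_strips_half_plane:
  assumes S: "flat_strips" and P: "periodic \<tau>" "0 < \<tau>"
    and proper: "\<And>r. compactin mtopology (mcball (c 0) r)"
  shows "bounds_flat_half_plane c"
proof -
  define K where "K i = (if snd i = 0 then {c (fst i)} else mcball (c 0) (\<bar>fst i\<bar> + \<bar>snd i\<bar>))"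
    for i :: "real \<times> real"
  define W where "W n = {i :: real \<times> real. \<bar>fst i\<bar> \<le> real (Suc n) \<and> 0 \<le> snd i \<and> snd i \<le> real (Suc n)}" for n
  \<comment> \<open>The alternatives correspond to the hypotheses \<open>vert\<close>,
    \<open>hor\<close> and \<open>high\<close> of \<open>half_plane_isometry\<close>. Only the
    second has a defect, and it vanishes as \<open>n\<close> grows.\<close>
  define Q where "Q n i j l u \<longleftrightarrow> i \<in> W n \<and> j \<in> W n \<and>
     (fst i = fst j \<and> l = \<bar>snd i - snd j\<bar> \<and> u = \<bar>snd i - snd j\<bar>
      \<or> snd i = snd j \<and> l = 0 \<and> u = \<bar>fst i - fst j\<bar> + 1 / real (Suc n)
      \<or> snd j = 0 \<and> l = snd i \<and> u = snd i + \<bar>fst i - fst j\<bar>)" for n i j l u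
  have cK: "compactin mtopology (K i)" for i unfolding K_def using proper by simp
  have nest: "\<exists>l' u'. Q n i j l' u' \<and> l \<le> l' \<and> u' \<le> u" if mn: "m \<le> n" and q: "Q m i j l u" for m n i j l u
  proof -
    have W: "i \<in> W n" "j \<in> W n" using q mn unfolding Q_def W_def by auto
    have "1 / real (Suc n) \<le> 1 / real (Suc m)" using mn by (simp add: field_simps)
    then show ?thesis
      using q W unfolding Q_def by (metis add_left_mono order_refl)
  qed
  have sol: "\<exists>f. (\<forall>i. f i \<in> K i) \<and> (\<forall>i j l u. Q n i j l u \<longrightarrow> l \<le> d (f i) (f j) \<and> d (f i) (f j) \<le> u)" for n
  proof -
    let ?n = "real (Suc n)"
    obtain q where q: "\<And>t. \<bar>t\<bar> \<le> ?n \<Longrightarrow> q t \<in> M \<and> H (q t) = ?n \<and> b (q t) = t"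
      "\<And>t s. \<bar>t\<bar> \<le> ?n \<Longrightarrow> \<bar>s\<bar> \<le> ?n \<Longrightarrow> d (q t) (q s) \<le> \<bar>t - s\<bar> + 1 / ?n"
      using flat_strips_centered[OF S P, of ?n] by auto
    \<comment> \<open>Outside the window only membership in \<open>K i\<close> is required;
      \<open>c 0\<close> is a default value lying in each of the balls.\<close>
    define f where "f i = (if i \<in> W n then pt (c (fst i)) (q (fst i)) (snd i / ?n)
       else if snd i = 0 then c (fst i) else c 0)" for i
    have qd: "d (c t) (q t) = ?n" if "\<bar>t\<bar> \<le> ?n" for t
      using q(1)[OF that] unfolding H_def by (auto simp: commute[of "c t"])
    have fW: "f (t, r) = pt (c t) (q t) (r / ?n)" "0 \<le> r / ?n" "r / ?n \<le> 1" "q t \<in> M" "\<bar>t\<bar> \<le> ?n" "0 \<le> r"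
      if "(t, r) \<in> W n" for t r
      using that q unfolding f_def W_def by auto
    have fM: "f i \<in> M" for i
      using fW[of "fst i" "snd i"] pt_props by (cases "i \<in> W n") (auto simp: f_def)
    have vert: "d (f (t, r)) (f (t, r')) = \<bar>r - r'\<bar>" if "(t, r) \<in> W n" "(t, r') \<in> W n" for t r r'
    proof -
      have "d (f (t, r)) (f (t, r')) = \<bar>r / ?n - r' / ?n\<bar> * ?n"
        using fW that pt_dist qd by simp
      also have "\<dots> = \<bar>r - r'\<bar>" by (simp add: diff_divide_distrib[symmetric] abs_divide del: of_nat_Suc)
      finally show ?thesis .
    qed
    have bot: "f (t, 0) = c t" for t
      using fW[of t 0] by (cases "(t, 0) \<in> W n") (auto simp: f_def)
    have hor: "d (f (t, r)) (f (s, r)) \<le> \<bar>t - s\<bar> + 1 / ?n" if "(t, r) \<in> W n" "(s, r) \<in> W n" for t s r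
    proof -
      have "d (f (t, r)) (f (s, r)) \<le> (1 - r / ?n) * d (c t) (c s) + r / ?n * d (q t) (q s)"
        unfolding fW(1)[OF that(1)] fW(1)[OF that(2)]
        by (rule pt_convex) (use fW[OF that(1)] fW[OF that(2)] in auto)
      also have "\<dots> \<le> (1 - r / ?n) * (\<bar>t - s\<bar> + 1 / ?n) + r / ?n * (\<bar>t - s\<bar> + 1 / ?n)"
        using fW[OF that(1)] fW[OF that(2)] q(2) by (intro add_mono mult_left_mono) auto
      also have "\<dots> = \<bar>t - s\<bar> + 1 / ?n" by (simp add: algebra_simps)
      finally show ?thesis .
    qed
    have high: "r \<le> d (f (t, r)) (c s)" "d (f (t, r)) (c s) \<le> r + \<bar>t - s\<bar>" if W: "(t, r) \<in> W n" for t s r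
    proof -
      note F = fW[OF W]
      have "H (f (t, r)) = r" using F q(1)[of t] pt_drop[of "q t" "r / ?n"] by (simp del: of_nat_Suc)
      then show "r \<le> d (f (t, r)) (c s)" using H_le[OF fM] by metis
      have "d (f (t, r)) (c s) \<le> d (f (t, r)) (c t) + d (c t) (c s)" using fM by (intro triangle) auto
      moreover have "(t, 0) \<in> W n" using W unfolding W_def by simp
      then have "d (f (t, r)) (c t) = r" using vert[OF W, of 0] bot F by simp
      ultimately show "d (f (t, r)) (c s) \<le> r + \<bar>t - s\<bar>" by simp
    qed
    have "f i \<in> K i" for i
    proof (cases "snd i = 0")
      case True then show ?thesis using bot[of "fst i"] unfolding K_def by (metis insertI1 prod.collapse)
    next
      case False
      have "d (c 0) (f i) \<le> \<bar>fst i\<bar> + \<bar>snd i\<bar>"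
      proof (cases "i \<in> W n")
        case True then show ?thesis using high(2)[of "fst i" "snd i" 0] fW[of "fst i" "snd i"] by (simp add: commute)
      qed (use False in \<open>auto simp: f_def\<close>)
      then show ?thesis using False fM unfolding K_def by simp
    qed
    moreover have "l \<le> d (f i) (f j) \<and> d (f i) (f j) \<le> u" if "Q n i j l u" for i j l u
      using that vert[of "fst i" "snd i" "snd j"] hor[of "fst i" "snd i" "fst j"]
        high[of "fst i" "snd i" "fst j"] bot[of "fst j"]
      unfolding Q_def by (cases i; cases j) auto
    ultimately show ?thesis by blast
  qed
  obtain f where f: "\<And>i. f i \<in> K i" "\<And>n i j l u. Q n i j l u \<Longrightarrow> l \<le> d (f i) (f j) \<and> d (f i) (f j) \<le> u"
  proof -
    have "\<exists>f. (\<forall>i. f i \<in> K i) \<and> (\<forall>n i j l u. Q n i j l u \<longrightarrow> l \<le> d (f i) (f j) \<and> d (f i) (f j) \<le> u)"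
      by (rule compact_nested_limit[of K Q]) (fact cK sol nest)+
    then show thesis using that by blast
  qed
  define g where "g t r = f (t, r)" for t r
  have inW: "\<forall>\<^sub>F n in sequentially. (t, r) \<in> W n" if "0 \<le> r" for t r
  proof -
    obtain N where N: "\<bar>t\<bar> + r \<le> real N" using real_arch_simple by blast
    show ?thesis
      using eventually_ge_at_top[of N] by eventually_elim (use N that in \<open>auto simp: W_def\<close>)
  qed
  have inW2: "\<exists>n. (t, r) \<in> W n \<and> (s, q) \<in> W n" if "0 \<le> r" "0 \<le> q" for t r s q
    using eventually_conj[OF inW inW, OF that, of t s] eventually_happens by force
  have gM: "g t r \<in> M" for t r
    using f(1)[of "(t, r)"] unfolding K_def g_def by (auto split: if_splits)
  have g0: "g t 0 = c t" for t using f(1)[of "(t, 0)"] unfolding K_def g_def by simp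
  have vert: "d (g t r) (g t q) = \<bar>r - q\<bar>" if pos: "0 \<le> r" "0 \<le> q" for t r q
  proof -
    obtain n where "(t, r) \<in> W n" "(t, q) \<in> W n" using inW2[OF pos] by blast
    then show ?thesis using f(2)[of n "(t, r)" "(t, q)" "\<bar>r - q\<bar>" "\<bar>r - q\<bar>"] unfolding Q_def g_def by simp
  qed
  have high: "r \<le> d (g t r) (c s)" if pos: "0 \<le> r" for t s r
  proof -
    obtain n where "(t, r) \<in> W n" "(s, 0) \<in> W n" using inW2[OF pos order_refl] by blast
    then show ?thesis using f(2)[of n "(t, r)" "(s, 0)" r "r + \<bar>t - s\<bar>"] g0[of s] unfolding Q_def g_def by simp
  qed
  have hor: "d (g t r) (g s r) \<le> \<bar>t - s\<bar>" if "0 \<le> r" for t s r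
  proof (rule tendsto_lowerbound)
    show "(\<lambda>n. \<bar>t - s\<bar> + 1 / real (Suc n)) \<longlonglongrightarrow> \<bar>t - s\<bar>"
      using tendsto_add[OF tendsto_const LIMSEQ_inverse_real_of_nat, of "\<bar>t - s\<bar>"] by (simp add: inverse_eq_divide)
    show "\<forall>\<^sub>F n in sequentially. d (g t r) (g s r) \<le> \<bar>t - s\<bar> + 1 / real (Suc n)"
      using inW[OF that, of t] inW[OF that, of s]
    proof eventually_elim
      case (elim n)
      then show ?case using f(2)[of n "(t, r)" "(s, r)" 0] unfolding Q_def g_def by simp
    qed
  qed simp
  have iso: "(d (g t r) (g s q))\<^sup>2 = (t - s)\<^sup>2 + (r - q)\<^sup>2" if "0 \<le> r" "0 \<le> q" for t r s q
    by (rule half_plane_isometry) (use gM vert hor g0 high that in auto)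
  define F :: "real^2 \<Rightarrow> 'a" where "F v = g (v $ 1) (v $ 2)" for v
  have "d (F v) (F w) = dist v w" if "v $ 2 \<ge> 0" "w $ 2 \<ge> 0" for v w
  proof -
    have "(d (F v) (F w))\<^sup>2 = (dist v w)\<^sup>2"
      unfolding F_def iso[OF that] by (simp add: dist_vec_def L2_set_def sum_2 dist_real_def sum_nonneg)
    then show ?thesis by (simp add: power2_eq_iff_nonneg)
  qed
  moreover have "F ` {u. u $ 2 = 0} = range c"
  proof -
    have "c t \<in> F ` {u. u $ 2 = 0}" for t
      by (rule image_eqI[of _ _ "vector [t, 0]"]) (simp_all add: F_def g0)
    moreover have "F u \<in> range c" if "u $ 2 = 0" for u using that by (simp add: F_def g0)
    ultimately show ?thesis by auto
  qed
  ultimately show ?thesis unfolding bounds_flat_half_plane_def using gM by (intro exI[of _ F]) (auto simp: F_def)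
qed


text \<open>A ball whose radius is at most the height of its centre has bounded projection. The
  bound is measured from the centre, so the projection has diameter at most
  \<open>2 * B\<close>.\<close>

definition contracting :: "real \<Rightarrow> bool" where
  "contracting B \<longleftrightarrow> (\<forall>x\<in>M. \<forall>y\<in>M. d x y \<le> H x \<longrightarrow> \<bar>b x - b y\<bar> \<le> B)"

lemma continuous_on_path:
  assumes "\<And>u v. u \<in> S \<Longrightarrow> v \<in> S \<Longrightarrow> d (\<sigma> u) (\<sigma> v) = \<bar>u - v\<bar>" "\<And>u. u \<in> S \<Longrightarrow> \<sigma> u \<in> M"
  shows "continuous_on S (\<lambda>u. b (\<sigma> u))" "continuous_on S (\<lambda>u. H (\<sigma> u))"
proof -
  have *: "continuous_on S (\<lambda>u. f (\<sigma> u))" if f: "\<And>x y. x \<in> M \<Longrightarrow> y \<in> M \<Longrightarrow> \<bar>f x - f y\<bar> \<le> d x y"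
    for f :: "'a \<Rightarrow> real"
    unfolding continuous_on_iff dist_real_def
  proof (intro ballI allI impI)
    fix u e :: real assume u: "u \<in> S" "0 < e"
    have "\<bar>f (\<sigma> v) - f (\<sigma> u)\<bar> < e" if "v \<in> S" "\<bar>v - u\<bar> < e" for v
      using f[of "\<sigma> v" "\<sigma> u"] assms(1)[of v u] assms(2) that u by simp
    then show "\<exists>r>0. \<forall>v\<in>S. \<bar>v - u\<bar> < r \<longrightarrow> \<bar>f (\<sigma> v) - f (\<sigma> u)\<bar> < e" using u by blast
  qed
  show "continuous_on S (\<lambda>u. b (\<sigma> u))" "continuous_on S (\<lambda>u. H (\<sigma> u))"
    using * b_lipschitz H_lipschitz by blast+
qed

section \<open>Contraction in the absence of a flat strip\<close>

context
  fixes R T e :: real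
  assumes pos: "0 < R" "0 < T" "0 < e"
    and no_strip: "\<And>t0 p. (\<And>t. t \<in> {0..T} \<Longrightarrow> p t \<in> M \<and> H (p t) = R \<and> b (p t) = t0 + t) \<Longrightarrow>
      \<exists>t\<in>{0..T}. \<exists>s\<in>{0..T}. \<bar>t - s\<bar> + e < d (p t) (p s)"
begin

text \<open>Lowered to height \<open>R\<close>, the block is not the edge of a strip, so two of its
  points are apart by more than \<open>e\<close> beyond their projections. By
  \<open>lower_convex\<close> this excess is at least \<open>\<rho> / R\<close> times as large at
  height \<open>\<rho>\<close>, and lowering the geodesic to height \<open>\<rho>\<close> does not
  increase distances. The rest of the block is at least as long as its projection.\<close>

lemma block_length:
  assumes \<sigma>: "\<And>u v. u \<in> {\<alpha>..\<beta>} \<Longrightarrow> v \<in> {\<alpha>..\<beta>} \<Longrightarrow> d (\<sigma> u) (\<sigma> v) = \<bar>u - v\<bar>"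
      "\<And>u. u \<in> {\<alpha>..\<beta>} \<Longrightarrow> \<sigma> u \<in> M" "\<And>u. u \<in> {\<alpha>..\<beta>} \<Longrightarrow> \<rho> \<le> H (\<sigma> u)"
    and \<rho>: "R \<le> \<rho>" and ab: "\<alpha> \<le> \<beta>" and T: "b (\<sigma> \<beta>) = b (\<sigma> \<alpha>) + T"
  shows "T + \<rho> * e / R \<le> \<beta> - \<alpha>"
proof -
  have cont: "continuous_on {\<alpha>..\<beta>} (\<lambda>u. b (\<sigma> u))" using continuous_on_path \<sigma> by blast
  \<comment> \<open>Every intermediate projection is attained; the times \<open>h t\<close> need not
    be monotone in \<open>t\<close>.\<close>
  have "\<exists>u\<in>{\<alpha>..\<beta>}. b (\<sigma> u) = b (\<sigma> \<alpha>) + t" if "t \<in> {0..T}" for t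
    using IVT'[OF _ _ ab cont, of "b (\<sigma> \<alpha>) + t"] that T by auto
  then obtain h where h: "\<And>t. t \<in> {0..T} \<Longrightarrow> h t \<in> {\<alpha>..\<beta>}" "\<And>t. t \<in> {0..T} \<Longrightarrow> b (\<sigma> (h t)) = b (\<sigma> \<alpha>) + t"
    by metis
  have hi: "R \<le> H (\<sigma> (h t))" "\<rho> \<le> H (\<sigma> (h t))" "\<sigma> (h t) \<in> M" if "t \<in> {0..T}" for t
    using \<sigma> h(1)[OF that] \<rho> by force+
  obtain t s where ts: "t \<in> {0..T}" "s \<in> {0..T}"
      and far: "\<bar>t - s\<bar> + e < d (lower R (\<sigma> (h t))) (lower R (\<sigma> (h s)))"
  proof -
    have "lower R (\<sigma> (h t)) \<in> M \<and> H (lower R (\<sigma> (h t))) = R \<and> b (lower R (\<sigma> (h t))) = b (\<sigma> \<alpha>) + t"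
      if "t \<in> {0..T}" for t
      using lower_props[OF hi(3)[OF that] pos(1) hi(1)[OF that]] h(2)[OF that] by simp
    from no_strip[OF this] show thesis using that by blast
  qed
  have \<rho>0: "0 < \<rho>" using \<rho> pos by simp
  define D where "D = d (lower \<rho> (\<sigma> (h t))) (lower \<rho> (\<sigma> (h s)))"
  have "D \<le> d (\<sigma> (h t)) (\<sigma> (h s))" unfolding D_def
    using hi ts \<rho>0 by (intro lower_lipschitz) auto
  then have D: "D \<le> \<bar>h t - h s\<bar>" using \<sigma>(1) h(1) ts by simp
  have "\<bar>t - s\<bar> + e < (1 - R / \<rho>) * \<bar>t - s\<bar> + R / \<rho> * D"
    using far lower_convex[OF hi(3)[OF ts(1)] hi(3)[OF ts(2)] pos(1) \<rho> hi(2)[OF ts(1)] hi(2)[OF ts(2)]]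
      h(2)[OF ts(1)] h(2)[OF ts(2)] unfolding D_def by simp
  then have "\<rho> * (\<bar>t - s\<bar> + e) < \<rho> * ((1 - R / \<rho>) * \<bar>t - s\<bar> + R / \<rho> * D)" using \<rho>0 by simp
  also have "\<dots> = \<rho> * \<bar>t - s\<bar> - R * \<bar>t - s\<bar> + R * D" using \<rho>0 by (simp add: field_simps)
  finally have "\<rho> * e < R * (D - \<bar>t - s\<bar>)" by (simp add: algebra_simps)
  then have "\<rho> * e / R < D - \<bar>t - s\<bar>" using pos by (simp add: pos_divide_less_eq mult.commute)
  then have 1: "\<rho> * e / R < \<bar>h t - h s\<bar> - \<bar>t - s\<bar>" using D by simp
  have 2: "t \<le> h t - \<alpha>" "T - t \<le> \<beta> - h t" if "t \<in> {0..T}" for t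
    using b_lipschitz[OF hi(3)[OF that] \<sigma>(2), of \<alpha>] b_lipschitz[OF hi(3)[OF that] \<sigma>(2), of \<beta>]
      \<sigma>(1)[OF h(1)[OF that], of \<alpha>] \<sigma>(1)[OF h(1)[OF that], of \<beta>] ab h[OF that] T that by auto
  show ?thesis using 1 2[OF ts(1)] 2[OF ts(2)] by linarith
qed

lemma blocks_length:
  assumes \<sigma>: "\<And>u v. u \<in> {\<alpha>..\<beta>} \<Longrightarrow> v \<in> {\<alpha>..\<beta>} \<Longrightarrow> d (\<sigma> u) (\<sigma> v) = \<bar>u - v\<bar>"
      "\<And>u. u \<in> {\<alpha>..\<beta>} \<Longrightarrow> \<sigma> u \<in> M" "\<And>u. u \<in> {\<alpha>..\<beta>} \<Longrightarrow> \<rho> \<le> H (\<sigma> u)"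
    and \<rho>: "R \<le> \<rho>" and ab: "\<alpha> \<le> \<beta>" and T: "b (\<sigma> \<alpha>) + of_nat m * T \<le> b (\<sigma> \<beta>)"
  shows "of_nat m * (T + \<rho> * e / R) \<le> \<beta> - \<alpha>"
  using \<sigma> ab T
proof (induction m arbitrary: \<beta>)
  case 0 then show ?case by simp
next
  case (Suc m)
  have cont: "continuous_on {\<alpha>..\<beta>} (\<lambda>u. b (\<sigma> u))" using continuous_on_path Suc.prems by blast
  have m: "0 \<le> real m * T" "0 \<le> T" using pos by auto
  obtain \<gamma>' where g': "\<alpha> \<le> \<gamma>'" "\<gamma>' \<le> \<beta>" "b (\<sigma> \<gamma>') = b (\<sigma> \<alpha>) + real (Suc m) * T"
    using IVT'[OF _ Suc.prems(5) Suc.prems(4) cont] m by (auto simp: algebra_simps)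
  have "continuous_on {\<alpha>..\<gamma>'} (\<lambda>u. b (\<sigma> u))" using cont by (rule continuous_on_subset) (use g' in auto)
  then obtain \<gamma> where g: "\<alpha> \<le> \<gamma>" "\<gamma> \<le> \<gamma>'" "b (\<sigma> \<gamma>) = b (\<sigma> \<alpha>) + real m * T"
    using IVT'[of "\<lambda>u. b (\<sigma> u)" \<alpha> "b (\<sigma> \<alpha>) + real m * T" \<gamma>'] g' m by (auto simp: algebra_simps)
  have "real m * (T + \<rho> * e / R) \<le> \<gamma> - \<alpha>"
    by (rule Suc.IH) (use Suc.prems g g' in auto)
  moreover have "T + \<rho> * e / R \<le> \<gamma>' - \<gamma>"
    by (rule block_length[where \<sigma> = \<sigma>, OF _ _ _ \<rho>]) (use Suc.prems g g' in \<open>auto simp: algebra_simps\<close>)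
  moreover have "real (Suc m) * (T + \<rho> * e / R) = real m * (T + \<rho> * e / R) + (T + \<rho> * e / R)"
    by (simp add: distrib_right)
  ultimately show ?case using g' by linarith
qed

text \<open>Where flat strips of height \<open>R\<close> and width \<open>T\<close> are missing, a geodesic at height \<open>\<rho>\<close> is longer
  than its projection by a factor growing linearly in \<open>\<rho>\<close>.\<close>

lemma stretched:
  assumes M: "z \<in> M" "w \<in> M" and hi: "\<And>s. 0 \<le> s \<Longrightarrow> s \<le> 1 \<Longrightarrow> \<rho> \<le> H (pt z w s)" and \<rho>: "R \<le> \<rho>"
  shows "(\<bar>b z - b w\<bar> - T) * (1 + \<rho> * (e / (R * T))) \<le> d z w"
proof -
  have *: "(b w - b z - T) * (1 + \<rho> * (e / (R * T))) \<le> d z w"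
    if M: "z \<in> M" "w \<in> M" and hi: "\<And>s. 0 \<le> s \<Longrightarrow> s \<le> 1 \<Longrightarrow> \<rho> \<le> H (pt z w s)" and le: "b z \<le> b w" for z w
  proof (cases "d z w = 0")
    case True
    then have "z = w" using M zero by simp
    moreover have "- T * (1 + \<rho> * (e / (R * T))) \<le> 0"
      using pos \<rho> by (intro mult_nonpos_nonneg add_nonneg_nonneg mult_nonneg_nonneg) auto
    ultimately show ?thesis using True by simp
  next
    case False
    define L where "L = d z w"
    have L: "0 < L" using False nonneg[of z w] unfolding L_def by linarith
    obtain \<sigma> where \<sigma>: "\<forall>u\<in>{0..L}. \<sigma> u \<in> M \<and> \<sigma> u \<in> pt z w ` {0..1} \<and> d z (\<sigma> u) = u \<and> d (\<sigma> u) w = L - u"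
        "\<forall>u\<in>{0..L}. \<forall>v\<in>{0..L}. d (\<sigma> u) (\<sigma> v) = \<bar>u - v\<bar>" "\<sigma> 0 = z" "\<sigma> L = w"
      using unit_speed[OF M L[unfolded L_def]] unfolding L_def by blast
    \<comment> \<open>The number of complete blocks of width \<open>T\<close>; the incomplete one
      accounts for the \<open>- T\<close> in the claim.\<close>
    define m where "m = nat \<lfloor>(b w - b z) / T\<rfloor>"
    have q: "0 \<le> (b w - b z) / T" using le pos by simp
    have m: "real m \<le> (b w - b z) / T" "(b w - b z) / T - 1 \<le> real m"
      unfolding m_def using q by linarith+
    have "real m * (T + \<rho> * e / R) \<le> L - 0"
    proof (rule blocks_length[where \<sigma> = \<sigma>])
      show "\<rho> \<le> H (\<sigma> u)" if "u \<in> {0..L}" for u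
        using hi \<sigma>(1) that by fastforce
      have "real m * T \<le> b w - b z" using m pos by (simp add: pos_le_divide_eq)
      then show "b (\<sigma> 0) + real m * T \<le> b (\<sigma> L)" using \<sigma> by simp
    qed (use \<rho> L \<sigma> in auto)
    moreover have "((b w - b z) / T - 1) * (T + \<rho> * e / R) \<le> real m * (T + \<rho> * e / R)"
      using m pos \<rho> by (intro mult_right_mono) (auto intro!: add_nonneg_nonneg divide_nonneg_nonneg mult_nonneg_nonneg)
    moreover have "((b w - b z) / T - 1) * (T + \<rho> * e / R) = (b w - b z - T) * (1 + \<rho> * (e / (R * T)))"
      using pos by (simp add: field_simps)
    ultimately show ?thesis unfolding L_def by simp
  qed
  show ?thesis
  proof (cases "b z \<le> b w")
    case True then show ?thesis using *[OF M hi] by simp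
  next
    case False
    have "\<rho> \<le> H (pt w z s)" if "0 \<le> s" "s \<le> 1" for s
      using hi[of "1 - s"] pt_sym[of z w s] that M by simp
    then show ?thesis using *[of w z] M False by (simp add: commute)
  qed
qed

text \<open>Use \<open>stretched\<close> at height \<open>q / 4\<close>. Length and stretching are
  both proportional to \<open>q\<close>, which cancels, so the bound does not depend on the
  height.\<close>

lemma narrow:
  assumes M: "z \<in> M" "w \<in> M" and q: "4 * R \<le> q" and hi: "\<And>s. 0 \<le> s \<Longrightarrow> s \<le> 1 \<Longrightarrow> q / 4 \<le> H (pt z w s)"
    and len: "d z w \<le> 3 / 2 * q"
  shows "\<bar>b z - b w\<bar> \<le> T + 6 * R * T / e"
proof (cases "\<bar>b z - b w\<bar> \<le> T")
  case True then show ?thesis 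
    using pos by (intro order_trans[OF True]) (simp add: mult_nonneg_nonneg)
next
  case False
  define k where "k = e / (R * T)"
  have k: "0 < k" using pos unfolding k_def by simp
  have q0: "0 < q" using q pos by simp
  have "(\<bar>b z - b w\<bar> - T) * (q / 4 * k) \<le> (\<bar>b z - b w\<bar> - T) * (1 + q / 4 * k)"
    using False by (intro mult_left_mono) auto
  also have "\<dots> \<le> 3 / 2 * q"
    using stretched[OF M hi] q len unfolding k_def by simp
  finally have "q * ((\<bar>b z - b w\<bar> - T) * k) \<le> q * 6" by (simp add: algebra_simps)
  then have "(\<bar>b z - b w\<bar> - T) * k \<le> 6" using q0 by simp
  then have "\<bar>b z - b w\<bar> - T \<le> 6 / k" using k by (simp add: field_simps)
  also have "6 / k = 6 * R * T / e" unfolding k_def using pos by simp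
  finally show ?thesis by simp
qed

lemma H_pt_ge:
  assumes "z \<in> M" "w \<in> M" "0 \<le> s" "s \<le> 1"
  shows "(H z + H w - d z w) / 2 \<le> H (pt z w s)"
proof -
  note p = pt_props[OF assms]
  have "H z - H (pt z w s) \<le> s * d z w" "H w - H (pt z w s) \<le> (1 - s) * d z w"
    using H_lipschitz[of z "pt z w s"] H_lipschitz[of w "pt z w s"] p assms by (auto simp: commute)
  then show ?thesis by (simp add: algebra_simps)
qed

text \<open>If \<open>x\<close> is the higher point, it is first lowered to the height
  \<open>q\<close> of \<open>y\<close>. By \<open>CN\<close> the new distance is at most
  \<open>3 / 2 * q\<close>, because \<open>(11/10)\<^sup>2 + 1 \<le> (3/2)\<^sup>2\<close>; this is
  the origin of the tenth. A segment of this length between points of height \<open>q\<close> stays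
  above \<open>q / 4\<close>, as \<open>narrow\<close> demands.\<close>

lemma close_heights_narrow:
  assumes M: "x \<in> M" "y \<in> M" and xy: "d x y \<le> H x" and l: "\<bar>b x - b y\<bar> \<le> H y / 10" and q: "4 * R \<le> H y"
  shows "\<bar>b x - b y\<bar> \<le> T + 6 * R * T / e"
proof (cases "H y \<le> H x")
  case True
  define q r \<mu> where "q = H y" and "r = H x" and "\<mu> = q / r"
  have q0: "0 < q" "q \<le> r" using assms pos True unfolding q_def r_def by auto
  then have \<mu>: "0 \<le> \<mu>" "\<mu> \<le> 1" "q = \<mu> * r" unfolding \<mu>_def by auto
  define x' where "x' = lower q x"
  have x': "x' \<in> M" "b x' = b x" "H x' = q" unfolding x'_def using lower_props[of x q] M q0 r_def by auto
  have a: "d (c (b x)) y \<le> q + q / 10"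
    using triangle[of y "c (b y)" "c (b x)"] M l unfolding q_def H_def by (simp add: commute abs_minus_commute)
  have "(d x' y)\<^sup>2 \<le> (1 - \<mu>) * (d (c (b x)) y)\<^sup>2 + \<mu> * (d x y)\<^sup>2 - \<mu> * (1 - \<mu>) * (d (c (b x)) x)\<^sup>2"
    using CN[OF c_in M(1) M(2) \<mu>(1,2), of "b x"] unfolding x'_def lower_def r_def[symmetric] \<mu>_def .
  also have "d (c (b x)) x = r" unfolding r_def H_def by (simp add: commute)
  also have "(1 - \<mu>) * (d (c (b x)) y)\<^sup>2 + \<mu> * (d x y)\<^sup>2 - \<mu> * (1 - \<mu>) * r\<^sup>2
      \<le> (1 - \<mu>) * (q + q / 10)\<^sup>2 + \<mu> * r\<^sup>2 - \<mu> * (1 - \<mu>) * r\<^sup>2"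
    using a xy \<mu> unfolding r_def by (intro diff_right_mono add_mono mult_left_mono power_mono) auto
  also have "\<dots> = (1 - \<mu>) * (q + q / 10)\<^sup>2 + (\<mu> * r)\<^sup>2" by (simp add: power2_eq_square algebra_simps)
  also have "\<dots> \<le> 1 * (q + q / 10)\<^sup>2 + q\<^sup>2" unfolding \<mu>(3)[symmetric] using \<mu> by (intro add_mono mult_right_mono) auto
  also have "\<dots> \<le> (3 / 2 * q)\<^sup>2" by (simp add: power2_eq_square algebra_simps)
  finally have len: "d x' y \<le> 3 / 2 * q" by (rule power2_le_imp_le) (use q0 in auto)
  have "\<bar>b x' - b y\<bar> \<le> T + 6 * R * T / e"
  proof (rule narrow[OF x'(1) M(2) _ _ len])
    show "q / 4 \<le> H (pt x' y s)" if "0 \<le> s" "s \<le> 1" for s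
      using H_pt_ge[OF x'(1) M(2) that] len x'(3) q_def by simp
  qed (use q q_def in auto)
  then show ?thesis using x' by simp
next
  case False
  show ?thesis
  proof (rule narrow[OF M q])
    show "H y / 4 \<le> H (pt x y s)" if "0 \<le> s" "s \<le> 1" for s
    proof -
      have "H y / 2 \<le> (H x + H y - d x y) / 2" using xy by simp
      also have "\<dots> \<le> H (pt x y s)" using H_pt_ge[OF M that] .
      finally show ?thesis using H_nonneg[of y] by linarith
    qed
  qed (use xy False H_nonneg[of y] in linarith)
qed

text \<open>Move from \<open>y\<close> towards \<open>x\<close> until the remaining projection is a tenth of the distance \<open>u\<close>
  travelled. At that point the height is at least \<open>u\<close>, so the remaining projection is bounded by
  the previous lemma, and hence so are \<open>u\<close> and the whole projection.\<close>

lemma contracting_of_no_strip: "contracting (11 * (R + (T + 6 * R * T / e)))"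
  unfolding contracting_def
proof (intro ballI impI)
  fix x y assume M: "x \<in> M" "y \<in> M" and xy: "d x y \<le> H x"
  define C where "C = R + (T + 6 * R * T / e)"
  have "0 \<le> 6 * R * T / e" using pos by simp
  then have C: "R \<le> C" "T + 6 * R * T / e \<le> C" "0 \<le> C" using pos unfolding C_def by linarith+
  have "\<bar>b x - b y\<bar> \<le> 11 * C"
  proof (cases "d x y = 0")
    case True
    then have "x = y" using M zero by simp
    then show ?thesis using C by simp
  next
    case False
    define D where "D = d y x"
    have D: "0 < D" using False nonneg[of x y] unfolding D_def by (simp add: commute less_le)
    obtain \<sigma> where \<sigma>: "\<forall>u\<in>{0..D}. \<sigma> u \<in> M \<and> \<sigma> u \<in> pt y x ` {0..1} \<and> d y (\<sigma> u) = u \<and> d (\<sigma> u) x = D - u"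
        "\<forall>u\<in>{0..D}. \<forall>v\<in>{0..D}. d (\<sigma> u) (\<sigma> v) = \<bar>u - v\<bar>" "\<sigma> 0 = y" "\<sigma> D = x"
      using unit_speed[OF M(2,1) D[unfolded D_def]] unfolding D_def by blast
    have \<sigma>M: "\<sigma> u \<in> M" and \<sigma>d: "d y (\<sigma> u) = u" "d (\<sigma> u) x = D - u" if "u \<in> {0..D}" for u
      using \<sigma>(1) that by auto
    note iso = \<sigma>(2)[rule_format]
    have "continuous_on {0..D} (\<lambda>u. u / 10 - \<bar>b x - b (\<sigma> u)\<bar>)"
      using continuous_on_path(1)[of "{0..D}" \<sigma>] iso \<sigma>M by (intro continuous_intros) auto
    moreover have "0 \<le> D / 10 - \<bar>b x - b (\<sigma> D)\<bar>" using D \<sigma>(4) by simp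
    ultimately obtain u where u: "0 \<le> u" "u \<le> D" "u / 10 - \<bar>b x - b (\<sigma> u)\<bar> = 0"
      using IVT'[of "\<lambda>u. u / 10 - \<bar>b x - b (\<sigma> u)\<bar>" 0 0 D] D by auto
    have uD: "u \<in> {0..D}" using u by simp
    have Hu: "u \<le> H (\<sigma> u)" using H_lipschitz[OF \<sigma>M[OF uD] M(1)] \<sigma>d[OF uD] xy D_def by (simp add: commute)
    have "\<bar>b x - b (\<sigma> u)\<bar> \<le> C"
    proof (cases "4 * R \<le> H (\<sigma> u)")
      case True
      have "\<bar>b x - b (\<sigma> u)\<bar> \<le> T + 6 * R * T / e"
      proof (rule close_heights_narrow[OF M(1) \<sigma>M[OF uD] _ _ True])
        show "d x (\<sigma> u) \<le> H x" using \<sigma>d[OF uD] u xy D_def by (simp add: commute)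
        show "\<bar>b x - b (\<sigma> u)\<bar> \<le> H (\<sigma> u) / 10" using u Hu by simp
      qed
      then show ?thesis using C by simp
    next
      case False
      \<comment> \<open>Here \<open>u < 4 * R\<close>, and the remaining projection is only
        \<open>u / 10\<close>.\<close>
      then show ?thesis using Hu u C pos by linarith
    qed
    moreover have "\<bar>b (\<sigma> u) - b y\<bar> \<le> u" using b_lipschitz[OF \<sigma>M[OF uD] M(2)] \<sigma>d[OF uD] by (simp add: commute)
    \<comment> \<open>From \<open>u / 10 \<le> C\<close> one gets \<open>u \<le> 10 * C\<close>,
      whence the factor 11.\<close>
    ultimately show ?thesis using u(3) by linarith
  qed
  then show "\<bar>b x - b y\<bar> \<le> 11 * (R + (T + 6 * R * T / e))" unfolding C_def .
qed

end

theorem contracting_of_rank_one: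
  assumes "periodic \<tau>" "0 < \<tau>" "\<And>r. compactin mtopology (mcball (c 0) r)" "\<not> bounds_flat_half_plane c"
  shows "\<exists>B. contracting B"
proof -
  have "\<not> flat_strips" using flat_strips_half_plane assms by blast
  then obtain R T e where "0 < R" "0 < T" "0 < e" "\<And>t0 p.
     (\<forall>t\<in>{0..T}. p t \<in> M \<and> H (p t) = R \<and> b (p t) = t0 + t) \<Longrightarrow>
     \<not> (\<forall>t\<in>{0..T}. \<forall>s\<in>{0..T}. d (p t) (p s) \<le> \<bar>t - s\<bar> + e)"
    unfolding flat_strips_def by blast
  note RTe = this
  have "contracting (11 * (R + (T + 6 * R * T / e)))"
  proof (rule contracting_of_no_strip[OF RTe(1-3)])
    fix t0 p assume "\<And>t. t \<in> {0..T} \<Longrightarrow> p t \<in> M \<and> H (p t) = R \<and> b (p t) = t0 + t"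
    then have "\<not> (\<forall>t\<in>{0..T}. \<forall>s\<in>{0..T}. d (p t) (p s) \<le> \<bar>t - s\<bar> + e)" by (intro RTe(4)) blast
    then show "\<exists>t\<in>{0..T}. \<exists>s\<in>{0..T}. \<bar>t - s\<bar> + e < d (p t) (p s)" by (simp add: not_le)
  qed
  then show ?thesis by blast
qed


section \<open>Geodesics near a contracting line\<close>

lemma contracting_mono: "contracting B \<Longrightarrow> B \<le> B' \<Longrightarrow> contracting B'"
  unfolding contracting_def by fastforce

text \<open>At height at least \<open>2 * B\<close> a step of length \<open>2 * B\<close> moves the
  projection by at most \<open>B\<close>: the projection advances at half speed, up to an incomplete
  step.\<close>

lemma contracting_steps:
  assumes C: "contracting B" "0 < B"
    and \<sigma>: "\<And>u v. u \<in> {\<alpha>..\<beta>} \<Longrightarrow> v \<in> {\<alpha>..\<beta>} \<Longrightarrow> d (\<sigma> u) (\<sigma> v) = \<bar>u - v\<bar>"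
      "\<And>u. u \<in> {\<alpha>..\<beta>} \<Longrightarrow> \<sigma> u \<in> M" "\<And>u. u \<in> {\<alpha>..\<beta>} \<Longrightarrow> 2 * B \<le> H (\<sigma> u)"
    and ab: "\<alpha> \<le> \<beta>" "\<beta> - \<alpha> \<le> of_nat n * (2 * B)"
  shows "\<bar>b (\<sigma> \<alpha>) - b (\<sigma> \<beta>)\<bar> \<le> of_nat n * B"
  using \<sigma> ab
proof (induction n arbitrary: \<alpha>)
  case 0 then show ?case by simp
next
  case (Suc n)
  define \<gamma> where "\<gamma> = min (\<alpha> + 2 * B) \<beta>"
  have g: "\<alpha> \<le> \<gamma>" "\<gamma> \<le> \<beta>" "\<gamma> - \<alpha> \<le> 2 * B" "\<beta> - \<gamma> \<le> real n * (2 * B)"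
    using Suc.prems(4,5) C(2) unfolding \<gamma>_def by (auto simp: min_def algebra_simps)
  have "d (\<sigma> \<alpha>) (\<sigma> \<gamma>) \<le> H (\<sigma> \<alpha>)" using Suc.prems(1)[of \<alpha> \<gamma>] Suc.prems(3)[of \<alpha>] g by simp
  then have "\<bar>b (\<sigma> \<alpha>) - b (\<sigma> \<gamma>)\<bar> \<le> B"
    using C(1) Suc.prems(2) g unfolding contracting_def by simp
  moreover have "\<bar>b (\<sigma> \<gamma>) - b (\<sigma> \<beta>)\<bar> \<le> real n * B"
    by (rule Suc.IH) (use Suc.prems g in auto)
  ultimately show ?case by (simp add: algebra_simps)
qed

text \<open>End pieces as long as the heights of the ends move the projection by at most
  \<open>B\<close> each, and a middle piece of length \<open>L\<close> by at most
  \<open>L / 2 + B\<close>. A geodesic is no longer than the detour along the line, so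
  \<open>L\<close> is at most the projected length. Hence \<open>L \<le> L / 2 + 3 * B\<close>, that
  is \<open>L \<le> 6 * B\<close>.\<close>

lemma contracting_avoid:
  assumes C: "contracting B" "0 < B"
    and \<sigma>: "\<And>u v. u \<in> {\<alpha>..\<beta>} \<Longrightarrow> v \<in> {\<alpha>..\<beta>} \<Longrightarrow> d (\<sigma> u) (\<sigma> v) = \<bar>u - v\<bar>"
      "\<And>u. u \<in> {\<alpha>..\<beta>} \<Longrightarrow> \<sigma> u \<in> M" "\<And>u. u \<in> {\<alpha>..\<beta>} \<Longrightarrow> 2 * B \<le> H (\<sigma> u)"
    and ab: "\<alpha> \<le> \<beta>"
  shows "\<bar>b (\<sigma> \<alpha>) - b (\<sigma> \<beta>)\<bar> \<le> 6 * B"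
proof -
  let ?P = "H (\<sigma> \<alpha>)" and ?Q = "H (\<sigma> \<beta>)"
  have ball: "\<bar>b (\<sigma> u) - b (\<sigma> v)\<bar> \<le> B" if "u \<in> {\<alpha>..\<beta>}" "v \<in> {\<alpha>..\<beta>}" "\<bar>u - v\<bar> \<le> H (\<sigma> u)" for u v
    using C(1) \<sigma>(1,2) that unfolding contracting_def by simp
  have in': "\<alpha> \<in> {\<alpha>..\<beta>}" "\<beta> \<in> {\<alpha>..\<beta>}" using ab by auto
  show ?thesis
  proof (cases "\<beta> - \<alpha> \<le> ?P + ?Q")
    case True
    define \<gamma> where "\<gamma> = min (\<alpha> + ?P) \<beta>"
    have g: "\<gamma> \<in> {\<alpha>..\<beta>}" "\<bar>\<alpha> - \<gamma>\<bar> \<le> ?P" "\<bar>\<beta> - \<gamma>\<bar> \<le> ?Q" using True ab H_nonneg[of "\<sigma> \<alpha>"] H_nonneg[of "\<sigma> \<beta>"]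
      unfolding \<gamma>_def by (auto simp: min_def)
    show ?thesis using ball[OF in'(1) g(1,2)] ball[OF in'(2) g(1,3)] C(2) by linarith
  next
    case False
    define \<gamma> \<gamma>' where "\<gamma> = \<alpha> + ?P" and "\<gamma>' = \<beta> - ?Q"
    have g: "\<gamma> \<in> {\<alpha>..\<beta>}" "\<gamma>' \<in> {\<alpha>..\<beta>}" "\<gamma> \<le> \<gamma>'" "\<bar>\<alpha> - \<gamma>\<bar> \<le> ?P" "\<bar>\<beta> - \<gamma>'\<bar> \<le> ?Q"
      using False H_nonneg[of "\<sigma> \<alpha>"] H_nonneg[of "\<sigma> \<beta>"]
      unfolding \<gamma>_def \<gamma>'_def atLeastAtMost_iff by linarith+
    define n where "n = nat \<lceil>(\<gamma>' - \<gamma>) / (2 * B)\<rceil>"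
    have "0 \<le> (\<gamma>' - \<gamma>) / (2 * B)" using g(3) C(2) by simp
    then have n: "(\<gamma>' - \<gamma>) / (2 * B) \<le> real n" "real n \<le> (\<gamma>' - \<gamma>) / (2 * B) + 1"
      unfolding n_def by linarith+
    have "\<bar>b (\<sigma> \<gamma>) - b (\<sigma> \<gamma>')\<bar> \<le> real n * B"
    proof (rule contracting_steps[OF C])
      show "\<gamma>' - \<gamma> \<le> real n * (2 * B)" using n(1) C(2) by (simp add: field_simps)
    qed (use \<sigma> g in auto)
    also have "\<dots> \<le> ((\<gamma>' - \<gamma>) / (2 * B) + 1) * B" using n(2) C(2) by (intro mult_right_mono) auto
    also have "\<dots> = (\<gamma>' - \<gamma>) / 2 + B" using C(2) by (simp add: field_simps)
    finally have 1: "\<bar>b (\<sigma> \<gamma>) - b (\<sigma> \<gamma>')\<bar> \<le> (\<gamma>' - \<gamma>) / 2 + B" .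
    have "d (\<sigma> \<alpha>) (\<sigma> \<beta>) \<le> ?P + \<bar>b (\<sigma> \<alpha>) - b (\<sigma> \<beta>)\<bar> + ?Q"
      using triangle[of "\<sigma> \<alpha>" "c (b (\<sigma> \<alpha>))" "\<sigma> \<beta>"] triangle[of "c (b (\<sigma> \<alpha>))" "c (b (\<sigma> \<beta>))" "\<sigma> \<beta>"]
        \<sigma>(2)[OF in'(1)] \<sigma>(2)[OF in'(2)] unfolding H_def by (simp add: commute)
    then have "\<gamma>' - \<gamma> \<le> \<bar>b (\<sigma> \<alpha>) - b (\<sigma> \<beta>)\<bar>" using \<sigma>(1)[OF in'] ab unfolding \<gamma>_def \<gamma>'_def by simp
    moreover have "\<bar>b (\<sigma> \<alpha>) - b (\<sigma> \<beta>)\<bar>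
        \<le> \<bar>b (\<sigma> \<alpha>) - b (\<sigma> \<gamma>)\<bar> + \<bar>b (\<sigma> \<gamma>) - b (\<sigma> \<gamma>')\<bar> + \<bar>b (\<sigma> \<beta>) - b (\<sigma> \<gamma>')\<bar>"
      by linarith
    ultimately show ?thesis using 1 ball[OF in'(1) g(1,4)] ball[OF in'(2) g(2,5)] by argo
  qed
qed

text \<open>The equation says that \<open>z\<close> lies on the geodesic from \<open>x\<close> to
  \<open>y\<close> without naming it. Only the entry point near the foot of \<open>x\<close> is
  demanded; exchanging \<open>x\<close> and \<open>y\<close> gives the exit.\<close>

definition gate :: "real \<Rightarrow> bool" where
  "gate K \<longleftrightarrow> (\<forall>x\<in>M. \<forall>y\<in>M. K < \<bar>b x - b y\<bar> \<longrightarrow>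
     (\<exists>z\<in>M. d x z + d z y = d x y \<and> d z (c (b x)) \<le> K))"

text \<open>The gate is the first point of the geodesic at height \<open>2 * B\<close>, which exists
  because the projection is too long for \<open>contracting_avoid\<close>. Up to it the projection
  moves by at most \<open>6 * B\<close>, again by that lemma.\<close>

lemma contracting_gate:
  assumes C: "contracting B" "0 < B"
  shows "gate (8 * B)"
  unfolding gate_def
proof (intro ballI impI)
  fix x y assume M: "x \<in> M" "y \<in> M" and far: "8 * B < \<bar>b x - b y\<bar>"
  show "\<exists>z\<in>M. d x z + d z y = d x y \<and> d z (c (b x)) \<le> 8 * B"
  proof (cases "H x \<le> 2 * B")
    case True
    then show ?thesis using M C(2) unfolding H_def by (intro bexI[of _ x]) auto
  next
    case False
    define D where "D = d x y"
    have D: "0 < D" using b_lipschitz[OF M] far C(2) unfolding D_def by linarith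
    obtain \<sigma> where \<sigma>: "\<forall>u\<in>{0..D}. \<sigma> u \<in> M \<and> \<sigma> u \<in> pt x y ` {0..1} \<and> d x (\<sigma> u) = u \<and> d (\<sigma> u) y = D - u"
        "\<forall>u\<in>{0..D}. \<forall>v\<in>{0..D}. d (\<sigma> u) (\<sigma> v) = \<bar>u - v\<bar>" and ends: "\<sigma> 0 = x" "\<sigma> D = y"
      using unit_speed[OF M D[unfolded D_def]] unfolding D_def by blast
    have \<sigma>M: "\<sigma> u \<in> M" if "u \<in> {0..D}" for u using \<sigma>(1) that by blast
    note iso = \<sigma>(2)[rule_format]
    have cont: "continuous_on {0..D} (\<lambda>u. H (\<sigma> u))" using continuous_on_path(2)[of "{0..D}" \<sigma>] iso \<sigma>M by blast
    define Z where "Z = {0..D} \<inter> (\<lambda>u. H (\<sigma> u)) -` {..2 * B}"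
    have "closed Z" unfolding Z_def by (rule continuous_closed_preimage[OF cont]) auto
    then have cZ: "compact Z" using compact_Icc[of 0 D] compact_Int_closed[of "{0..D}" Z] unfolding Z_def by (simp add: Int_absorb1)
    have "Z \<noteq> {}"
    proof
      assume "Z = {}"
      then have "2 * B \<le> H (\<sigma> u)" if "u \<in> {0..D}" for u using that unfolding Z_def by force
      then have "\<bar>b (\<sigma> 0) - b (\<sigma> D)\<bar> \<le> 6 * B"
        using contracting_avoid[OF C, of 0 D \<sigma>] iso \<sigma>M D by simp
      then show False using ends far C(2) by simp
    qed
    then obtain u where u: "u \<in> Z" "\<And>v. v \<in> Z \<Longrightarrow> u \<le> v" using compact_attains_inf[OF cZ] by blast
    have uD: "u \<in> {0..D}" "H (\<sigma> u) \<le> 2 * B" using u(1) unfolding Z_def by auto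
    have Hu: "H (\<sigma> u) = 2 * B"
    proof (rule ccontr)
      assume "H (\<sigma> u) \<noteq> 2 * B"
      have "continuous_on {0..u} (\<lambda>u. H (\<sigma> u))" using cont by (rule continuous_on_subset) (use uD in auto)
      then obtain v where v: "0 \<le> v" "v \<le> u" "H (\<sigma> v) = 2 * B"
        using IVT2'[of "\<lambda>u. H (\<sigma> u)" u "2 * B" 0] uD False ends by auto
      then have "v \<in> Z" using uD unfolding Z_def by auto
      then show False using u(2)[of v] v \<open>H (\<sigma> u) \<noteq> 2 * B\<close> by simp
    qed
    have "\<bar>b (\<sigma> 0) - b (\<sigma> u)\<bar> \<le> 6 * B"
    proof (rule contracting_avoid[OF C])
      show "2 * B \<le> H (\<sigma> v)" if "v \<in> {0..u}" for v
      proof (rule ccontr)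
        assume n: "\<not> 2 * B \<le> H (\<sigma> v)"
        then have "v \<in> Z" using that uD unfolding Z_def by auto
        then show False using u(2)[of v] that Hu n by simp
      qed
    qed (use uD iso \<sigma>M in auto)
    moreover have "d (\<sigma> u) (c (b x)) \<le> H (\<sigma> u) + \<bar>b (\<sigma> u) - b x\<bar>"
      unfolding H_def using triangle[of "\<sigma> u" "c (b (\<sigma> u))" "c (b x)"] \<sigma>M uD by simp
    ultimately have "d (\<sigma> u) (c (b x)) \<le> 8 * B" using Hu ends by (simp add: abs_minus_commute)
    moreover have "d x (\<sigma> u) + d (\<sigma> u) y = d x y"
      using iso[of 0 u] iso[of u D] uD D ends D_def by simp
    ultimately show ?thesis using \<sigma>M uD by (intro bexI[of _ "\<sigma> u"]) auto
  qed
qed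

lemma gate_length:
  assumes g: "gate K" and M: "x \<in> M" "y \<in> M" and far: "K < \<bar>b x - b y\<bar>"
  shows "d x (c (b x)) + d (c (b x)) y - 2 * K \<le> d x y"
    and "H x + \<bar>b x - b y\<bar> + H y - 4 * K \<le> d x y"
proof -
  have *: "d x (c (b x)) + d (c (b x)) y - 2 * K \<le> d x y"
    if "x \<in> M" "y \<in> M" "K < \<bar>b x - b y\<bar>" for x y
  proof -
    obtain z where "z \<in> M" "d x z + d z y = d x y" "d z (c (b x)) \<le> K"
      using g \<open>x \<in> M\<close> \<open>y \<in> M\<close> \<open>K < \<bar>b x - b y\<bar>\<close> unfolding gate_def by blast
    then show ?thesis
      using triangle[of x z "c (b x)"] triangle[of "c (b x)" z y] that by (simp add: commute)
  qed
  show "d x (c (b x)) + d (c (b x)) y - 2 * K \<le> d x y" by (rule *[OF M far])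
  \<comment> \<open>The first bound, used once more from \<open>y\<close> to the foot of
    \<open>x\<close>, costs another \<open>2 * K\<close>.\<close>
  moreover have "H y + \<bar>b x - b y\<bar> - 2 * K \<le> d y (c (b x))"
    using *[of y "c (b x)"] M far unfolding H_def by (simp add: abs_minus_commute)
  ultimately show "H x + \<bar>b x - b y\<bar> + H y - 4 * K \<le> d x y"
    unfolding H_def by (simp add: commute)
qed

lemma b_on_perpendicular:
  assumes "x \<in> M" "z \<in> M" "d (c (b x)) z + d z x = H x"
  shows "b z = b x"
proof (rule b_uniqueI)
  fix t
  have "H x \<le> d x z + d z (c t)" using H_le[OF assms(1), of t] triangle[of x z "c t"] assms by simp
  then show "d z (c (b x)) \<le> d z (c t)" using assms(3) by (simp add: commute)
qed (use assms in auto)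

end

section \<open>Actions on CAT(0) spaces\<close>

locale CAT0_action = CAT0_space Y d + geometric_action Y d G \<phi>
  for Y :: "'b set" and d and G :: "('a, 'c) monoid_scheme" (structure) and \<phi>
begin

sublocale group G using group_hom by (rule group_hom.axioms)

lemma act_in [simp, intro]: "g \<in> carrier G \<Longrightarrow> x \<in> Y \<Longrightarrow> \<phi> g x \<in> Y"
  using element_image by blast

lemma act_mult: "g \<in> carrier G \<Longrightarrow> k \<in> carrier G \<Longrightarrow> x \<in> Y \<Longrightarrow> \<phi> (g \<otimes> k) x = \<phi> g (\<phi> k x)"
  using composition_rule by blast

lemma act_one [simp]: "x \<in> Y \<Longrightarrow> \<phi> \<one> x = x"
  using id_eq_one by (metis restrict_apply')

lemma act_inv [simp]:
  assumes "g \<in> carrier G" "x \<in> Y"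
  shows "\<phi> (inv g) (\<phi> g x) = x" "\<phi> g (\<phi> (inv g) x) = x"
  using act_mult[of "inv g" g x] act_mult[of g "inv g" x] assms by simp_all

lemma act_dist [simp]: "g \<in> carrier G \<Longrightarrow> x \<in> Y \<Longrightarrow> y \<in> Y \<Longrightarrow> d (\<phi> g x) (\<phi> g y) = d x y"
  by (rule isometric)

lemma act_dist_inv: "g \<in> carrier G \<Longrightarrow> x \<in> Y \<Longrightarrow> y \<in> Y \<Longrightarrow> d (\<phi> (inv g) x) y = d x (\<phi> g y)"
  using act_dist[of g "\<phi> (inv g) x" y] by simp

lemma finite_displacement: "x \<in> Y \<Longrightarrow> finite {g \<in> carrier G. d x (\<phi> g x) \<le> n}"
  by (rule finite_subset[OF _ proper[of x "max n 0"]]) auto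

end

locale line_action = CAT0_action Y d G \<phi> + CAT0_line Y d c
  for Y :: "'b set" and d and G :: "('a, 'c) monoid_scheme" (structure) and \<phi> and c +
  fixes h :: 'a and \<tau> :: real
  assumes h [simp]: "h \<in> carrier G" and \<tau>: "0 < \<tau>" and h_c: "\<And>t. \<phi> h (c t) = c (t + \<tau>)"
begin

abbreviation pow :: "int \<Rightarrow> 'a" where "pow n \<equiv> h [^] n"

lemma pow_c: "\<phi> (pow n) (c t) = c (t + of_int n * \<tau>)"
proof -
  have nat: "\<phi> (h [^] n) (c t) = c (t + of_nat n * \<tau>)" for n :: nat and t
  proof (induction n arbitrary: t)
    case (Suc n)
    have "\<phi> (h [^] Suc n) (c t) = \<phi> (h [^] n) (\<phi> h (c t))" by (simp add: act_mult)
    then show ?case using Suc by (simp add: h_c algebra_simps)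
  qed simp
  show ?thesis
  proof (cases n rule: int_cases2)
    case (nonneg m)
    then show ?thesis using nat by (simp add: int_pow_int)
  next
    case (nonpos m)
    have "\<phi> (pow n) (c t) = \<phi> (inv (h [^] m)) (\<phi> (h [^] m) (c (t - of_nat m * \<tau>)))"
      using nonpos nat[of m "t - of_nat m * \<tau>"] by (simp add: int_pow_neg_int)
    also have "\<dots> = c (t - of_nat m * \<tau>)" by (rule act_inv) auto
    finally show ?thesis using nonpos by simp
  qed
qed

lemma pow_b:
  assumes "x \<in> Y" shows "b (\<phi> (pow n) x) = b x + of_int n * \<tau>" "H (\<phi> (pow n) x) = H x"
  using b_translate[of "\<phi> (pow n)" "of_int n * \<tau>" x] assms pow_c by auto

end

section \<open>Transversal and elementary group elements\<close>

locale axis_action = line_action Y d G \<phi> c h \<tau>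
  for Y :: "'b set" and d and G :: "('a, 'c) monoid_scheme" (structure) and \<phi> c h \<tau> +
  fixes K :: real
  assumes contr: "contracting K" and gate: "gate K"
begin

lemma K_nonneg: "0 \<le> K"
proof -
  have "\<bar>b (c 0) - b (c 0)\<bar> \<le> K" using contr unfolding contracting_def by (metis H_nonneg c_in mdist_zero zero)
  then show ?thesis by simp
qed

text \<open>The conditions bound the projection of the translate of the axis by \<open>a\<close> to
  the axis, and that of the axis to the translate, the latter pulled back by
  \<open>a\<close>.\<close>

definition transversal :: "real \<Rightarrow> 'a \<Rightarrow> bool" where
  "transversal m a \<longleftrightarrow> a \<in> carrier G \<and> (\<forall>t. \<bar>b (\<phi> a (c t))\<bar> \<le> m \<and> \<bar>b (\<phi> (inv a) (c t))\<bar> \<le> m)"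

lemma transversal_inv: "transversal m a \<Longrightarrow> transversal m (inv a)"
  unfolding transversal_def by auto

text \<open>This is Behrstock's inequality for the axis and its translate by \<open>a\<close>. If
  \<open>\<phi> a x\<close> projected far, the perpendicular from it to its foot \<open>z\<close> on
  the translate would pass near the axis, at \<open>v\<close>. Pulled back by \<open>a\<close>, this
  point has the same foot as \<open>x\<close>, but it is also close to the translate by
  \<open>inv a\<close>, which projects near 0.\<close>

lemma ping_pong:
  assumes a: "transversal m a" and x: "x \<in> Y" and far: "m + K < \<bar>b x\<bar>"
  shows "\<bar>b (\<phi> a x)\<bar> \<le> m + K"
proof (rule ccontr)
  assume n: "\<not> \<bar>b (\<phi> a x)\<bar> \<le> m + K"
  have aG: "a \<in> carrier G" and m: "\<bar>b (\<phi> a (c t))\<bar> \<le> m" "\<bar>b (\<phi> (inv a) (c t))\<bar> \<le> m" for t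
    using a unfolding transversal_def by auto
  define z where "z = \<phi> a (c (b x))"
  have z: "z \<in> Y" "\<bar>b z\<bar> \<le> m" unfolding z_def using aG m by auto
  have "K < \<bar>b z - b (\<phi> a x)\<bar>" using n z by linarith
  then obtain v where v: "v \<in> Y" "d z v + d v (\<phi> a x) = d z (\<phi> a x)" "d v (c (b z)) \<le> K"
    using gate z aG x unfolding gate_def by blast
  define v' where "v' = \<phi> (inv a) v"
  have v': "v' \<in> Y" "v = \<phi> a v'" unfolding v'_def using aG v by auto
  have "d (c (b x)) v' + d v' x = d (c (b x)) x" using v(2) aG x v' unfolding v'(2) z_def by simp
  then have "b v' = b x" using b_on_perpendicular[of x v'] x v' unfolding H_def by (simp add: commute)
  moreover have "\<bar>b v' - b (\<phi> (inv a) (c (b z)))\<bar> \<le> K"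
    using b_lipschitz[of v' "\<phi> (inv a) (c (b z))"] v(3) aG v v' unfolding v'_def by simp
  ultimately show False using m(2)[of "b z"] far by linarith
qed

lemma transversal_ping_pong:
  assumes "transversal m a" "2 * m + 2 * K < \<bar>of_int n\<bar> * \<tau>" and e: "e \<in> Y" "\<bar>b e\<bar> \<le> m + K"
  shows "\<bar>b (\<phi> (a \<otimes> pow n) e)\<bar> \<le> m + K" "\<phi> (inv a) (\<phi> (a \<otimes> pow n) e) = \<phi> (pow n) e"
proof -
  have aG: "a \<in> carrier G" using assms unfolding transversal_def by auto
  have "\<bar>of_int n * \<tau>\<bar> = \<bar>of_int n\<bar> * \<tau>" using \<tau> by (simp add: abs_mult)
  then have "m + K < \<bar>b (\<phi> (pow n) e)\<bar>" using pow_b(1)[OF e(1), of n] assms by linarith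
  then show "\<bar>b (\<phi> (a \<otimes> pow n) e)\<bar> \<le> m + K" using ping_pong assms e aG by (simp add: act_mult)
  show "\<phi> (inv a) (\<phi> (a \<otimes> pow n) e) = \<phi> (pow n) e" using e aG by (simp add: act_mult)
qed

text \<open>These elements commensurate the cyclic group generated by \<open>h\<close>.\<close>

definition elementary :: "'a \<Rightarrow> bool" where
  "elementary g \<longleftrightarrow> g \<in> carrier G \<and>
     (\<exists>m n :: int. m \<noteq> 0 \<and> n \<noteq> 0 \<and> g \<otimes> pow m = pow n \<otimes> g)"

lemma elementary_inv:
  assumes "elementary g" shows "elementary (inv g)"
proof -
  obtain m n :: int where g: "g \<in> carrier G" and mn: "m \<noteq> 0" "n \<noteq> 0" "g \<otimes> pow m = pow n \<otimes> g"
    using assms unfolding elementary_def by auto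
  have "inv g \<otimes> pow n = inv g \<otimes> (pow n \<otimes> g) \<otimes> inv g" using g by (simp add: m_assoc)
  also have "\<dots> = pow m \<otimes> inv g" unfolding mn(3)[symmetric] using g by (simp add: m_assoc[symmetric])
  finally show ?thesis using g mn unfolding elementary_def by auto
qed

lemma intertwine_int_pow:
  assumes G: "g \<in> carrier G" "x \<in> carrier G" "y \<in> carrier G" and e: "g \<otimes> x = y \<otimes> g"
  shows "g \<otimes> x [^] (k::int) = y [^] k \<otimes> g"
proof -
  have nat: "g \<otimes> x [^] (k::nat) = y [^] k \<otimes> g"
    if "x \<in> carrier G" "y \<in> carrier G" "g \<otimes> x = y \<otimes> g" for x y and k :: nat
  proof (induction k)
    case 0 then show ?case using G by simp
  next
    case (Suc k)
    have "g \<otimes> x [^] Suc k = (g \<otimes> x [^] k) \<otimes> x" using that G by (simp add: m_assoc)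
    also have "\<dots> = y [^] k \<otimes> (g \<otimes> x)" unfolding Suc using that G by (simp add: m_assoc)
    also have "\<dots> = y [^] Suc k \<otimes> g" unfolding that(3) using that G by (simp add: m_assoc)
    finally show ?case .
  qed
  show ?thesis
  proof (cases k rule: int_cases2)
    case (nonneg n) then show ?thesis using nat[OF G(2,3) e] by (simp add: int_pow_int)
  next
    case (nonpos n)
    have "g \<otimes> inv x = inv y \<otimes> (y \<otimes> g) \<otimes> inv x" using G by (simp add: m_assoc[symmetric])
    also have "\<dots> = inv y \<otimes> g" unfolding e[symmetric] using G by (simp add: m_assoc)
    finally have "g \<otimes> inv x [^] n = inv y [^] n \<otimes> g" using nat[of "inv x" "inv y"] G by simp
    then show ?thesis using nonpos G by (simp add: int_pow_neg_int nat_pow_inv)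
  qed
qed

lemma pow_eq_one: assumes "pow n = \<one>" shows "n = 0"
proof -
  have "c (0 + of_int n * \<tau>) = c 0" using pow_c[of n 0] assms by simp
  then have "b (c (0 + of_int n * \<tau>)) = b (c 0)" by simp
  then show ?thesis using \<tau> by simp
qed

text \<open>The gate on the geodesic from \<open>\<phi> g (c t)\<close> to
  \<open>\<phi> g (c 0)\<close> lies on the translated axis. It projects close to the foot of the
  first point, hence far from that of the second, which forces its parameter to be large.\<close>

lemma near_points:
  assumes g: "g \<in> carrier G" and unb: "\<And>N. \<exists>t. N < \<bar>b (\<phi> g (c t))\<bar>"
  shows "\<exists>s. N \<le> \<bar>s\<bar> \<and> H (\<phi> g (c s)) \<le> K"
proof -
  obtain t where t: "max N 0 + K + \<bar>b (\<phi> g (c 0))\<bar> < \<bar>b (\<phi> g (c t))\<bar>" using unb by blast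
  have "K < \<bar>b (\<phi> g (c t)) - b (\<phi> g (c 0))\<bar>" using t by linarith
  then obtain z where z: "z \<in> Y" "d (\<phi> g (c t)) z + d z (\<phi> g (c 0)) = d (\<phi> g (c t)) (\<phi> g (c 0))"
      "d z (c (b (\<phi> g (c t)))) \<le> K"
    using gate g unfolding gate_def by blast
  define z' where "z' = \<phi> (inv g) z"
  have z': "z' \<in> Y" "z = \<phi> g z'" unfolding z'_def using g z by auto
  have e: "d (c t) z' + d z' (c 0) = \<bar>t\<bar>" using z(2) g z' unfolding z'(2) by simp
  obtain s where z'c: "z' = c s" using between_line[of z' t 0] z' e by auto
  have "H z \<le> K" using H_le[OF z(1)] z(3) order_trans by blast
  moreover have "N \<le> \<bar>s\<bar>"
  proof -
    have "\<bar>b z - b (\<phi> g (c t))\<bar> \<le> K" using b_lipschitz[OF z(1) c_in, of "b (\<phi> g (c t))"] z(3) by simp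
    moreover have "\<bar>b z - b (\<phi> g (c 0))\<bar> \<le> d z (\<phi> g (c 0))" using b_lipschitz z g by simp
    moreover have "d z (\<phi> g (c 0)) = \<bar>s\<bar>" unfolding z'(2) z'c using g by simp
    ultimately show ?thesis using t by linarith
  qed
  ultimately show ?thesis using z'(2) z'c by blast
qed

lemma H_line_convex:
  assumes g: "g \<in> carrier G" and "H (\<phi> g (c s)) \<le> k" "H (\<phi> g (c t)) \<le> k" "s \<le> u" "u \<le> t"
  shows "H (\<phi> g (c u)) \<le> k"
proof (cases "s = t")
  case False
  define l where "l = (u - s) / (t - s)"
  have l: "0 \<le> l" "l \<le> 1" using assms False unfolding l_def by auto
  have "l * (t - s) = u - s" unfolding l_def using False by simp
  then have u: "u = (1 - l) * s + l * t" by (simp add: algebra_simps)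
  have "pt (\<phi> g (c s)) (\<phi> g (c t)) l = \<phi> g (c u)"
  proof (rule pt_unique)
    have "d (c s) (c u) = l * d (c s) (c t)" "d (c u) (c t) = (1 - l) * d (c s) (c t)"
      using pt_props[OF c_in c_in l, of s t] unfolding pt_c[OF l] u by auto
    then show "d (\<phi> g (c s)) (\<phi> g (c u)) = l * d (\<phi> g (c s)) (\<phi> g (c t))"
      "d (\<phi> g (c u)) (\<phi> g (c t)) = (1 - l) * d (\<phi> g (c s)) (\<phi> g (c t))"
      using g by (simp_all del: c_dist)
  qed (use g l in auto)
  then have "H (\<phi> g (c u)) \<le> (1 - l) * H (\<phi> g (c s)) + l * H (\<phi> g (c t))"
    using H_convex[of "\<phi> g (c s)" "\<phi> g (c t)" l] g l by simp
  also have "\<dots> \<le> (1 - l) * k + l * k" using assms l by (intro add_mono mult_left_mono) auto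
  finally show ?thesis by (simp add: algebra_simps)
qed (use assms in auto)

text \<open>By \<open>near_points\<close> and convexity of the height, a ray of the translated axis
  stays within \<open>K\<close> of the axis. The elements \<open>u i\<close>, which compare
  \<open>g\<close> times powers of \<open>h\<close> with powers of \<open>h\<close>, then move one
  point by a bounded amount. By properness two of them coincide, which is the relation
  sought.\<close>

lemma unbounded_elementary:
  assumes g: "g \<in> carrier G" and unb: "\<And>N. \<exists>t. N < \<bar>b (\<phi> g (c t))\<bar>"
  shows "elementary g"
proof -
  \<comment> \<open>\<open>e\<close> is 1 or -1, the direction in which the ray runs.\<close>
  obtain e :: int and s0 :: real where e: "e \<noteq> 0" and ray: "\<And>i::nat. H (\<phi> g (c (s0 + of_int (e * int i) * \<tau>))) \<le> K"
  proof -
    consider "\<forall>N. \<exists>s\<ge>N. H (\<phi> g (c s)) \<le> K" | "\<forall>N. \<exists>s\<le>-N. H (\<phi> g (c s)) \<le> K"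
    proof (cases "\<forall>N. \<exists>s\<ge>N. H (\<phi> g (c s)) \<le> K")
      case False
      then obtain N0 where N0: "\<And>s. N0 \<le> s \<Longrightarrow> \<not> H (\<phi> g (c s)) \<le> K" by blast
      have "\<exists>s\<le>-N. H (\<phi> g (c s)) \<le> K" for N
        using near_points[OF g unb, of "max \<bar>N\<bar> \<bar>N0\<bar>"] N0 by (smt (verit))
      then show thesis using that by blast
    qed (use that in blast)
    then show thesis
    proof cases
      case 1
      obtain s0 where s0: "H (\<phi> g (c s0)) \<le> K" using 1 by blast
      have "H (\<phi> g (c (s0 + of_int (1 * int i) * \<tau>))) \<le> K" for i
      proof -
        obtain t where "s0 + real i * \<tau> \<le> t" "H (\<phi> g (c t)) \<le> K" using 1 by blast
        then show ?thesis using H_line_convex[OF g s0, of t "s0 + real i * \<tau>"] \<tau> by simp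
      qed
      then show thesis using that[of 1 s0] by simp
    next
      case 2
      obtain s0 where s0: "H (\<phi> g (c s0)) \<le> K" using 2 by blast
      have "H (\<phi> g (c (s0 + of_int (- 1 * int i) * \<tau>))) \<le> K" for i
      proof -
        obtain t where "t \<le> - (real i * \<tau> - s0)" "H (\<phi> g (c t)) \<le> K" using 2 by blast
        then show ?thesis using H_line_convex[OF g _ s0, of t "s0 - real i * \<tau>"] \<tau> by simp
      qed
      then show thesis using that[of "-1" s0] by simp
    qed
  qed
  define p where "p i = \<phi> g (c (s0 + of_int (e * int i) * \<tau>))" for i :: nat
  have pY: "p i \<in> Y" for i unfolding p_def using g by auto
  have p: "p i = \<phi> (g \<otimes> pow (e * int i)) (c s0)" for i
    unfolding p_def using g by (simp add: act_mult pow_c)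
  have "\<exists>j::int. \<bar>b (p i) - (s0 + of_int j * \<tau>)\<bar> \<le> \<tau>" for i
  proof -
    obtain j :: int where "of_int j * \<tau> \<le> b (p i) - s0" "b (p i) - s0 < of_int j * \<tau> + \<tau>"
      using multiple_below[OF \<tau>] .
    then show ?thesis by (intro exI[of _ j]) (simp add: abs_le_iff)
  qed
  then obtain j :: "nat \<Rightarrow> int" where j: "\<And>i. \<bar>b (p i) - (s0 + of_int (j i) * \<tau>)\<bar> \<le> \<tau>" by metis
  define u where "u i = inv (pow (j i)) \<otimes> (g \<otimes> pow (e * int i))" for i
  have uG: "u i \<in> carrier G" for i unfolding u_def using g by simp
  have "d (c s0) (\<phi> (u i) (c s0)) \<le> K + \<tau>" for i
  proof -
    have "d (c s0) (\<phi> (u i) (c s0)) = d (c (s0 + of_int (j i) * \<tau>)) (p i)"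
      unfolding u_def p using g act_dist_inv[of "pow (j i)" "\<phi> (g \<otimes> pow (e * int i)) (c s0)" "c s0"]
      by (simp add: act_mult[of "inv (pow (j i))"] pow_c commute)
    also have "\<dots> \<le> d (c (s0 + of_int (j i) * \<tau>)) (c (b (p i))) + d (c (b (p i))) (p i)"
      using pY by (intro triangle) auto
    also have "\<dots> \<le> \<tau> + K" using j[of i] ray[of i] unfolding p_def[symmetric] H_def
      by (intro add_mono) (simp_all add: commute abs_minus_commute)
    finally show ?thesis by simp
  qed
  then have "range u \<subseteq> {g \<in> carrier G. d (c s0) (\<phi> g (c s0)) \<le> K + \<tau>}" using uG by auto
  then have "finite (range u)" using finite_displacement[OF c_in] finite_subset by blast
  then have "\<not> inj u" using finite_imageD by blast
  then obtain i i' where ii: "u i = u i'" "i \<noteq> i'" unfolding inj_def by blast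
  let ?m = "e * int i - e * int i'" and ?n = "j i - j i'"
  have split: "g \<otimes> pow (e * int i) = pow (j i) \<otimes> u i" for i
    unfolding u_def using g by (simp add: m_assoc[symmetric])
  have "g \<otimes> pow ?m = (g \<otimes> pow (e * int i)) \<otimes> inv (pow (e * int i'))"
    using g by (simp add: int_pow_diff m_assoc)
  also have "\<dots> = pow ?n \<otimes> (pow (j i') \<otimes> u i') \<otimes> inv (pow (e * int i'))"
    unfolding split ii(1) using uG by (simp add: int_pow_diff m_assoc inv_solve_left)
  also have "\<dots> = pow ?n \<otimes> g" unfolding split[symmetric] using g by (simp add: m_assoc)
  finally have eq: "g \<otimes> pow ?m = pow ?n \<otimes> g" .
  have m0: "?m \<noteq> 0" using ii(2) e by auto
  have "?n \<noteq> 0"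
  proof
    assume "?n = 0"
    then have "g \<otimes> pow ?m = g" using eq g by simp
    then have "pow ?m = \<one>" using g by (simp add: l_cancel_one)
    then show False using pow_eq_one m0 by blast
  qed
  then show ?thesis using g eq m0 unfolding elementary_def by blast
qed


text \<open>The relation makes the height along the translated axis periodic and its projection
  unbounded. So points of height at most \<open>K\<close> exist, on both sides of \<open>t\<close>,
  and the height is convex.\<close>

lemma elementary_close:
  assumes "elementary g"
  shows "H (\<phi> g (c t)) \<le> K"
proof -
  obtain m n :: int where g: "g \<in> carrier G" and mn: "m \<noteq> 0" "n \<noteq> 0" "g \<otimes> pow m = pow n \<otimes> g"
    using assms unfolding elementary_def by auto
  have shift: "\<phi> g (c (t + of_int (m * k) * \<tau>)) = \<phi> (pow (n * k)) (\<phi> g (c t))" for t and k :: int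
  proof -
    have "\<phi> (g \<otimes> pow (m * k)) (c t) = \<phi> (pow (n * k) \<otimes> g) (c t)"
      using intertwine_int_pow[OF g _ _ mn(3), of k] g by (simp add: int_pow_pow)
    then show ?thesis using g by (simp add: act_mult pow_c)
  qed
  have "\<exists>t. N < \<bar>b (\<phi> g (c t))\<bar>" for N
  proof -
    let ?b0 = "b (\<phi> g (c 0))"
    obtain k :: nat where k: "(\<bar>N\<bar> + \<bar>?b0\<bar> + 1) / \<tau> \<le> real k" using real_arch_simple by blast
    then have "\<bar>N\<bar> + \<bar>?b0\<bar> + 1 \<le> real k * \<tau>" using \<tau> by (simp add: field_simps)
    also have "\<dots> \<le> real k * \<tau> * \<bar>real_of_int n\<bar>"
      using \<tau> mn(2) mult_left_mono[of 1 "\<bar>real_of_int n\<bar>" "real k * \<tau>"] by simp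
    also have "\<dots> = \<bar>real_of_int (n * int k) * \<tau>\<bar>" using \<tau> by (simp add: abs_mult)
    finally have "N < \<bar>?b0 + real_of_int (n * int k) * \<tau>\<bar>" by linarith
    then show ?thesis
      using shift[of 0 "int k"] pow_b(1)[of "\<phi> g (c 0)" "n * int k"] g
      by (intro exI[of _ "0 + of_int (m * int k) * \<tau>"]) simp
  qed
  from near_points[OF g this, of 0] obtain s0 where s0: "H (\<phi> g (c s0)) \<le> K" by blast
  have per: "H (\<phi> g (c (s0 + of_int (m * k) * \<tau>))) \<le> K" for k
    unfolding shift using pow_b(2)[of "\<phi> g (c s0)"] g s0 by simp
  obtain k :: nat where k: "\<bar>t - s0\<bar> / \<tau> \<le> real k" using real_arch_simple by blast
  then have "\<bar>t - s0\<bar> \<le> real k * \<tau>" using \<tau> by (simp add: field_simps)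
  also have "\<dots> \<le> real k * \<tau> * \<bar>real_of_int m\<bar>"
    using \<tau> mn(1) mult_left_mono[of 1 "\<bar>real_of_int m\<bar>" "real k * \<tau>"] by simp
  also have "\<dots> = \<bar>real_of_int (m * int k) * \<tau>\<bar>" using \<tau> by (simp add: abs_mult)
  finally have kt: "\<bar>t - s0\<bar> \<le> \<bar>real_of_int (m * int k) * \<tau>\<bar>" .
  show ?thesis
  proof (cases "0 \<le> real_of_int (m * int k) * \<tau>")
    case True
    then show ?thesis using H_line_convex[OF g per[of "- int k"] per[of "int k"], of t] kt by simp
  next
    case False
    then show ?thesis using H_line_convex[OF g per[of "int k"] per[of "- int k"], of t] kt by simp
  qed
qed

lemma not_transversal_elementary:
  assumes g: "g \<in> carrier G" and n: "\<And>m. \<not> transversal m g"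
  shows "elementary g"
proof (cases "\<forall>N. \<exists>t. N < \<bar>b (\<phi> g (c t))\<bar>")
  case True then show ?thesis using unbounded_elementary[OF g] by blast
next
  case False
  then obtain N where N: "\<And>t. \<bar>b (\<phi> g (c t))\<bar> \<le> N" by (meson not_le)
  have "\<exists>t. N' < \<bar>b (\<phi> (inv g) (c t))\<bar>" for N'
  proof (rule ccontr)
    assume "\<not> ?thesis"
    then have "\<bar>b (\<phi> (inv g) (c t))\<bar> \<le> N'" for t by (meson not_le)
    then have "transversal (max N N') g" unfolding transversal_def using N g by (fastforce simp: le_max_iff_disj)
    then show False using n by blast
  qed
  then have "elementary (inv g)" using unbounded_elementary g by blast
  then show ?thesis using elementary_inv[of "inv g"] g by simp
qed

text \<open>Let \<open>x\<close> in \<open>N\<close> move \<open>c 0\<close> far, and let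
  \<open>y\<close> be its conjugate with \<open>g \<otimes> y = x \<otimes> g\<close>. Both are
  elementary, so \<open>\<phi> x (c 0)\<close> projects far and \<open>\<phi> y (c 0)\<close> is
  near some \<open>c s\<close>. Then \<open>\<phi> g (c s)\<close> is near
  \<open>\<phi> x (c 0)\<close>, and the axis translated by \<open>g\<close> has unbounded
  projection.\<close>

lemma normal_elementary:
  assumes N: "N \<lhd> G" "infinite N" and el: "\<And>x. x \<in> N \<Longrightarrow> elementary x" and g: "g \<in> carrier G"
  shows "elementary g"
proof (rule unbounded_elementary[OF g])
  fix R :: real
  interpret normal N G by (rule N)
  define D where "D = d (c 0) (\<phi> g (c 0))"
  have "\<not> N \<subseteq> {x \<in> carrier G. d (c 0) (\<phi> x (c 0)) \<le> R + 2 * K + D}"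
    using finite_displacement[OF c_in] N(2) finite_subset by blast
  then obtain x where x: "x \<in> N" "R + 2 * K + D < d (c 0) (\<phi> x (c 0))" using subset by force
  have xG: "x \<in> carrier G" using x subset by blast
  define y where "y = inv g \<otimes> x \<otimes> g"
  have y: "y \<in> N" unfolding y_def using inv_op_closed1[OF g x(1)] .
  then have yG: "y \<in> carrier G" using subset by blast
  have gy: "g \<otimes> y = x \<otimes> g" unfolding y_def using g xG by (simp add: m_assoc[symmetric])
  define s where "s = b (\<phi> y (c 0))"
  have "H (\<phi> y (c 0)) \<le> K" by (rule elementary_close[OF el[OF y]])
  then have 1: "d (\<phi> g (\<phi> y (c 0))) (\<phi> g (c s)) \<le> K" unfolding H_def s_def using g yG by simp
  have "\<phi> g (\<phi> y (c 0)) = \<phi> x (\<phi> g (c 0))" using gy g yG xG by (metis act_mult c_in)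
  then have 2: "d (\<phi> x (c 0)) (\<phi> g (\<phi> y (c 0))) = D" unfolding D_def using xG g by simp
  have "d (\<phi> x (c 0)) (\<phi> g (c s)) \<le> D + K"
    using triangle[of "\<phi> x (c 0)" "\<phi> g (\<phi> y (c 0))" "\<phi> g (c s)"] 1 2 g xG yG by simp
  then have "\<bar>b (\<phi> x (c 0)) - b (\<phi> g (c s))\<bar> \<le> D + K"
    using b_lipschitz[of "\<phi> x (c 0)" "\<phi> g (c s)"] xG g by simp
  moreover have "d (c 0) (\<phi> x (c 0)) \<le> \<bar>b (\<phi> x (c 0))\<bar> + K"
    using triangle[of "c 0" "c (b (\<phi> x (c 0)))" "\<phi> x (c 0)"] elementary_close[OF el[OF x(1)], of 0] xG
    unfolding H_def by (simp add: commute)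
  ultimately have "R < \<bar>b (\<phi> g (c s))\<bar>" using x(2) by linarith
  then show "\<exists>t. R < \<bar>b (\<phi> g (c t))\<bar>" by blast
qed

text \<open>Every \<open>\<phi> g (c 0)\<close> is near the axis, so a power of \<open>h\<close>
  brings it near \<open>c 0\<close>; by properness this leaves finitely many cosets.\<close>

lemma all_elementary_virtually_cyclic:
  assumes el: "\<And>g. g \<in> carrier G \<Longrightarrow> elementary g"
  shows "virtually_cyclic G"
proof -
  define P where "P = generate G (carrier G \<inter> {h})"
  have P: "P = range pow" unfolding P_def using generate_pow[OF h] by auto
  have sub: "subgroup P G" unfolding P_def by (rule generate_is_subgroup) auto
  have cyc: "cyclic_group (G\<lparr>carrier := P\<rparr>)"
    using cyclic_group_generated[of h] unfolding P_def subgroup_generated_def .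
  define F where "F = {u \<in> carrier G. d (c 0) (\<phi> u (c 0)) \<le> K + \<tau>}"
  have "rcosets P \<subseteq> (\<lambda>u. P #> u) ` F"
  proof
    fix X assume "X \<in> rcosets P"
    then obtain g where g: "g \<in> carrier G" "X = P #> g" unfolding RCOSETS_def by blast
    define p where "p = \<phi> g (c 0)"
    have p: "p \<in> Y" "H p \<le> K" unfolding p_def using g elementary_close[OF el] by auto
    obtain j :: int where j: "of_int j * \<tau> \<le> b p" "b p < of_int j * \<tau> + \<tau>"
      using multiple_below[OF \<tau>] .
    define u where "u = inv (pow j) \<otimes> g"
    have u: "u \<in> carrier G" "g = pow j \<otimes> u" unfolding u_def using g by (simp_all add: m_assoc[symmetric])
    have "d (c 0) (\<phi> u (c 0)) = d (c (of_int j * \<tau>)) p"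
      unfolding u_def p_def using g act_dist_inv[of "pow j" "\<phi> g (c 0)" "c 0"]
      by (simp add: act_mult pow_c commute)
    also have "\<dots> \<le> d (c (of_int j * \<tau>)) (c (b p)) + d (c (b p)) p" using p by (intro triangle) auto
    also have "\<dots> \<le> \<tau> + K" using j p(2) unfolding H_def by (intro add_mono) (simp_all add: commute)
    finally have "u \<in> F" unfolding F_def using u by simp
    moreover have "P #> g = P #> u"
    proof -
      have "P #> g = (P #> pow j) #> u" using u sub by (simp add: coset_mult_assoc subgroup.subset)
      also have "P #> pow j = P" using P sub by (intro coset_join2) auto
      finally show ?thesis .
    qed
    ultimately show "X \<in> (\<lambda>u. P #> u) ` F" using g by blast
  qed
  moreover have "finite F" unfolding F_def by (rule finite_displacement) simp
  ultimately have "finite (rcosets P)" using finite_subset by blast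
  then show ?thesis unfolding virtually_cyclic_def using sub cyc by blast
qed

lemma transversal_in_normal:
  assumes "N \<lhd> G" "infinite N" "non_elementary G"
  obtains x m where "x \<in> N" "transversal m x"
proof -
  have "N \<subseteq> carrier G" using assms(1) by (simp add: normal_def subgroup.subset)
  then show thesis
    using not_transversal_elementary normal_elementary[OF assms(1,2)] all_elementary_virtually_cyclic assms(3) that
    by (metis subsetD)
qed

end

section \<open>Compactness, hyperbolic elements and their axes\<close>

context CAT0_action
begin

lemma act_continuous: "g \<in> carrier G \<Longrightarrow> continuous_map mtopology mtopology (\<phi> g)"
  unfolding metric_continuous_map[OF Metric_space_axioms]
proof (intro conjI ballI allI impI)
  fix x and e :: real assume "g \<in> carrier G" "x \<in> Y" "0 < e"
  then show "\<exists>r>0. \<forall>y. y \<in> Y \<and> d x y < r \<longrightarrow> d (\<phi> g x) (\<phi> g y) < e" by (intro exI[of _ e]) simp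
qed auto

text \<open>\<open>x0 \<in> Y\<close> is asserted only together with \<open>k \<in> Z\<close>,
  because \<open>Y\<close> and \<open>Z\<close> might be empty.\<close>

lemma fundamental_domain:
  "\<exists>Z x0 R. compactin mtopology Z \<and> (\<forall>y\<in>Y. \<exists>g\<in>carrier G. \<exists>k\<in>Z. y = \<phi> g k)
     \<and> (\<forall>k\<in>Z. k \<in> Y \<and> x0 \<in> Y \<and> d x0 k \<le> R)"
proof -
  obtain Z where Z: "compactin mtopology Z" "(\<Union>g\<in>carrier G. \<phi> g ` Z) = Y" using cocompact by blast
  then obtain x0 r where x0: "Z \<subseteq> mcball x0 r" using compactin_imp_mbounded unfolding mbounded_def by blast
  have "\<exists>g\<in>carrier G. \<exists>k\<in>Z. y = \<phi> g k" if "y \<in> Y" for y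
  proof -
    have "y \<in> (\<Union>g\<in>carrier G. \<phi> g ` Z)" using Z(2) that by simp
    then show ?thesis by blast
  qed
  moreover have "k \<in> Y \<and> x0 \<in> Y \<and> d x0 k \<le> r" if "k \<in> Z" for k
    using subsetD[OF x0 that] by simp
  ultimately show ?thesis using Z(1) by blast
qed

text \<open>By properness of the action finitely many translates of the compact set \<open>Z\<close>
  cover the ball, which is closed.\<close>

lemma compact_balls: "compactin mtopology (mcball x r)"
proof (cases "x \<in> Y")
  case True
  obtain Z x0 R where Z: "compactin mtopology Z" "\<forall>y\<in>Y. \<exists>g\<in>carrier G. \<exists>k\<in>Z. y = \<phi> g k"
    "\<forall>k\<in>Z. k \<in> Y \<and> x0 \<in> Y \<and> d x0 k \<le> R"
    using fundamental_domain by blast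
  note Z = Z(1) bspec[OF Z(2)] bspec[OF Z(3)]
  define F where "F = {g \<in> carrier G. \<exists>k\<in>Z. d x (\<phi> g k) \<le> r}"
  have "F \<subseteq> {g \<in> carrier G. d x (\<phi> g x) \<le> r + (R + d x0 x)}"
  proof (unfold F_def, safe)
    fix g k assume g: "g \<in> carrier G" "k \<in> Z" "d x (\<phi> g k) \<le> r"
    then have k: "k \<in> Y" "d x0 k \<le> R" "x0 \<in> Y" using Z by auto
    have "d x (\<phi> g x) \<le> d x (\<phi> g k) + d (\<phi> g k) (\<phi> g x)" using g k True by (intro triangle) auto
    also have "d (\<phi> g k) (\<phi> g x) \<le> d x0 k + d x0 x"
      using g k True triangle[of k x0 x] by (simp add: commute)
    finally show "d x (\<phi> g x) \<le> r + (R + d x0 x)" using g k by simp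
  qed
  then have fin: "finite F" using finite_displacement[OF True] finite_subset by blast
  have "compactin mtopology (\<Union>g\<in>F. \<phi> g ` Z)"
    using fin Z(1) act_continuous by (intro compactin_Union) (auto simp: F_def intro: image_compactin)
  moreover have "mcball x r \<subseteq> (\<Union>g\<in>F. \<phi> g ` Z)"
  proof
    fix y assume y: "y \<in> mcball x r"
    then obtain g k where "g \<in> carrier G" "k \<in> Z" "y = \<phi> g k" using Z(2)[of y] by auto
    then show "y \<in> (\<Union>g\<in>F. \<phi> g ` Z)" using y unfolding F_def by auto
  qed
  ultimately show ?thesis using closed_compactin closedin_mcball by blast
next
  case False
  then have "mcball x r = {}" by auto
  then show ?thesis by simp
qed

lemma pow_orbit_le:
  assumes "f \<in> carrier G" "x \<in> Y"
  shows "d x (\<phi> (f [^] (n::nat)) x) \<le> of_nat n * d x (\<phi> f x)"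
proof (induction n)
  case (Suc n)
  have "d x (\<phi> (f [^] Suc n) x) \<le> d x (\<phi> (f [^] n) x) + d (\<phi> (f [^] n) x) (\<phi> (f [^] n) (\<phi> f x))"
    using assms triangle[of x "\<phi> (f [^] n) x" "\<phi> (f [^] n) (\<phi> f x)"] by (simp add: act_mult)
  then show ?case using Suc assms by (simp add: algebra_simps)
qed (use assms in simp)

text \<open>By cocompactness only finitely many conjugates of \<open>f\<close> matter, each of which attains its
  minimal displacement over the compact fundamental domain.\<close>

lemma infinite_order_hyperbolic:
  assumes f: "f \<in> carrier G" and ord: "\<And>n::nat. 0 < n \<Longrightarrow> f [^] n \<noteq> \<one>" and Y: "y0 \<in> Y"
  shows "hyperbolic_isometry (\<phi> f)"
proof -
  obtain Z x0 R where Z: "compactin mtopology Z" "\<forall>y\<in>Y. \<exists>g\<in>carrier G. \<exists>k\<in>Z. y = \<phi> g k"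
    "\<forall>k\<in>Z. k \<in> Y \<and> x0 \<in> Y \<and> d x0 k \<le> R"
    using fundamental_domain by blast
  note Z = Z(1) bspec[OF Z(2)] bspec[OF Z(3)]
  obtain k0 g0 where k0: "k0 \<in> Z" "g0 \<in> carrier G" "y0 = \<phi> g0 k0" using Z(2)[OF Y] by blast
  have kY: "k0 \<in> Y" "x0 \<in> Y" using k0 Z by auto
  define r where "r = d y0 (\<phi> f y0)"
  define conj where "conj g = inv g \<otimes> f \<otimes> g" for g
  have conj: "conj g \<in> carrier G" "d k (\<phi> (conj g) k) = d (\<phi> g k) (\<phi> f (\<phi> g k))" if "g \<in> carrier G" "k \<in> Y" for g k
    using that f act_dist_inv[of g "\<phi> f (\<phi> g k)" k] unfolding conj_def by (simp_all add: act_mult commute)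
  \<comment> \<open>Since \<open>r\<close> is a displacement that occurs, it is enough to minimize
    over these conjugates.\<close>
  define F where "F = {u \<in> conj ` carrier G. \<exists>k\<in>Z. d k (\<phi> u k) \<le> r}"
  have "F \<subseteq> {u \<in> carrier G. d x0 (\<phi> u x0) \<le> r + 2 * R}"
  proof
    fix u assume "u \<in> F"
    then obtain g k where u: "g \<in> carrier G" "u = conj g" "k \<in> Z" "d k (\<phi> u k) \<le> r" unfolding F_def by blast
    have uG: "u \<in> carrier G" using u conj kY by blast
    have k: "k \<in> Y" "d x0 k \<le> R" using u Z by auto
    have "d x0 (\<phi> u x0) \<le> d x0 k + d k (\<phi> u k) + d (\<phi> u k) (\<phi> u x0)"
      using triangle[of x0 k "\<phi> u x0"] triangle[of k "\<phi> u k" "\<phi> u x0"] k kY uG by simp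
    then show "u \<in> {u \<in> carrier G. d x0 (\<phi> u x0) \<le> r + 2 * R}" using u k kY uG by (simp add: commute)
  qed
  then have fin: "finite F" using finite_displacement[OF kY(2)] finite_subset by blast
  have Fne: "conj g0 \<in> F" unfolding F_def r_def using k0 conj[of g0 k0] kY by (auto intro!: bexI[of _ k0])
  have FG: "u \<in> carrier G" if "u \<in> F" for u using that conj kY unfolding F_def by auto
  have "\<exists>k\<in>Z. \<forall>k'\<in>Z. d k (\<phi> u k) \<le> d k' (\<phi> u k')" if u: "u \<in> F" for u
  proof -
    have id: "continuous_map mtopology (mtopology_of Self) (\<lambda>x. x)"
      and cu: "continuous_map mtopology (mtopology_of Self) (\<phi> u)"
      using act_continuous[OF FG[OF u]] unfolding mtopology_of_def mspace_Self mdist_Self by simp_all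
    have "continuous_map mtopology euclideanreal (\<lambda>x. d x (\<phi> u x))"
      using continuous_map_mdist[OF id cu] by simp
    then have "compact ((\<lambda>x. d x (\<phi> u x)) ` Z)" using image_compactin[OF Z(1)] by fastforce
    then show ?thesis using compact_attains_inf[of "(\<lambda>x. d x (\<phi> u x)) ` Z"] k0 by blast
  qed
  then obtain m where m: "\<And>u. u \<in> F \<Longrightarrow> m u \<in> Z" "\<And>u k. u \<in> F \<Longrightarrow> k \<in> Z \<Longrightarrow> d (m u) (\<phi> u (m u)) \<le> d k (\<phi> u k)"
    by metis
  define u where "u = arg_min_on (\<lambda>u. d (m u) (\<phi> u (m u))) F"
  have u: "u \<in> F" "d (m u) (\<phi> u (m u)) \<le> d (m v) (\<phi> v (m v))" if "v \<in> F" for v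
    using arg_min_if_finite(1)[OF fin, of "\<lambda>u. d (m u) (\<phi> u (m u))"] arg_min_least[OF fin _ that, of "\<lambda>u. d (m u) (\<phi> u (m u))"] that
    unfolding u_def by auto
  note u = u(1)[OF Fne] u(2)
  obtain g where g: "g \<in> carrier G" "u = conj g" using u(1) unfolding F_def by blast
  define x where "x = \<phi> g (m u)"
  have mY: "m u \<in> Y" using m(1)[OF u(1)] Z by blast
  have xY: "x \<in> Y" unfolding x_def using g mY by blast
  have dx: "d x (\<phi> f x) = d (m u) (\<phi> u (m u))" unfolding x_def g(2) using conj(2)[OF g(1)] mY g by simp
  have min: "d x (\<phi> f x) \<le> d y (\<phi> f y)" if "y \<in> Y" for y
  proof -
    obtain g' k where k: "k \<in> Z" "g' \<in> carrier G" "y = \<phi> g' k" using Z(2)[OF \<open>y \<in> Y\<close>] by blast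
    then have e: "d y (\<phi> f y) = d k (\<phi> (conj g') k)" using conj(2) Z by auto
    show ?thesis
    proof (cases "d y (\<phi> f y) \<le> r")
      case True
      then have F: "conj g' \<in> F" unfolding F_def using k e by auto
      show ?thesis using u(2)[OF F] m(2)[OF F k(1)] dx e by simp
    next
      case False
      have "d x (\<phi> f x) \<le> r" using u(2)[OF Fne] m(2)[OF Fne k0(1)] dx conj(2)[of g0 k0] k0 kY unfolding r_def by simp
      then show ?thesis using False by simp
    qed
  qed
  \<comment> \<open>With displacement 0 all powers of \<open>f\<close> would fix \<open>x\<close>;
    being distinct, they would contradict properness.\<close>
  have pos: "0 < d x (\<phi> f x)"
  proof (rule ccontr)
    assume "\<not> ?thesis"
    then have "d x (\<phi> f x) = 0" using nonneg[of x "\<phi> f x"] by linarith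
    then have "range (\<lambda>n::nat. f [^] n) \<subseteq> {g \<in> carrier G. d x (\<phi> g x) \<le> 0}"
      using pow_orbit_le[OF f xY] f by auto
    then have "finite (range (\<lambda>n::nat. f [^] n))" using finite_displacement[OF xY] finite_subset by blast
    then have "\<not> inj (\<lambda>n::nat. f [^] n)" using finite_imageD by blast
    then obtain i j :: nat where ij: "f [^] i = f [^] j" "i < j" unfolding inj_def by (metis linorder_neqE_nat)
    have "f [^] i \<otimes> f [^] (j - i) = f [^] i" using f ij(2) ij(1)[symmetric] by (simp add: nat_pow_mult)
    then show False using ord[of "j - i"] ij f by (simp add: l_cancel_one)
  qed
  have "bij_betw (\<phi> f) Y Y" using bij_prop0[OF f] by (simp add: Bij_def)
  then show ?thesis unfolding hyperbolic_isometry_def using f xY pos min by (intro conjI) (auto intro!: bexI[of _ x])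
qed

text \<open>\<open>g\<close> takes the midpoint of \<open>y\<close> and \<open>\<phi> g y\<close> to
  that of \<open>\<phi> g y\<close> and its image; by \<open>pt_fan\<close> these are at most half
  of \<open>d y (\<phi> (g \<otimes> g) y)\<close> apart. So the minimal displacement at least
  doubles under squaring. With equality at powers of 2, the triangle inequality leaves no room for a
  defect at smaller exponents.\<close>

lemma hyperbolic_displacement:
  assumes f: "f \<in> carrier G" and x: "x \<in> Y" and min: "\<And>y. y \<in> Y \<Longrightarrow> d x (\<phi> f x) \<le> d y (\<phi> f y)"
  shows "d x (\<phi> (f [^] (n::nat)) x) = of_nat n * d x (\<phi> f x)"
proof -
  let ?l = "d x (\<phi> f x)"
  have doubling: "2 * l \<le> d y (\<phi> (g \<otimes> g) y)"
    if g: "g \<in> carrier G" and l: "\<And>y. y \<in> Y \<Longrightarrow> l \<le> d y (\<phi> g y)" and y: "y \<in> Y" for g l y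
  proof -
    have s: "0 \<le> (1/2::real)" "(1/2::real) \<le> 1" by auto
    define m where "m = pt (\<phi> g y) y (1/2)"
    define m' where "m' = pt (\<phi> g y) (\<phi> g (\<phi> g y)) (1/2)"
    have gy: "\<phi> g y \<in> Y" "\<phi> g (\<phi> g y) \<in> Y" using g y by auto
    note pm = pt_props[OF gy(1) y s, folded m_def]
    have "m' = \<phi> g m" unfolding m'_def
      by (rule pt_unique) (use pm g y in \<open>auto simp: commute\<close>)
    moreover have "d m m' \<le> 1 / 2 * d y (\<phi> g (\<phi> g y))"
      unfolding m_def m'_def by (rule pt_fan) (use gy y in auto)
    moreover have "l \<le> d m (\<phi> g m)" using l pm by blast
    ultimately show ?thesis using g y by (simp add: act_mult)
  qed
  have pow2: "\<forall>y\<in>Y. 2 ^ k * ?l \<le> d y (\<phi> (f [^] (2 ^ k :: nat)) y)" for k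
  proof (induction k)
    case 0 then show ?case using min f by simp
  next
    case (Suc k)
    have e: "f [^] (2 ^ Suc k :: nat) = f [^] (2 ^ k :: nat) \<otimes> f [^] (2 ^ k :: nat)"
      using f by (simp add: nat_pow_mult mult_2)
    show ?case unfolding e using doubling[of "f [^] (2 ^ k :: nat)" "2 ^ k * ?l"] Suc f by (simp add: mult.assoc)
  qed
  have "n \<le> 2 ^ n" by (simp add: less_imp_le)
  define N where "N = (2::nat) ^ n"
  have N: "n \<le> N" unfolding N_def by fact
  have Nx: "of_nat N * ?l \<le> d x (\<phi> (f [^] N) x)" using pow2[of n] x unfolding N_def by auto
  have "f [^] N = f [^] n \<otimes> f [^] (N - n)" using f N by (simp add: nat_pow_mult)
  then have "d x (\<phi> (f [^] N) x) \<le> d x (\<phi> (f [^] n) x) + d (\<phi> (f [^] n) x) (\<phi> (f [^] n) (\<phi> (f [^] (N - n)) x))"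
    using f x triangle[of x "\<phi> (f [^] n) x" "\<phi> (f [^] n) (\<phi> (f [^] (N - n)) x)"] by (simp add: act_mult)
  also have "\<dots> \<le> d x (\<phi> (f [^] n) x) + of_nat (N - n) * ?l" using f x pow_orbit_le[OF f x, of "N - n"] by simp
  finally have "of_nat n * ?l \<le> d x (\<phi> (f [^] n) x)"
    using Nx N by (simp add: of_nat_diff algebra_simps)
  then show ?thesis using pow_orbit_le[OF f x, of n] by simp
qed

text \<open>By \<open>hyperbolic_displacement\<close> the orbit of a point of minimal displacement
  is spaced as on a line, so the geodesics between consecutive orbit points join to a geodesic
  line.\<close>

lemma hyperbolic_axis:
  assumes f: "f \<in> carrier G" and hyp: "hyperbolic_isometry (\<phi> f)"
  obtains c \<tau> where "geodesic_line c" "0 < \<tau>" "\<And>t. \<phi> f (c t) = c (t + \<tau>)"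
proof -
  obtain x where x: "x \<in> Y" "0 < d x (\<phi> f x)" "\<And>y. y \<in> Y \<Longrightarrow> d x (\<phi> f x) \<le> d y (\<phi> f y)"
    using hyp unfolding hyperbolic_isometry_def by blast
  define l where "l = d x (\<phi> f x)"
  have l: "0 < l" using x l_def by simp
  define p where "p i = \<phi> (f [^] (i::int)) x" for i
  have pY: "p i \<in> Y" for i unfolding p_def using f x by auto
  have p_add: "p (i + j) = \<phi> (f [^] i) (p j)" for i j unfolding p_def using f x by (simp add: int_pow_mult act_mult)
  have pd: "d (p i) (p j) = of_int (j - i) * l" if ij: "i \<le> j" for i j
  proof -
    obtain n where n: "j = i + int n" using ij zle_iff_zadd by blast
    have "d (p i) (p j) = d (p 0) (p (int n))"
      using p_add[of i 0] p_add[of i "int n"] n f pY by simp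
    also have "\<dots> = of_nat n * l"
      unfolding p_def l_def using hyperbolic_displacement[OF f x(1,3), of n] x(1) by (simp add: int_pow_int)
    finally show ?thesis using n by simp
  qed
  define i where "i t = \<lfloor>t / l\<rfloor>" for t
  define c where "c t = pt (p (i t)) (p (i t + 1)) (t / l - of_int (i t))" for t
  have r: "0 \<le> t / l - of_int (i t)" "t / l - of_int (i t) \<le> 1" for t unfolding i_def by linarith+
  have cY: "c t \<in> Y" for t unfolding c_def using pt_props pY r by simp
  have c1: "d (p (i t)) (c t) = t - of_int (i t) * l" "d (c t) (p (i t + 1)) = of_int (i t + 1) * l - t" for t
  proof -
    have "d (p (i t)) (p (i t + 1)) = l" using pd[of "i t" "i t + 1"] by simp
    moreover have "(t / l - of_int (i t)) * l = t - of_int (i t) * l"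
      "(1 - (t / l - of_int (i t))) * l = of_int (i t + 1) * l - t"
      using l by (simp_all add: left_diff_distrib distrib_right)
    ultimately show "d (p (i t)) (c t) = t - of_int (i t) * l" "d (c t) (p (i t + 1)) = of_int (i t + 1) * l - t"
      using pt_props[OF pY pY r, of "i t" "i t + 1" t] unfolding c_def by simp_all
  qed
  have mono: "i s \<le> i t" if "s \<le> t" for s t unfolding i_def using that l by (intro floor_mono divide_right_mono) auto
  have le: "d (c s) (c t) = t - s" if st: "s \<le> t" for s t
  proof (rule antisym)
    have "d (p (i s)) (p (i t + 1)) \<le> d (p (i s)) (c s) + d (c s) (c t) + d (c t) (p (i t + 1))"
      using triangle[of "p (i s)" "c s" "p (i t + 1)"] triangle[of "c s" "c t" "p (i t + 1)"] pY cY by simp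
    then show "t - s \<le> d (c s) (c t)"
      using pd[of "i s" "i t + 1"] mono[OF st] c1[of s] c1[of t] by (simp add: algebra_simps)
    show "d (c s) (c t) \<le> t - s"
    proof (cases "i s = i t")
      case True
      have "d (c s) (c t) = \<bar>(s / l - of_int (i t)) - (t / l - of_int (i t))\<bar> * l"
        using pt_dist[OF pY pY r[of s] r[of t], of "i t" "i t + 1"] pd[of "i t" "i t + 1"] True
        unfolding c_def by simp
      also have "\<dots> = t - s" using st l by (simp add: abs_if field_simps)
      finally show ?thesis by simp
    next
      case False
      then have lt: "i s + 1 \<le> i t" using mono[OF st] by simp
      have "d (c s) (c t) \<le> d (c s) (p (i s + 1)) + d (p (i s + 1)) (p (i t)) + d (p (i t)) (c t)"
        using triangle[of "c s" "p (i s + 1)" "c t"] triangle[of "p (i s + 1)" "p (i t)" "c t"] pY cY by simp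
      then show ?thesis using pd[OF lt] c1[of s] c1[of t] by (simp add: algebra_simps)
    qed
  qed
  have "d (c s) (c t) = \<bar>s - t\<bar>" for s t using le[of s t] le[of t s] by (cases "s \<le> t") (auto simp: commute)
  then have "geodesic_line c" unfolding geodesic_line_def using cY by auto
  moreover have "\<phi> f (c t) = c (t + l)" for t
  proof -
    have it: "i (t + l) = i t + 1" unfolding i_def using l by (simp add: add_divide_distrib)
    have f1: "\<phi> f (p j) = p (j + 1)" for j using p_add[of 1 j] f by (simp add: add.commute)
    have A: "t / l - of_int (i t) = (t + l) / l - of_int (i (t + l))" using l it by (simp add: add_divide_distrib)
    have B: "pt (p (i t + 1)) (p (i t + 1 + 1)) (t / l - of_int (i t)) = \<phi> f (c t)"
    proof (rule pt_unique)
      show "d (p (i t + 1)) (\<phi> f (c t)) = (t / l - of_int (i t)) * d (p (i t + 1)) (p (i t + 1 + 1))"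
        using pt_props(2)[OF pY pY r, of "i t" "i t + 1" t, folded c_def, unfolded f1[symmetric]] f pY cY
        unfolding f1[symmetric] by simp
      show "d (\<phi> f (c t)) (p (i t + 1 + 1)) = (1 - (t / l - of_int (i t))) * d (p (i t + 1)) (p (i t + 1 + 1))"
        using pt_props(3)[OF pY pY r, of "i t" "i t + 1" t, folded c_def, unfolded f1[symmetric]] f pY cY
        unfolding f1[symmetric] by simp
    qed (use f pY cY r in auto)
    show ?thesis unfolding c_def[of "t + l"] it by (rule B[unfolded A it, symmetric])
  qed
  ultimately show thesis using that l by blast
qed

lemma rank_one_axis:
  assumes f: "f \<in> carrier G" and r1: "rank_one (\<phi> f)"
  obtains c \<tau> K where "axis_action Y d G \<phi> c f \<tau> K"
proof -
  obtain c \<tau> where c: "geodesic_line c" "0 < \<tau>" "\<And>t. \<phi> f (c t) = c (t + \<tau>)"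
    using hyperbolic_axis f r1 unfolding rank_one_def by blast
  interpret line_action Y d G \<phi> c f \<tau> by unfold_locales (use c f in auto)
  have "axis (\<phi> f) c" unfolding axis_def using c by (auto intro!: exI[of _ \<tau>])
  then have "\<not> bounds_flat_half_plane c" using r1 unfolding rank_one_def by blast
  moreover have "periodic \<tau>"
    unfolding periodic_def
  proof
    fix k :: int
    show "\<exists>u. (\<forall>x\<in>Y. u x \<in> Y) \<and> (\<forall>x\<in>Y. \<forall>y\<in>Y. d (u x) (u y) = d x y) \<and> (\<forall>t. u (c t) = c (t + real_of_int k * \<tau>))"
      using pow_c f by (intro exI[of _ "\<phi> (f [^] k)"]) auto
  qed
  ultimately obtain B where "contracting B" using contracting_of_rank_one c(2) compact_balls by blast
  \<comment> \<open>\<open>contracting_gate\<close> needs a positive constant; after multiplication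
    by 8 one constant serves both properties.\<close>
  then have "contracting (max B 1)" using contracting_mono by simp
  moreover have "0 < max B 1" "max B 1 \<le> 8 * max B 1" by linarith+
  ultimately have "contracting (8 * max B 1)" "gate (8 * max B 1)"
    using contracting_mono contracting_gate by blast+
  then have "axis_action Y d G \<phi> c f \<tau> (8 * max B 1)" by unfold_locales
  then show thesis by (rule that)
qed

end

section \<open>A rank-one element of the normal subgroup\<close>

context axis_action
begin

text \<open>A flat half plane over a bi-infinite quasi-axis is impossible once the quasi-axis projects
  far apart on a contracting line: the boundary of a large half square joins the two ends in
  eight steps, each of which is short compared to the distance to the contracting line.\<close>

lemma commutator_rank_one:
  assumes N: "N \<lhd> G" and xN: "x \<in> N" and tr: "transversal m x"
  shows "\<exists>f\<in>N. rank_one (\<phi> f)"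
proof -
  interpret nrm: normal N G by (rule N)
  have x: "x \<in> carrier G" using tr unfolding transversal_def by simp
  have K0: "0 \<le> K" by (rule K_nonneg)
  have xt: "\<bar>b (\<phi> x (c t))\<bar> \<le> m" "\<bar>b (\<phi> (inv x) (c t))\<bar> \<le> m" for t
    using tr unfolding transversal_def by auto
  have m0: "0 \<le> m" using xt(1)[of 0] by linarith
  \<comment> \<open>More than ping-pong requires: the surplus keeps the two ends of the orbit of
    \<open>f\<close> more than \<open>8 * K\<close> apart in projection, against the eight steps
    below.\<close>
  define n where "n = \<lceil>(2 * m + 20 * K + 1) / \<tau>\<rceil>"
  have "(2 * m + 20 * K + 1) / \<tau> \<le> of_int n" unfolding n_def by linarith
  then have n: "2 * m + 20 * K + 1 \<le> of_int n * \<tau>" using \<tau> by (simp add: divide_le_eq)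
  then have n0: "0 < real_of_int n * \<tau>" using K0 m0 by linarith
  then have "0 < n" using \<tau> by (simp add: zero_less_mult_iff)
  then have big: "2 * m + 2 * K < \<bar>real_of_int n\<bar> * \<tau>" "2 * m + 2 * K < \<bar>real_of_int (- n)\<bar> * \<tau>"
    using n K0 by auto
  define p where "p = x \<otimes> pow n"
  define q where "q = inv x \<otimes> pow (- n)"
  define p' where "p' = x \<otimes> pow (- n)"
  define q' where "q' = inv x \<otimes> pow n"
  have G: "p \<in> carrier G" "q \<in> carrier G" "p' \<in> carrier G" "q' \<in> carrier G"
    unfolding p_def q_def p'_def q'_def using x by simp_all
  define f where "f = p \<otimes> q"
  have f: "f \<in> carrier G" unfolding f_def using G by simp
  have "f = x \<otimes> (pow n \<otimes> inv x \<otimes> inv (pow n))"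
    unfolding f_def p_def q_def using x by (simp add: m_assoc int_pow_neg)
  moreover have "pow n \<otimes> inv x \<otimes> inv (pow n) \<in> N" using nrm.inv_op_closed2 xN by simp
  ultimately have fN: "f \<in> N" using xN nrm.m_closed by simp
  have finv: "inv f = pow n \<otimes> x \<otimes> pow (- n) \<otimes> inv x"
    unfolding f_def p_def q_def using x by (simp add: inv_mult_group m_assoc int_pow_neg)
  \<comment> \<open>Seen from the translate by \<open>x\<close>, the backward orbit is thus produced
    by \<open>q'\<close> and \<open>p'\<close>, to which ping-pong applies as well.\<close>
  have conj: "inv x \<otimes> inv f = q' \<otimes> p' \<otimes> inv x"
    unfolding finv q'_def p'_def using x by (simp add: m_assoc)
  define P where "P e \<longleftrightarrow> e \<in> Y \<and> \<bar>b e\<bar> \<le> m + K" for e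
  have Pp: "P (\<phi> p e)" "\<phi> (inv x) (\<phi> p e) = \<phi> (pow n) e" if "P e" for e
    using transversal_ping_pong[OF tr big(1), of e] that G(1) unfolding P_def p_def by auto
  have Pp': "P (\<phi> p' e)" if "P e" for e
    using transversal_ping_pong[OF tr big(2), of e] that G(3) unfolding P_def p'_def by auto
  have Pq: "P (\<phi> q e)" if "P e" for e
    using transversal_ping_pong[OF transversal_inv[OF tr] big(2), of e] that G(2) unfolding P_def q_def by auto
  have Pq': "P (\<phi> q' e)" if "P e" for e
    using transversal_ping_pong[OF transversal_inv[OF tr] big(1), of e] that G(4) unfolding P_def q'_def by auto
  \<comment> \<open>The projection to the axis translated by \<open>x\<close>: the forward orbit of
    \<open>f\<close> stays near \<open>n * \<tau>\<close>, the backward orbit near 0.\<close>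
  define \<beta> where "\<beta> y = b (\<phi> (inv x) y)" for y
  define W where "W = of_int n * \<tau> + m + K"
  have W0: "0 \<le> W" unfolding W_def using n0 m0 K0 by linarith
  have fwd: "P (\<phi> (f [^] (k::nat)) (c 0))" for k
  proof (induction k)
    case (Suc k)
    have "\<phi> (f [^] Suc k) (c 0) = \<phi> p (\<phi> q (\<phi> (f [^] k) (c 0)))"
      using f G nat_pow_Suc2[of f k] unfolding f_def by (simp add: act_mult del: nat_pow_Suc)
    then show ?case using Pp Pq Suc by simp
  qed (use m0 K0 in \<open>simp add: P_def\<close>)
  have up: "of_int n * \<tau> - (m + K) \<le> \<beta> (\<phi> (f [^] k) (c 0))" "\<bar>\<beta> (\<phi> (f [^] k) (c 0))\<bar> \<le> W" if k: "0 < k" for k :: nat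
  proof -
    obtain j where j: "k = Suc j" using k by (cases k) auto
    define e where "e = \<phi> q (\<phi> (f [^] j) (c 0))"
    have e: "P e" unfolding e_def using Pq fwd by simp
    have "\<phi> (f [^] k) (c 0) = \<phi> p e"
      using f G nat_pow_Suc2[of f j] unfolding f_def j e_def by (simp add: act_mult del: nat_pow_Suc)
    then have "\<beta> (\<phi> (f [^] k) (c 0)) = b e + of_int n * \<tau>"
      unfolding \<beta>_def using Pp(2)[OF e] pow_b(1)[of e n] e unfolding P_def by simp
    then show "of_int n * \<tau> - (m + K) \<le> \<beta> (\<phi> (f [^] k) (c 0))" "\<bar>\<beta> (\<phi> (f [^] k) (c 0))\<bar> \<le> W"
      using e n0 m0 K0 unfolding P_def W_def by linarith+
  qed
  have down: "\<bar>\<beta> (\<phi> (inv f [^] (k::nat)) (c 0))\<bar> \<le> m + K" for k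
  proof -
    have "P (\<phi> (inv x) (\<phi> (inv f [^] k) (c 0)))"
    proof (induction k)
      case 0 then show ?case using xt(2)[of 0] x K0 unfolding P_def by simp
    next
      case (Suc k)
      have "\<phi> (inv x) (\<phi> (inv f [^] Suc k) (c 0)) = \<phi> (inv x \<otimes> inv f) (\<phi> (inv f [^] k) (c 0))"
        using f x nat_pow_Suc2[of "inv f" k] by (simp add: act_mult del: nat_pow_Suc)
      also have "\<dots> = \<phi> q' (\<phi> p' (\<phi> (inv x) (\<phi> (inv f [^] k) (c 0))))"
        unfolding conj using G x f by (simp add: act_mult)
      finally show ?case using Pq' Pp' Suc by simp
    qed
    then show ?thesis unfolding P_def \<beta>_def by simp
  qed
  have ord: "f [^] k \<noteq> \<one>" if "0 < k" for k :: nat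
  proof
    assume "f [^] k = \<one>"
    then have "of_int n * \<tau> - (m + K) \<le> \<beta> (c 0)" using up(1)[OF that] by simp
    then show False using down[of 0] n K0 by simp
  qed
  have hyp: "hyperbolic_isometry (\<phi> f)" using infinite_order_hyperbolic[OF f ord c_in] .
  have "\<not> bounds_flat_half_plane c'" if ax: "axis (\<phi> f) c'" for c'
  proof
    obtain a where line': "geodesic_line c'" and a: "a \<noteq> 0" "\<And>t. \<phi> f (c' t) = c' (t + a)"
      using ax unfolding axis_def by auto
    interpret L: CAT0_line Y d c' by unfold_locales (rule line')
    have c'Y [simp]: "c' t \<in> Y" for t by (rule L.c_in)
    have dc': "d (c' s) (c' t) = \<bar>s - t\<bar>" for s t by (rule L.c_dist)
    assume "bounds_flat_half_plane c'"
    then obtain F :: "real^2 \<Rightarrow> 'b" where F: "\<And>u. u $ 2 \<ge> 0 \<Longrightarrow> F u \<in> Y"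
        "\<And>u v. u $ 2 \<ge> 0 \<Longrightarrow> v $ 2 \<ge> 0 \<Longrightarrow> d (F u) (F v) = dist u v" "F ` {u. u $ 2 = 0} = range c'"
      unfolding bounds_flat_half_plane_def by auto
    have fk: "\<phi> (f [^] (k::nat)) (c' t) = c' (t + of_nat k * a)" for k t
    proof (induction k arbitrary: t)
      case (Suc k)
      have "\<phi> (f [^] Suc k) (c' t) = \<phi> (f [^] k) (\<phi> f (c' t))" using f by (simp add: act_mult)
      then show ?case using Suc a(2) by (simp add: algebra_simps)
    qed simp
    have ifk: "\<phi> (inv f [^] (k::nat)) (c' t) = c' (t - of_nat k * a)" for k t
    proof -
      have "\<phi> (inv f [^] k) (\<phi> (f [^] k) (c' (t - of_nat k * a))) = c' (t - of_nat k * a)"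
        using f by (simp add: nat_pow_inv)
      then show ?thesis unfolding fk by simp
    qed
    define D where "D = d (c 0) (c' 0)"
    define E where "E = d (c' 0) (\<phi> x (c 0))"
    have height: "d y (c' 0) - E - \<bar>\<beta> y\<bar> \<le> H (\<phi> (inv x) y)" if y: "y \<in> Y" for y
    proof -
      have "d y (\<phi> x (c 0)) = d (\<phi> (inv x) y) (c 0)" using act_dist_inv[OF x y c_in] by simp
      also have "\<dots> \<le> H (\<phi> (inv x) y) + \<bar>\<beta> y\<bar>"
        using triangle[of "\<phi> (inv x) y" "c (\<beta> y)" "c 0"] x y unfolding H_def \<beta>_def by simp
      finally show ?thesis
        using triangle[of y "\<phi> x (c 0)" "c' 0"] y x unfolding E_def by (simp add: commute)
    qed
    have contract: "\<bar>\<beta> y - \<beta> z\<bar> \<le> K" if "y \<in> Y" "z \<in> Y" "d y z \<le> H (\<phi> (inv x) y)" for y z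
      using contr that x unfolding contracting_def \<beta>_def by simp
    define r where "r = 2 * D + (E + W) + D + 2 * (E + W + 9 * K)"
    obtain k :: nat where k: "r / \<bar>a\<bar> + 1 \<le> real k"
      using real_arch_simple by blast
    define \<rho> where "\<rho> = real k * \<bar>a\<bar>"
    have DE: "0 \<le> D" "0 \<le> E" unfolding D_def E_def by auto
    have a0: "0 < \<bar>a\<bar>" using a by simp
    have "r + \<bar>a\<bar> \<le> \<rho>"
    proof -
      have "(r / \<bar>a\<bar> + 1) * \<bar>a\<bar> \<le> \<rho>"
        unfolding \<rho>_def using k by (intro mult_right_mono) auto
      then show ?thesis using a0 by (simp add: distrib_right)
    qed
    then have \<rho>: "2 * D + E + W + D \<le> \<rho>" "2 * (E + W + 9 * K) \<le> \<rho>" "0 < \<rho>"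
      using DE W0 K0 a0 unfolding r_def by argo+
    have k0: "0 < k" using \<rho>(3) unfolding \<rho>_def by (cases k) auto
    \<comment> \<open>The distance \<open>D\<close> of an orbit point to the matching point of
      \<open>c'\<close> is at most its height over the translated axis, so contraction keeps their
      projections together.\<close>
    have track: "\<bar>\<beta> y - \<beta> z\<bar> \<le> K" if y: "y \<in> Y" "z \<in> Y" "\<bar>\<beta> y\<bar> \<le> W" "d y z = D" "d z (c' 0) = \<rho>" for y z
    proof (rule contract[OF y(1,2)])
      have "\<rho> - D \<le> d y (c' 0)" using triangle[of z y "c' 0"] y by (simp add: commute)
      then show "d y z \<le> H (\<phi> (inv x) y)" using height[OF y(1)] y \<rho>(1) DE by linarith
    qed
    define zp zm where "zp = c' (real k * a)" and "zm = c' (- real k * a)"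
    have ka: "\<bar>real k * a\<bar> = \<rho>" unfolding \<rho>_def by (simp add: abs_mult)
    have "\<bar>\<beta> (\<phi> (f [^] k) (c 0)) - \<beta> zp\<bar> \<le> K"
    proof (rule track)
      have "d (\<phi> (f [^] k) (c 0)) (\<phi> (f [^] k) (c' 0)) = D" unfolding D_def using f by simp
      then show "d (\<phi> (f [^] k) (c 0)) zp = D" unfolding fk zp_def by simp
      show "d zp (c' 0) = \<rho>" unfolding zp_def dc' using ka by simp
    qed (use f up k0 in \<open>auto simp: zp_def\<close>)
    then have zp: "of_int n * \<tau> - m - 2 * K \<le> \<beta> zp" "\<bar>\<beta> zp\<bar> \<le> W + K" using up[OF k0] by linarith+
    have "\<bar>\<beta> (\<phi> (inv f [^] k) (c 0)) - \<beta> zm\<bar> \<le> K"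
    proof (rule track)
      have "d (\<phi> (inv f [^] k) (c 0)) (\<phi> (inv f [^] k) (c' 0)) = D" unfolding D_def using f by simp
      then show "d (\<phi> (inv f [^] k) (c 0)) zm = D" unfolding ifk zm_def by simp
      show "d zm (c' 0) = \<rho>" unfolding zm_def dc' using ka by simp
      show "\<bar>\<beta> (\<phi> (inv f [^] k) (c 0))\<bar> \<le> W" using down[of k] n0 unfolding W_def by linarith
    qed (use f in \<open>auto simp: zm_def\<close>)
    then have zm: "\<beta> zm \<le> m + 2 * K" using down[of k] by linarith
    obtain u where u: "u $ 2 = 0" "F u = zp" using F(3) unfolding zp_def by (metis (mono_tags, lifting) imageE mem_Collect_eq rangeI)
    obtain v where v: "v $ 2 = 0" "F v = zm" using F(3) unfolding zm_def by (metis (mono_tags, lifting) imageE mem_Collect_eq rangeI)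
    have dist1: "dist w w' = \<bar>w $ 1 - w' $ 1\<bar>" if "w $ 2 = w' $ 2" for w w' :: "real^2"
      using that by (simp add: dist_vec_def L2_set_def sum_2 dist_real_def)
    have dist2: "dist w w' = \<bar>w $ 2 - w' $ 2\<bar>" if "w $ 1 = w' $ 1" for w w' :: "real^2"
      using that by (simp add: dist_vec_def L2_set_def sum_2 dist_real_def)
    have "d (F u) (F v) = 2 * \<rho>" unfolding u v zp_def zm_def dc' using ka by (simp add: abs_mult mult_ac)
    then have uv: "\<bar>u $ 1 - v $ 1\<bar> = 2 * \<rho>" using F(2)[of u v] u v dist1[of u v] by simp
    \<comment> \<open>\<open>w\<close> is the midpoint of the two boundary points and
      \<open>s\<close> the sign of their order; in the coordinates of \<open>Q\<close> they become
      \<open>(\<rho>, 0)\<close> and \<open>(-\<rho>, 0)\<close>.\<close>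
    define w where "w = (u $ 1 + v $ 1) / 2"
    define s where "s = (u $ 1 - v $ 1) / (2 * \<rho>)"
    have s: "\<bar>s\<bar> = 1" unfolding s_def using uv \<rho>(3) by (simp add: abs_divide)
    have sr: "s * \<rho> = (u $ 1 - v $ 1) / 2" unfolding s_def using \<rho>(3) by simp
    define Q where "Q X Z = F (vector [w + s * X, Z])" for X Z
    have QY: "Q X Z \<in> Y" if "0 \<le> Z" for X Z unfolding Q_def using F(1) that by simp
    have Qh: "d (Q X Z) (Q X' Z) = \<bar>X - X'\<bar>" if "0 \<le> Z" for X X' Z
    proof -
      have "\<bar>s * X - s * X'\<bar> = \<bar>X - X'\<bar>" using s by (metis abs_mult mult_1 right_diff_distrib)
      then show ?thesis unfolding Q_def using F(2) that dist1 by simp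
    qed
    have Qv: "d (Q X Z) (Q X Z') = \<bar>Z - Z'\<bar>" if "0 \<le> Z" "0 \<le> Z'" for X Z Z'
      unfolding Q_def using F(2) that dist2 by simp
    have vec2: "z = vector [z $ 1, z $ 2]" for z :: "real^2" by (simp add: vec_eq_iff forall_2)
    have ends: "Q \<rho> 0 = zp" "Q (- \<rho>) 0 = zm"
    proof -
      have "w + s * \<rho> = u $ 1" "w + s * (- \<rho>) = v $ 1" using sr unfolding w_def by (simp_all add: field_simps)
      then show "Q \<rho> 0 = zp" "Q (- \<rho>) 0 = zm" unfolding Q_def using u v vec2[of u] vec2[of v] by simp_all
    qed
    have Q0: "Q 0 0 = c' 0"
    proof -
      have "Q 0 0 \<in> F ` {u. u $ 2 = 0}" unfolding Q_def by (rule imageI) simp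
      then obtain t where t: "Q 0 0 = c' t" using F(3) by auto
      have "d (c' t) (c' (real k * a)) = \<rho>" "d (c' t) (c' (- real k * a)) = \<rho>"
        using Qh[of 0 0 \<rho>] Qh[of 0 0 "- \<rho>"] \<rho>(3) unfolding ends t zp_def zm_def by simp_all
      then have "t = 0" unfolding dc' using ka \<rho>(3) by (simp add: abs_if split: if_splits)
      then show ?thesis using t by simp
    qed
    have far: "\<bar>X\<bar> \<le> d (Q X Z) (c' 0)" "Z \<le> d (Q X Z) (c' 0)" if "0 \<le> Z" for X Z
    proof -
      have "\<bar>(vector [w + s * X, Z] - vector [w + s * 0, 0] :: real^2) $ i\<bar> \<le> d (Q X Z) (Q 0 0)" for i
        unfolding Q_def using F(2)[of "vector [w + s * X, Z]" "vector [w + s * 0, 0]"] that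
        by (simp add: dist_norm component_le_norm_cart del: vector_minus_component)
      from this[of 1] this[of 2] show "\<bar>X\<bar> \<le> d (Q X Z) (c' 0)" "Z \<le> d (Q X Z) (c' 0)"
        unfolding Q0 using s by (simp_all add: abs_mult)
    qed
    \<comment> \<open>While the projection has drifted by at most \<open>8 * K\<close>, a point at
      distance at least \<open>\<rho>\<close> from \<open>c' 0\<close> has height at least
      \<open>\<rho> / 2\<close>, so a move by \<open>\<rho> / 2\<close> adds at most
      \<open>K\<close>.\<close>
    have step: "\<bar>\<beta> z - \<beta> zp\<bar> \<le> (j + 1) * K"
      if y: "y \<in> Y" "z \<in> Y" "\<rho> \<le> d y (c' 0)" "d y z \<le> \<rho> / 2" and j: "\<bar>\<beta> y - \<beta> zp\<bar> \<le> j * K" "j \<le> 8" for y z j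
    proof -
      have "j * K \<le> 8 * K" using j(2) K0 by (intro mult_right_mono)
      then have "\<bar>\<beta> y\<bar> \<le> W + 9 * K" using j(1) zp(2) by linarith
      then have "\<rho> / 2 \<le> H (\<phi> (inv x) y)" using height[OF y(1)] y(3) \<rho>(2) by argo
      then have "\<bar>\<beta> y - \<beta> z\<bar> \<le> K" using contract[OF y(1,2)] y(4) by linarith
      then show ?thesis using j(1) unfolding distrib_right by linarith
    qed
    have r2: "0 \<le> \<rho> / 2" "0 \<le> \<rho>" "\<bar>\<rho>\<bar> = \<rho>" using \<rho>(3) by auto
    \<comment> \<open>Two steps up, four across, two down.\<close>
    have s1: "\<bar>\<beta> (Q \<rho> (\<rho> / 2)) - \<beta> zp\<bar> \<le> (0 + 1) * K"
      by (rule step[of "Q \<rho> 0"]) (use QY Qv far(1)[of 0 \<rho>] r2 ends in auto)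
    have s2: "\<bar>\<beta> (Q \<rho> \<rho>) - \<beta> zp\<bar> \<le> (0 + 1 + 1) * K"
      by (rule step[OF _ _ _ _ s1]) (use QY Qv far(1)[of "\<rho> / 2" \<rho>] r2 in auto)
    have s3: "\<bar>\<beta> (Q (\<rho> / 2) \<rho>) - \<beta> zp\<bar> \<le> (0 + 1 + 1 + 1) * K"
      by (rule step[OF _ _ _ _ s2]) (use QY Qh far(2)[of \<rho> \<rho>] r2 in auto)
    have s4: "\<bar>\<beta> (Q 0 \<rho>) - \<beta> zp\<bar> \<le> (0 + 1 + 1 + 1 + 1) * K"
      by (rule step[OF _ _ _ _ s3]) (use QY Qh far(2)[of \<rho> "\<rho> / 2"] r2 in auto)
    have s5: "\<bar>\<beta> (Q (- \<rho> / 2) \<rho>) - \<beta> zp\<bar> \<le> (0 + 1 + 1 + 1 + 1 + 1) * K"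
      by (rule step[OF _ _ _ _ s4]) (use QY Qh far(2)[of \<rho> 0] r2 in auto)
    have s6: "\<bar>\<beta> (Q (- \<rho>) \<rho>) - \<beta> zp\<bar> \<le> (0 + 1 + 1 + 1 + 1 + 1 + 1) * K"
      by (rule step[OF _ _ _ _ s5]) (use QY Qh far(2)[of \<rho> "- \<rho> / 2"] r2 in auto)
    have s7: "\<bar>\<beta> (Q (- \<rho>) (\<rho> / 2)) - \<beta> zp\<bar> \<le> (0 + 1 + 1 + 1 + 1 + 1 + 1 + 1) * K"
      by (rule step[OF _ _ _ _ s6]) (use QY Qv far(2)[of \<rho> "- \<rho>"] r2 in auto)
    have s8: "\<bar>\<beta> (Q (- \<rho>) 0) - \<beta> zp\<bar> \<le> (0 + 1 + 1 + 1 + 1 + 1 + 1 + 1 + 1) * K"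
      by (rule step[OF _ _ _ _ s7]) (use QY Qv far(1)[of "\<rho> / 2" "- \<rho>"] r2 in auto)
    then have "\<bar>\<beta> zm - \<beta> zp\<bar> \<le> 8 * K" unfolding ends by simp
    then show False using zp(1) zm n K0 by linarith
  qed
  then have "rank_one (\<phi> f)" unfolding rank_one_def using hyp by blast
  then show ?thesis using fN by blast
qed

end

theorem (in CAT0_action) rank_one_in_normal:
  assumes "N \<lhd> G" "infinite N" "non_elementary G" "g \<in> carrier G" "rank_one (\<phi> g)"
  shows "\<exists>f\<in>N. rank_one (\<phi> f)"
proof -
  obtain c \<tau> K where "axis_action Y d G \<phi> c g \<tau> K" using rank_one_axis assms by blast
  then interpret axis_action Y d G \<phi> c g \<tau> K .
  obtain x m where "x \<in> N" "transversal m x" using transversal_in_normal assms by blast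
  then show ?thesis using commutator_rank_one assms by blast
qed

section \<open>Counting\<close>

lemma sum_lists_prod_list:
  fixes w :: "'s \<Rightarrow> real"
  assumes "finite S"
  shows "(\<Sum>l | set l \<subseteq> S \<and> length l = k. prod_list (map w l)) = (\<Sum>s\<in>S. w s) ^ k"
proof (induction k)
  case 0
  have "{l. set l \<subseteq> S \<and> length l = 0} = {[]}" by auto
  then show ?case by simp
next
  case (Suc k)
  have inj: "inj_on (\<lambda>(xs, n). n # xs) ({l. set l \<subseteq> S \<and> length l = k} \<times> S)" by (auto simp: inj_on_def)
  have "(\<Sum>l | set l \<subseteq> S \<and> length l = Suc k. prod_list (map w l))
      = (\<Sum>(l, s)\<in>{l. set l \<subseteq> S \<and> length l = k} \<times> S. prod_list (map w l) * w s)"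
    unfolding lists_length_Suc_eq sum.reindex[OF inj] by (simp add: case_prod_beta mult.commute)
  also have "\<dots> = (\<Sum>l | set l \<subseteq> S \<and> length l = k. prod_list (map w l)) * (\<Sum>s\<in>S. w s)"
    by (simp add: sum_product sum.cartesian_product)
  finally show ?case using Suc by simp
qed

lemma geometric_tail:
  fixes r :: real
  assumes "0 \<le> r" "r < 1"
  shows "(\<Sum>m=k..n. r ^ m) \<le> r ^ k / (1 - r)"
proof -
  have "(\<Sum>m=k..n. r ^ m) \<le> (\<Sum>m. r ^ (m + k))"
  proof (cases "k \<le> n")
    case True
    have "(\<Sum>m=k..n. r ^ m) = (\<Sum>m\<in>{0..n - k}. r ^ (m + k))"
      using sum.shift_bounds_cl_nat_ivl[of "\<lambda>m. r ^ m" 0 k "n - k"] True by simp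
    also have "\<dots> \<le> (\<Sum>m. r ^ (m + k))"
      using assms by (intro sum_le_suminf) (auto simp: power_add summable_geometric intro: summable_mult2)
    finally show ?thesis .
  next
    case False
    then show ?thesis using assms
      by (auto simp: power_add summable_geometric intro!: suminf_nonneg summable_mult2)
  qed
  also have "\<dots> = r ^ k / (1 - r)"
    using assms suminf_mult2[OF summable_geometric, of r "r ^ k"] suminf_geometric[of r]
    by (simp add: power_add)
  finally show ?thesis .
qed

section \<open>Lower bounds for the growth rate from ping-pong\<close>

context CAT0_action
begin

lemma finite_orbit_ball: "x \<in> Y \<Longrightarrow> finite (orbit_ball G \<phi> d x n)"
proof -
  assume x: "x \<in> Y"
  have "orbit_ball G \<phi> d x n = (\<lambda>g. \<phi> g x) ` {g \<in> carrier G. d x (\<phi> g x) \<le> real n}"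
    unfolding orbit_ball_def by auto
  then show ?thesis using finite_displacement[OF x] by simp
qed

text \<open>\<open>growth_rate\<close> counts orbit points, whereas words are counted as group
  elements. The fibres are cosets of the finite stabilizer of \<open>x\<close>, written here as a
  displacement set.\<close>

lemma card_le_orbit_ball:
  assumes x: "x \<in> Y"
  shows "card {g \<in> carrier G. d x (\<phi> g x) \<le> real n}
       \<le> card {g \<in> carrier G. d x (\<phi> g x) \<le> 0} * card (orbit_ball G \<phi> d x n)"
proof -
  let ?S = "{g \<in> carrier G. d x (\<phi> g x) \<le> 0}" and ?O = "orbit_ball G \<phi> d x n"
  define Fb where "Fb y = {g \<in> carrier G. \<phi> g x = y}" for y
  have "card (Fb y) \<le> card ?S" if "y \<in> ?O" for y
  proof -
    obtain g0 where g0: "g0 \<in> carrier G" "y = \<phi> g0 x" using \<open>y \<in> ?O\<close> unfolding orbit_ball_def by auto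
    have "Fb y \<subseteq> (\<lambda>k. g0 \<otimes> k) ` ?S"
    proof
      fix g assume "g \<in> Fb y"
      then have g: "g \<in> carrier G" "\<phi> g x = \<phi> g0 x" using g0 unfolding Fb_def by auto
      have "\<phi> (inv g0 \<otimes> g) x = x" using g g0 x by (simp add: act_mult)
      moreover have "g = g0 \<otimes> (inv g0 \<otimes> g)" using g g0 by (simp add: m_assoc[symmetric])
      ultimately show "g \<in> (\<lambda>k. g0 \<otimes> k) ` ?S" using g g0 x by (intro image_eqI[of _ _ "inv g0 \<otimes> g"]) auto
    qed
    then show ?thesis using finite_displacement[OF x, of 0] by (meson card_image_le card_mono finite_imageI le_trans)
  qed
  moreover have "{g \<in> carrier G. d x (\<phi> g x) \<le> real n} \<subseteq> (\<Union>y\<in>?O. Fb y)"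
    unfolding Fb_def orbit_ball_def by auto
  moreover have "Fb y \<subseteq> {g \<in> carrier G. d x (\<phi> g x) \<le> d x y}" for y unfolding Fb_def by auto
  then have "finite (Fb y)" for y using finite_displacement[OF x] finite_subset by blast
  ultimately have "card {g \<in> carrier G. d x (\<phi> g x) \<le> real n} \<le> (\<Sum>y\<in>?O. card ?S)"
  proof -
    assume *: "\<And>y. y \<in> ?O \<Longrightarrow> card (Fb y) \<le> card ?S"
      "{g \<in> carrier G. d x (\<phi> g x) \<le> real n} \<subseteq> (\<Union>y\<in>?O. Fb y)" "\<And>y. finite (Fb y)"
    have "card {g \<in> carrier G. d x (\<phi> g x) \<le> real n} \<le> card (\<Union>y\<in>?O. Fb y)"
      using *(2,3) finite_orbit_ball[OF x] by (intro card_mono finite_UN_I)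
    also have "\<dots> \<le> (\<Sum>y\<in>?O. card (Fb y))" by (rule card_UN_le[OF finite_orbit_ball[OF x]])
    also have "\<dots> \<le> (\<Sum>y\<in>?O. card ?S)" by (rule sum_mono[OF *(1)])
    finally show ?thesis .
  qed
  then show ?thesis by (simp add: mult.commute)
qed

definition lprod :: "'a list \<Rightarrow> 'a" where "lprod l = foldr (\<lambda>s g. s \<otimes> g) l \<one>"

lemma lprod_simps [simp]: "lprod [] = \<one>" "lprod (s # l) = s \<otimes> lprod l"
  unfolding lprod_def by simp_all

lemma lprod_closed [simp]: "set l \<subseteq> carrier G \<Longrightarrow> lprod l \<in> carrier G"
  by (induction l) simp_all

text \<open>Words of equal length in \<open>S\<close> have distinct orbit points, so the weights of all words of
  length \<open>k\<close> sum to the \<open>k\<close>-th power of the weight of \<open>S\<close>, whereas exponential growth below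
  \<open>\<sigma>\<close> would make this sum tend to 0.\<close>

lemma ping_pong_growth:
  assumes S: "finite S" "S \<subseteq> carrier G" and P: "P \<subseteq> Y" "p0 \<in> P"
    and ping: "\<And>s e. s \<in> S \<Longrightarrow> e \<in> P \<Longrightarrow> \<phi> s e \<in> P"
    and pong: "\<And>s s' e e'. s \<in> S \<Longrightarrow> s' \<in> S \<Longrightarrow> e \<in> P \<Longrightarrow> e' \<in> P \<Longrightarrow> \<phi> s e = \<phi> s' e' \<Longrightarrow> s = s'"
    and \<sigma>: "0 < \<sigma>" "1 \<le> (\<Sum>s\<in>S. exp (- \<sigma> * (d p0 (\<phi> s p0) + 2)))" and x: "x \<in> Y"
  shows "ereal \<sigma> \<le> growth_rate G \<phi> d x (carrier G)"
proof (rule ccontr)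
  assume "\<not> ?thesis"
  then have "growth_rate G \<phi> d x (carrier G) < ereal \<sigma>" by simp
  moreover have int: "orbit_ball G \<phi> d x n \<inter> (\<lambda>g. \<phi> g x) ` carrier G = orbit_ball G \<phi> d x n" for n
    unfolding orbit_ball_def by auto
  ultimately have "limsup (\<lambda>n. ereal (ln (real (card (orbit_ball G \<phi> d x n))) / real n)) < ereal \<sigma>"
    unfolding growth_rate_def by (simp only: int)
  then obtain \<sigma>0 where *: "limsup (\<lambda>n. ereal (ln (real (card (orbit_ball G \<phi> d x n))) / real n)) < ereal \<sigma>0"
    and "ereal \<sigma>0 < ereal \<sigma>"
    using ereal_dense2 by blast
  then have \<sigma>0: "\<sigma>0 < \<sigma>" by simp
  define \<sigma>1 where "\<sigma>1 = max \<sigma>0 0"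
  have \<sigma>1: "0 \<le> \<sigma>1" "\<sigma>1 < \<sigma>" using \<sigma>0 \<sigma>(1) unfolding \<sigma>1_def by auto
  obtain n0 where n0: "\<And>n. n0 \<le> n \<Longrightarrow> ereal (ln (real (card (orbit_ball G \<phi> d x n))) / real n) < ereal \<sigma>0"
    using Limsup_lessD[OF *] unfolding eventually_sequentially by blast
  define N where "N n = card {g \<in> carrier G. d x (\<phi> g x) \<le> real n}" for n
  define st where "st = card {g \<in> carrier G. d x (\<phi> g x) \<le> 0}"
  have Nb: "real (N n) \<le> real st * exp (\<sigma>1 * real n)" if n: "max n0 1 \<le> n" for n
  proof -
    have "x \<in> orbit_ball G \<phi> d x n" unfolding orbit_ball_def using x by (auto intro!: exI[of _ \<one>])
    then have c: "0 < card (orbit_ball G \<phi> d x n)" using finite_orbit_ball[OF x] card_gt_0_iff by blast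
    have "ereal (ln (real (card (orbit_ball G \<phi> d x n))) / real n) \<le> ereal \<sigma>0" using n0[of n] n by simp
    then have "ln (real (card (orbit_ball G \<phi> d x n))) / real n \<le> \<sigma>1" unfolding \<sigma>1_def by simp
    then have "ln (real (card (orbit_ball G \<phi> d x n))) \<le> \<sigma>1 * real n" using n by (simp add: divide_le_eq)
    then have "real (card (orbit_ball G \<phi> d x n)) \<le> exp (\<sigma>1 * real n)"
      using c by (simp add: ln_le_cancel_iff[symmetric, of _ "exp _"] del: ln_le_cancel_iff)
    then have "real st * real (card (orbit_ball G \<phi> d x n)) \<le> real st * exp (\<sigma>1 * real n)"
      by (rule mult_left_mono) simp
    moreover have "real (N n) \<le> real st * real (card (orbit_ball G \<phi> d x n))"
      using of_nat_mono[OF card_le_orbit_ball[OF x, of n], where ?'a = real] unfolding N_def st_def by simp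
    ultimately show ?thesis by linarith
  qed
  have p0Y: "p0 \<in> Y" using P by blast
  \<comment> \<open>With positive integral lengths a word of \<open>k\<close> letters has length at
    least \<open>k\<close>. Rounding up and adding 1 costs at most 2, whence the 2 in the
    hypothesis.\<close>
  define L where "L s = nat \<lceil>d p0 (\<phi> s p0)\<rceil> + 1" for s
  have L: "d p0 (\<phi> s p0) \<le> real (L s)" "real (L s) \<le> d p0 (\<phi> s p0) + 2" "1 \<le> L s" for s
  proof -
    have "0 \<le> d p0 (\<phi> s p0)" by simp
    then show "d p0 (\<phi> s p0) \<le> real (L s)" "real (L s) \<le> d p0 (\<phi> s p0) + 2" unfolding L_def by linarith+
  qed (simp add: L_def)
  have "(\<Sum>s\<in>S. exp (- \<sigma> * (d p0 (\<phi> s p0) + 2))) \<le> (\<Sum>s\<in>S. exp (- \<sigma> * real (L s)))"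
    using \<sigma>(1) L(2) by (intro sum_mono) simp
  then have S1: "1 \<le> (\<Sum>s\<in>S. exp (- \<sigma> * real (L s)))" using \<sigma>(2) by linarith
  define W where "W k = {l. set l \<subseteq> S \<and> length l = k}" for k
  define LL where "LL l = sum_list (map L l)" for l
  have finW: "finite (W k)" for k unfolding W_def using finite_lists_length_eq[OF S(1)] .
  have WG: "lprod l \<in> carrier G" if "l \<in> W k" for l k using that S(2) unfolding W_def by auto
  have inP: "\<phi> (lprod l) p0 \<in> P" if "set l \<subseteq> S" for l
    using that
  proof (induction l)
    case (Cons s l)
    then have "lprod l \<in> carrier G" "s \<in> carrier G" using S(2) by auto
    then show ?case using Cons ping p0Y by (simp add: act_mult)
  qed (use P p0Y in simp)
  have inj: "l = l'" if "set l \<subseteq> S" "set l' \<subseteq> S" "length l = length l'" "\<phi> (lprod l) p0 = \<phi> (lprod l') p0" for l l'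
    using that
  proof (induction l arbitrary: l')
    case (Cons s l)
    obtain s' m where l': "l' = s' # m" using Cons.prems(3) by (cases l') auto
    have G: "lprod l \<in> carrier G" "s \<in> carrier G" "lprod m \<in> carrier G" "s' \<in> carrier G"
      using Cons.prems S(2) l' by auto
    have e: "\<phi> s (\<phi> (lprod l) p0) = \<phi> s' (\<phi> (lprod m) p0)" using Cons.prems(4) l' G p0Y by (simp add: act_mult)
    have "s = s'" by (rule pong[OF _ _ _ _ e]) (use Cons.prems l' inP in auto)
    have "\<phi> (inv s) (\<phi> s (\<phi> (lprod l) p0)) = \<phi> (inv s) (\<phi> s (\<phi> (lprod m) p0))" using e \<open>s = s'\<close> by simp
    then have "\<phi> (lprod l) p0 = \<phi> (lprod m) p0" using G p0Y by simp
    then have "l = m" using Cons.IH[of m] Cons.prems l' by auto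
    then show ?case using l' \<open>s = s'\<close> by simp
  qed simp
  have len: "d p0 (\<phi> (lprod l) p0) \<le> real (LL l)" if "set l \<subseteq> carrier G" for l
    using that
  proof (induction l)
    case (Cons s l)
    have G: "lprod l \<in> carrier G" "s \<in> carrier G" using Cons.prems by auto
    have "d p0 (\<phi> (lprod (s # l)) p0) \<le> d p0 (\<phi> s p0) + d (\<phi> s p0) (\<phi> s (\<phi> (lprod l) p0))"
      using G p0Y triangle[of p0 "\<phi> s p0" "\<phi> s (\<phi> (lprod l) p0)"] by (simp add: act_mult)
    then show ?case using Cons L(1)[of s] G p0Y unfolding LL_def by simp
  qed (use p0Y in \<open>simp add: LL_def\<close>)
  \<comment> \<open>The cost of moving the base point from \<open>p0\<close> to
    \<open>x\<close>.\<close>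
  define q where "q = nat \<lceil>2 * d x p0\<rceil>"
  have q: "2 * d x p0 \<le> real q" unfolding q_def by linarith
  have fiber: "card {l \<in> W k. LL l = m} \<le> N (m + q)" for k m
    unfolding N_def
  proof (rule card_inj_on_le[of lprod])
    show "inj_on lprod {l \<in> W k. LL l = m}"
      by (rule inj_onI) (use inj in \<open>auto simp: W_def\<close>)
    show "lprod ` {l \<in> W k. LL l = m} \<subseteq> {g \<in> carrier G. d x (\<phi> g x) \<le> real (m + q)}"
    proof safe
      fix l assume l: "l \<in> W k" "m = LL l"
      show g: "lprod l \<in> carrier G" using WG[OF l(1)] .
      have "d x (\<phi> (lprod l) x) \<le> d x p0 + (d p0 (\<phi> (lprod l) p0) + d (\<phi> (lprod l) p0) (\<phi> (lprod l) x))"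
        using triangle[of x p0 "\<phi> (lprod l) x"] triangle[of p0 "\<phi> (lprod l) p0" "\<phi> (lprod l) x"] x p0Y g by simp
      moreover have "d p0 (\<phi> (lprod l) p0) \<le> real (LL l)" using len l S(2) unfolding W_def by blast
      ultimately show "d x (\<phi> (lprod l) x) \<le> real (LL l + q)" using q x p0Y g by (simp add: commute)
    qed
  qed (rule finite_displacement[OF x])
  define r where "r = exp (\<sigma>1 - \<sigma>)"
  have r: "0 < r" "r < 1" using \<sigma>1 unfolding r_def by auto
  define A where "A = real st * exp (\<sigma>1 * real q)"
  have A0: "0 \<le> A" unfolding A_def by simp
  have main: "1 \<le> A * (r ^ k / (1 - r))" if k: "max n0 1 \<le> k" for k
  proof -
    define T where "T = {k..Max (insert 0 (LL ` W k)) + k}"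
    have "1 \<le> (\<Sum>s\<in>S. exp (- \<sigma> * real (L s))) ^ k" using S1 by (rule one_le_power)
    also have "\<dots> = (\<Sum>l\<in>W k. prod_list (map (\<lambda>s. exp (- \<sigma> * real (L s))) l))"
      unfolding W_def using sum_lists_prod_list[OF S(1)] by simp
    also have "\<dots> = (\<Sum>l\<in>W k. exp (- \<sigma> * real (LL l)))"
    proof (rule sum.cong[OF refl])
      fix l
      show "prod_list (map (\<lambda>s. exp (- \<sigma> * real (L s))) l) = exp (- \<sigma> * real (LL l))"
        by (induction l) (simp_all add: LL_def exp_add[symmetric] algebra_simps)
    qed
    also have "\<dots> = (\<Sum>m\<in>T. \<Sum>l | l \<in> W k \<and> LL l = m. exp (- \<sigma> * real (LL l)))"
    proof (rule sum.group[symmetric, OF finW])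
      have "length l \<le> LL l" for l
      proof (induction l)
        case (Cons s l)
        then show ?case using L(3)[of s] unfolding LL_def by simp
      qed simp
      then have "k \<le> LL l" if "l \<in> W k" for l using that unfolding W_def by force
      moreover have "LL l \<le> Max (insert 0 (LL ` W k)) + k" if "l \<in> W k" for l
        using Max_ge[of "insert 0 (LL ` W k)" "LL l"] that finW[of k] by (simp add: trans_le_add1)
      ultimately show "LL ` W k \<subseteq> T" unfolding T_def by auto
    qed (simp add: T_def)
    also have "\<dots> = (\<Sum>m\<in>T. real (card {l \<in> W k. LL l = m}) * exp (- \<sigma> * real m))" by simp
    also have "\<dots> \<le> (\<Sum>m\<in>T. A * r ^ m)"
    proof (rule sum_mono)
      fix m assume "m \<in> T"
      then have m: "max n0 1 \<le> m + q" using k unfolding T_def by auto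
      have "real (card {l \<in> W k. LL l = m}) \<le> real st * exp (\<sigma>1 * real (m + q))"
        using fiber[of k m] Nb[OF m] by linarith
      then have "real (card {l \<in> W k. LL l = m}) * exp (- \<sigma> * real m)
          \<le> real st * exp (\<sigma>1 * real (m + q)) * exp (- \<sigma> * real m)" by (rule mult_right_mono) simp
      also have "\<dots> = A * r ^ m" unfolding A_def r_def exp_of_nat_mult[symmetric]
        by (simp add: exp_add[symmetric] algebra_simps)
      finally show "real (card {l \<in> W k. LL l = m}) * exp (- \<sigma> * real m) \<le> A * r ^ m" .
    qed
    also have "\<dots> = A * (\<Sum>m\<in>T. r ^ m)" by (simp add: sum_distrib_left)
    also have "\<dots> \<le> A * (r ^ k / (1 - r))"
      unfolding T_def using geometric_tail[of r k] r A0 by (intro mult_left_mono) auto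
    finally show ?thesis .
  qed
  have "(\<lambda>k. A * (r ^ k / (1 - r))) \<longlonglongrightarrow> A * (0 / (1 - r))"
    using r by (intro tendsto_intros LIMSEQ_power_zero) auto
  then have "\<forall>\<^sub>F k in sequentially. A * (r ^ k / (1 - r)) < 1" using order_tendstoD(2)[of _ "A * (0 / (1 - r))" sequentially 1] by simp
  then obtain k1 where "\<And>k. k1 \<le> k \<Longrightarrow> A * (r ^ k / (1 - r)) < 1" unfolding eventually_sequentially by blast
  from this[of "max k1 (max n0 1)"] main[of "max k1 (max n0 1)"] show False by simp
qed

text \<open>By continuity in the exponent, a finite sum that is at least 2 at \<delta> stays above 1
  at some larger exponent.\<close>

theorem ping_pong_growth_gt:
  assumes S: "finite S" "S \<subseteq> carrier G" and P: "P \<subseteq> Y" "p0 \<in> P"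
    and ping: "\<And>s e. s \<in> S \<Longrightarrow> e \<in> P \<Longrightarrow> \<phi> s e \<in> P"
    and pong: "\<And>s s' e e'. s \<in> S \<Longrightarrow> s' \<in> S \<Longrightarrow> e \<in> P \<Longrightarrow> e' \<in> P \<Longrightarrow> \<phi> s e = \<phi> s' e' \<Longrightarrow> s = s'"
    and \<delta>: "0 \<le> \<delta>" "2 \<le> (\<Sum>s\<in>S. exp (- \<delta> * (d p0 (\<phi> s p0) + 2)))" and x: "x \<in> Y"
  shows "ereal \<delta> < growth_rate G \<phi> d x (carrier G)"
proof -
  let ?f = "\<lambda>\<sigma>. \<Sum>s\<in>S. exp (- \<sigma> * (d p0 (\<phi> s p0) + 2))"
  have "(?f \<longlongrightarrow> ?f \<delta>) (at_right \<delta>)" by (intro tendsto_intros)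
  then have "\<forall>\<^sub>F \<sigma> in at_right \<delta>. 1 < ?f \<sigma>" by (rule order_tendstoD) (use \<delta> in simp)
  moreover have "\<forall>\<^sub>F \<sigma> in at_right \<delta>. \<delta> < \<sigma>" by (rule eventually_at_right_less)
  ultimately have "\<forall>\<^sub>F \<sigma> in at_right \<delta>. 1 < ?f \<sigma> \<and> \<delta> < \<sigma>" by (rule eventually_conj)
  then obtain \<sigma> where \<sigma>: "1 < ?f \<sigma>" "\<delta> < \<sigma>" using eventually_happens'[of "at_right \<delta>"] by auto
  have "ereal \<sigma> \<le> growth_rate G \<phi> d x (carrier G)"
    by (rule ping_pong_growth[OF S P ping pong]) (use \<sigma> \<delta> x in auto)
  then show ?thesis using \<sigma>(2) by (meson less_ereal.simps(1) less_le_trans)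
qed

end

section \<open>Submultiplicative sequences and exponential series\<close>

lemma submultiplicative_power:
  fixes v :: "nat \<Rightarrow> real"
  assumes v: "\<And>n. 1 \<le> v n" "mono v" "\<And>a b. v (a + b) \<le> v a * v b" and m: "0 < m"
  shows "v n \<le> v m ^ (n div m + 1)"
proof -
  have "v (m * Suc j) \<le> v m ^ Suc j" for j
  proof (induction j)
    case (Suc j)
    have "v (m * Suc (Suc j)) \<le> v m * v (m * Suc j)" using v(3)[of m "m * Suc j"] by simp
    also have "\<dots> \<le> v m * v m ^ Suc j" using Suc v(1)[of m] by (intro mult_left_mono) auto
    finally show ?case by simp
  qed simp
  from this[of "n div m"] have "v (m * (n div m + 1)) \<le> v m ^ (n div m + 1)" by simp
  moreover have "n \<le> m * (n div m + 1)"
    using dividend_less_times_div[OF m, of n] by simp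
  ultimately show ?thesis using monoD[OF v(2), of n "m * (n div m + 1)"] by linarith
qed

text \<open>The upper bound in Fekete's lemma, from cutting \<open>n\<close> into blocks of length
  \<open>m\<close>. The shift by \<open>q\<close> costs a factor \<open>v q\<close>, which
  disappears after division by \<open>n\<close>.\<close>

lemma submultiplicative_limsup:
  fixes v u :: "nat \<Rightarrow> real"
  assumes v: "\<And>n. 1 \<le> v n" "mono v" "\<And>a b. v (a + b) \<le> v a * v b" and m: "0 < m"
    and u: "\<And>n. 0 \<le> u n" "\<And>n. u n \<le> v (n + q)"
  shows "limsup (\<lambda>n. ereal (ln (u n) / real n)) \<le> ereal (ln (v m) / real m)"
proof -
  define e where "e n = (ln (v q) + ln (v m)) / real n + ln (v m) / real m" for n :: nat
  have pos: "0 < v n" "0 \<le> ln (v n)" for n using v(1)[of n] by auto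
  have "ln (u n) / real n \<le> e n" if n: "0 < n" for n
  proof -
    have "ln (u n) \<le> ln (v n) + ln (v q)"
    proof (cases "u n = 0")
      case True then show ?thesis using pos by simp
    next
      case False
      then have "0 < u n" using u(1)[of n] by simp
      then have "ln (u n) \<le> ln (v n * v q)"
        using u(2)[of n] v(3)[of n q] pos by (intro ln_mono) auto
      also have "\<dots> = ln (v n) + ln (v q)"
        using pos(1)[of n] pos(1)[of q] by (simp add: ln_mult)
      finally show ?thesis .
    qed
    moreover have "ln (v n) \<le> real (n div m + 1) * ln (v m)"
    proof -
      have "ln (v n) \<le> ln (v m ^ (n div m + 1))"
        using submultiplicative_power[of v, OF v m] pos by (intro ln_mono) auto
      also have "\<dots> = real (n div m + 1) * ln (v m)" by (rule ln_realpow)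
      finally show ?thesis .
    qed
    moreover have "real (n div m + 1) * ln (v m) \<le> (real n / real m + 1) * ln (v m)"
      using pos of_nat_div_le_of_nat[of n m, where ?'a = real] by (intro mult_right_mono) auto
    ultimately have "ln (u n) \<le> (real n / real m + 1) * ln (v m) + ln (v q)" by linarith
    also have "\<dots> = real n * e n" unfolding e_def using n m by (simp add: field_simps)
    finally show ?thesis using n by (simp add: divide_le_eq mult.commute)
  qed
  then have "\<forall>\<^sub>F n in sequentially. ereal (ln (u n) / real n) \<le> ereal (e n)"
    unfolding eventually_sequentially by (intro exI[of _ 1]) simp
  then have "limsup (\<lambda>n. ereal (ln (u n) / real n)) \<le> limsup (\<lambda>n. ereal (e n))" by (rule Limsup_mono)
  also have "e \<longlonglongrightarrow> 0 + ln (v m) / real m"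
    unfolding e_def by (intro tendsto_intros lim_const_over_n)
  then have "limsup (\<lambda>n. ereal (e n)) = ereal (ln (v m) / real m)"
    by (intro lim_imp_Limsup) (auto simp: tendsto_ereal)
  finally show ?thesis .
qed

text \<open>By summation by parts over the balls \<open>{x \<in> U. w x \<le> n}\<close>.\<close>

lemma exponential_series_unbounded:
  fixes w :: "'x \<Rightarrow> real"
  assumes fin: "\<And>n::nat. finite {x \<in> U. w x \<le> real n}" and \<delta>: "0 < \<delta>" and C: "0 < C"
    and card: "\<And>n. n0 \<le> n \<Longrightarrow> C * exp (\<delta> * real n) \<le> real (card {x \<in> U. w x \<le> real n})"
  shows "\<exists>n. R \<le> (\<Sum>x | x \<in> U \<and> w x \<le> real n. exp (- \<delta> * w x))"
proof -
  define B where "B n = {x \<in> U. w x \<le> real n}" for n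
  define T where "T n = (\<Sum>x\<in>B n. exp (- \<delta> * w x))" for n
  define E where "E n = exp (- \<delta> * real n)" for n
  have finB: "finite (B n)" for n unfolding B_def by (rule fin)
  have low: "E n \<le> exp (- \<delta> * w x)" if "x \<in> B n" for x n using that \<delta> unfolding B_def E_def by simp
  have parts: "real (card (B n)) * E n + (\<Sum>j<n. real (card (B j)) * (E j - E (Suc j))) \<le> T n" for n
  proof (induction n)
    case 0
    have "(\<Sum>x\<in>B 0. E 0) \<le> T 0" unfolding T_def by (intro sum_mono low)
    then show ?case by simp
  next
    case (Suc n)
    have sub: "B n \<subseteq> B (Suc n)" unfolding B_def by auto
    have "T (Suc n) = T n + (\<Sum>x\<in>B (Suc n) - B n. exp (- \<delta> * w x))"
      unfolding T_def using sum.subset_diff[OF sub finB] by (simp add: add.commute)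
    moreover have "(\<Sum>x\<in>B (Suc n) - B n. E (Suc n)) \<le> (\<Sum>x\<in>B (Suc n) - B n. exp (- \<delta> * w x))"
      by (intro sum_mono low) auto
    moreover have "(\<Sum>x\<in>B (Suc n) - B n. E (Suc n)) = (real (card (B (Suc n))) - real (card (B n))) * E (Suc n)"
      using sub finB card_mono[OF finB sub] by (simp add: card_Diff_subset of_nat_diff)
    ultimately show ?case using Suc by (simp add: algebra_simps)
  qed
  define k where "k = C * (1 - exp (- \<delta>))"
  have k: "0 < k" unfolding k_def using C \<delta> by simp
  \<comment> \<open>Each late term of the partial summation is at least the same \<open>k\<close>,
    so the partial sums grow at least linearly.\<close>
  have term_ge: "k \<le> real (card (B j)) * (E j - E (Suc j))" if "n0 \<le> j" for j
  proof -
    have E: "E j - E (Suc j) = exp (- (\<delta> * real j)) * (1 - exp (- \<delta>))"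
      unfolding E_def by (simp add: right_diff_distrib exp_add[symmetric] algebra_simps)
    have "k = C * exp (\<delta> * real j) * (exp (- (\<delta> * real j)) * (1 - exp (- \<delta>)))"
      unfolding k_def by (simp add: exp_minus)
    also have "\<dots> \<le> real (card (B j)) * (exp (- (\<delta> * real j)) * (1 - exp (- \<delta>)))"
      using card[OF that] \<delta> unfolding B_def by (intro mult_right_mono) auto
    finally show ?thesis unfolding E .
  qed
  have nonneg: "0 \<le> real (card (B j)) * (E j - E (Suc j))" for j
    unfolding E_def using \<delta> by (intro mult_nonneg_nonneg) auto
  obtain i :: nat where i: "R / k \<le> real i" using real_arch_simple by blast
  have "R \<le> real i * k" using i k by (simp add: divide_le_eq)
  also have "\<dots> = (\<Sum>j\<in>{n0..<n0 + i}. k)" by simp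
  also have "\<dots> \<le> (\<Sum>j\<in>{n0..<n0 + i}. real (card (B j)) * (E j - E (Suc j)))" using term_ge by (intro sum_mono) auto
  also have "\<dots> \<le> (\<Sum>j<n0 + i. real (card (B j)) * (E j - E (Suc j)))"
    using nonneg by (intro sum_mono2) auto
  also have "\<dots> \<le> T (n0 + i)"
  proof -
    have "0 \<le> real (card (B (n0 + i))) * E (n0 + i)" unfolding E_def by simp
    then show ?thesis using parts[of "n0 + i"] by linarith
  qed
  finally show ?thesis unfolding T_def B_def by blast
qed

lemma maximal_separated:
  fixes r :: "'x \<Rightarrow> 'x \<Rightarrow> real"
  assumes "finite A" and r: "\<And>x. x \<in> A \<Longrightarrow> r x x \<le> C" "\<And>x y. r x y = r y x"
  shows "\<exists>B\<subseteq>A. (\<forall>x\<in>B. \<forall>y\<in>B. x \<noteq> y \<longrightarrow> C < r x y) \<and> (\<forall>x\<in>A. \<exists>y\<in>B. r x y \<le> C)"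
  using assms(1) r(1)
proof (induction A)
  case (insert a A)
  then obtain B where B: "B \<subseteq> A" "\<forall>x\<in>B. \<forall>y\<in>B. x \<noteq> y \<longrightarrow> C < r x y" "\<forall>x\<in>A. \<exists>y\<in>B. r x y \<le> C" by blast
  show ?case
  proof (cases "\<exists>y\<in>B. r a y \<le> C")
    case True then show ?thesis using B by (intro exI[of _ B]) auto
  next
    case False
    then have "\<forall>y\<in>B. C < r a y \<and> C < r y a" using r(2) by (metis not_le)
    then show ?thesis using B insert.prems by (intro exI[of _ "insert a B"]) auto
  qed
qed simp

section \<open>Quotients\<close>

context CAT0_action
begin

text \<open>Cosets are counted instead of points of the quotient space, because submultiplicativity
  comes from products of cosets.\<close>

definition qball :: "'a set \<Rightarrow> 'b \<Rightarrow> nat \<Rightarrow> 'a set set" where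
  "qball N p n = (\<lambda>g. N #> g) ` {g \<in> carrier G. d p (\<phi> g p) \<le> real n}"

definition minimal :: "'a set \<Rightarrow> 'b \<Rightarrow> 'a \<Rightarrow> bool" where
  "minimal N p a \<longleftrightarrow> a \<in> carrier G \<and> (\<forall>x\<in>N. d p (\<phi> a p) \<le> d p (\<phi> (x \<otimes> a) p))"

lemma finite_qball: "p \<in> Y \<Longrightarrow> finite (qball N p n)"
  unfolding qball_def using finite_displacement by simp

lemma qball_mono: "n \<le> n' \<Longrightarrow> qball N p n \<subseteq> qball N p n'"
  unfolding qball_def by (intro image_mono) auto

lemma orbit_codiameter:
  assumes "p \<in> Y"
  shows "\<exists>D::nat. \<forall>y\<in>Y. \<exists>g\<in>carrier G. d y (\<phi> g p) \<le> real D"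
proof -
  obtain Z x0 R where Z: "\<forall>y\<in>Y. \<exists>g\<in>carrier G. \<exists>k\<in>Z. y = \<phi> g k"
    "\<forall>k\<in>Z. k \<in> Y \<and> x0 \<in> Y \<and> d x0 k \<le> R"
    using fundamental_domain by blast
  obtain D :: nat where D: "R + d x0 p \<le> real D" using real_arch_simple by blast
  show ?thesis
  proof (intro exI[of _ D] ballI)
    fix y assume "y \<in> Y"
    then obtain g k where gk: "g \<in> carrier G" "k \<in> Z" "y = \<phi> g k" using Z(1) by blast
    then have k: "k \<in> Y" "x0 \<in> Y" "d x0 k \<le> R" using Z(2) by auto
    have "d y (\<phi> g p) \<le> d x0 k + d x0 p" using gk k assms triangle[of k x0 p] by (simp add: commute)
    then show "\<exists>g\<in>carrier G. d y (\<phi> g p) \<le> real D" using gk k D by force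
  qed
qed

text \<open>The geodesic from \<open>p\<close> to \<open>\<phi> g p\<close> is cut into pieces of
  length at most \<open>n\<close> and \<open>m\<close>, and the cut point is replaced by an orbit
  point within \<open>D\<close>. This factors \<open>g\<close>, and with it the coset, at the cost
  of \<open>D\<close> in each factor.\<close>

lemma qball_submultiplicative:
  assumes N: "N \<lhd> G" and p: "p \<in> Y" and D: "\<forall>y\<in>Y. \<exists>g\<in>carrier G. d y (\<phi> g p) \<le> real D"
  shows "card (qball N p (n + m)) \<le> card (qball N p (n + D)) * card (qball N p (m + D))"
proof -
  interpret nrm: normal N G by (rule N)
  have "qball N p (n + m) \<subseteq> (\<lambda>(X, Z). X <#> Z) ` (qball N p (n + D) \<times> qball N p (m + D))"
  proof
    fix X assume "X \<in> qball N p (n + m)"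
    then obtain g where g: "g \<in> carrier G" "X = N #> g" "d p (\<phi> g p) \<le> real (n + m)" unfolding qball_def by auto
    define L where "L = d p (\<phi> g p)"
    have gp: "\<phi> g p \<in> Y" using g p by auto
    obtain s where s: "0 \<le> s" "s \<le> 1" "s * L \<le> real n" "(1 - s) * L \<le> real m"
    proof (cases "L \<le> real n")
      case True then show thesis using that[of 1] by simp
    next
      case False
      then have "0 < L" using of_nat_0_le_iff[of n] by linarith
      then show thesis using that[of "real n / L"] False g(3) unfolding L_def[symmetric]
        by (simp add: left_diff_distrib divide_le_eq)
    qed
    define z where "z = pt p (\<phi> g p) s"
    have z: "z \<in> Y" "d p z \<le> real n" "d z (\<phi> g p) \<le> real m"
      unfolding z_def using pt_props[OF p gp s(1,2)] s(3,4) unfolding L_def by auto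
    obtain g1 where g1: "g1 \<in> carrier G" "d z (\<phi> g1 p) \<le> real D" using D z by blast
    have g1p: "\<phi> g1 p \<in> Y" using g1 p by auto
    define g2 where "g2 = inv g1 \<otimes> g"
    have g2: "g2 \<in> carrier G" "g1 \<otimes> g2 = g" unfolding g2_def using g g1 by (simp_all add: m_assoc[symmetric])
    have "d p (\<phi> g1 p) \<le> real (n + D)" using triangle[OF p z(1) g1p] z g1 by simp
    moreover have "d p (\<phi> g2 p) = d (\<phi> g1 p) (\<phi> g p)"
      unfolding g2_def using g g1 p act_dist_inv[of g1 "\<phi> g p" p] by (simp add: act_mult commute)
    then have "d p (\<phi> g2 p) \<le> real (m + D)" using triangle[OF g1p z(1) gp] z g1 by (simp add: commute)
    moreover have "X = (N #> g1) <#> (N #> g2)" using nrm.rcos_sum[OF g1(1) g2(1)] g2 g by simp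
    ultimately show "X \<in> (\<lambda>(X, Z). X <#> Z) ` (qball N p (n + D) \<times> qball N p (m + D))"
      unfolding qball_def using g1 g2 by force
  qed
  then have "card (qball N p (n + m)) \<le> card (qball N p (n + D) \<times> qball N p (m + D))"
    using finite_qball[OF p] by (intro surj_card_le) auto
  then show ?thesis by (simp add: card_cartesian_product)
qed

text \<open>The displacement of \<open>p\<close> attains its minimum on each coset, as balls contain
  finitely many group elements.\<close>

lemma card_qball_le_minimal:
  assumes N: "N \<lhd> G" and p: "p \<in> Y"
  shows "card (qball N p n) \<le> card {a. minimal N p a \<and> d p (\<phi> a p) \<le> real n}"
proof -
  interpret nrm: normal N G by (rule N)
  have "qball N p n \<subseteq> (\<lambda>a. N #> a) ` {a. minimal N p a \<and> d p (\<phi> a p) \<le> real n}"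
  proof
    fix X assume "X \<in> qball N p n"
    then obtain g where g: "g \<in> carrier G" "X = N #> g" "d p (\<phi> g p) \<le> real n" unfolding qball_def by auto
    have sub: "X \<subseteq> carrier G" using g nrm.subset r_coset_subset_G by simp
    define F where "F = {a \<in> X. d p (\<phi> a p) \<le> d p (\<phi> g p)}"
    have "F \<subseteq> {a \<in> carrier G. d p (\<phi> a p) \<le> d p (\<phi> g p)}" unfolding F_def using sub by auto
    then have fin: "finite F" using finite_displacement[OF p] finite_subset by blast
    have gX: "g \<in> X" unfolding g(2) by (rule rcos_self[OF g(1) nrm.subgroup_axioms])
    then have gF: "g \<in> F" unfolding F_def by simp
    define a where "a = arg_min_on (\<lambda>a. d p (\<phi> a p)) F"
    have a: "a \<in> F" "\<And>y. y \<in> F \<Longrightarrow> d p (\<phi> a p) \<le> d p (\<phi> y p)"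
      using arg_min_if_finite(1)[OF fin, of "\<lambda>a. d p (\<phi> a p)"] arg_min_least[OF fin, of _ "\<lambda>a. d p (\<phi> a p)"] gF
      unfolding a_def by auto
    have aX: "a \<in> X" "a \<in> carrier G" "d p (\<phi> a p) \<le> d p (\<phi> g p)" using a sub unfolding F_def by auto
    have Xa: "X = N #> a" using aX(1) g repr_independence nrm.subgroup_axioms by blast
    have "d p (\<phi> a p) \<le> d p (\<phi> (x \<otimes> a) p)" if "x \<in> N" for x
    proof (cases "d p (\<phi> (x \<otimes> a) p) \<le> d p (\<phi> g p)")
      case True
      have "x \<otimes> a \<in> X" unfolding Xa r_coset_def using that by auto
      then show ?thesis using a(2) True unfolding F_def by simp
    qed (use aX in simp)
    then have "minimal N p a" unfolding minimal_def using aX by simp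
    then show "X \<in> (\<lambda>a. N #> a) ` {a. minimal N p a \<and> d p (\<phi> a p) \<le> real n}" using Xa aX g by auto
  qed
  moreover have "{a. minimal N p a \<and> d p (\<phi> a p) \<le> real n} \<subseteq> {a \<in> carrier G. d p (\<phi> a p) \<le> real n}"
    unfolding minimal_def by auto
  then have "finite {a. minimal N p a \<and> d p (\<phi> a p) \<le> real n}"
    using finite_displacement[OF p] finite_subset by blast
  ultimately show ?thesis by (intro surj_card_le)
qed

lemma card_quotient_orbit_ball:
  assumes N: "N \<lhd> G" and p: "p \<in> Y" and Q: "Q \<in> quotient_space G Y \<phi> N"
  shows "\<exists>q. \<forall>n. card (orbit_ball (G Mod N) (quotient_action \<phi>) (quotient_dist d) Q n) \<le> card (qball N p (n + q))"
proof -
  interpret nrm: normal N G by (rule N)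
  obtain y where y: "y \<in> Y" "Q = orbit (G\<lparr>carrier := N\<rparr>) \<phi> y" using Q unfolding orbits_def by auto
  \<comment> \<open>\<open>2 * d p y\<close> pays for the change of base point. The extra 1 is there
    because the quotient distance is an infimum, which some pair of points realizes up to 1.\<close>
  define q where "q = nat \<lceil>2 * d p y\<rceil> + 1"
  have q: "2 * d p y + 1 \<le> real q" unfolding q_def by linarith
  have "orbit_ball (G Mod N) (quotient_action \<phi>) (quotient_dist d) Q n
      \<subseteq> (\<lambda>X. quotient_action \<phi> X Q) ` qball N p (n + q)" for n
  proof
    fix Z assume "Z \<in> orbit_ball (G Mod N) (quotient_action \<phi>) (quotient_dist d) Q n"
    then obtain X where X: "X \<in> carrier (G Mod N)" "Z = quotient_action \<phi> X Q" "quotient_dist d Q Z \<le> real n"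
      unfolding orbit_ball_def by auto
    obtain g where g: "g \<in> carrier G" "X = N #> g" using X(1) unfolding FactGroup_def RCOSETS_def by auto
    have Z: "Z = orbit (G\<lparr>carrier := N\<rparr>) \<phi> (\<phi> g y)"
      unfolding X(2) g(2) y(2) by (rule quotient_action_coset_orbit[OF N g(1) y(1)])
    have ne: "y \<in> Q" "\<phi> g y \<in> Z"
      unfolding y(2) Z orbit_def using y g by (auto intro!: exI[of _ \<one>])
    have "Inf {d u v |u v. u \<in> Q \<and> v \<in> Z} < real n + 1" using X(3) unfolding quotient_dist_def by simp
    then obtain t where "t \<in> {d u v |u v. u \<in> Q \<and> v \<in> Z}" "t < real n + 1"
      using cInf_lessD[of "{d u v |u v. u \<in> Q \<and> v \<in> Z}"] ne by blast
    then obtain u v where uv: "u \<in> Q" "v \<in> Z" "d u v < real n + 1" by auto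
    obtain k k' where k: "k \<in> N" "k' \<in> N" "u = \<phi> k y" "v = \<phi> k' (\<phi> g y)"
      using uv(1,2) unfolding y(2) Z orbit_def by auto
    have kG: "k \<in> carrier G" "k' \<in> carrier G" using k nrm.subset by auto
    define g' where "g' = inv k \<otimes> k' \<otimes> g"
    have g': "g' \<in> carrier G" unfolding g'_def using kG g by simp
    have "g' \<in> X" unfolding g'_def g(2) r_coset_def using k nrm.m_inv_closed nrm.m_closed by blast
    then have Xg': "X = N #> g'" using g repr_independence nrm.subgroup_axioms by blast
    have "d y (\<phi> g' y) = d u v" unfolding g'_def k using kG g y act_dist_inv[of k "\<phi> k' (\<phi> g y)" y]
      by (simp add: act_mult commute)
    then have "d p (\<phi> g' p) \<le> d p y + (real n + 1) + d y p"
      using triangle[of p y "\<phi> g' p"] triangle[of y "\<phi> g' y" "\<phi> g' p"] uv(3) p y g' by simp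
    then have "d p (\<phi> g' p) \<le> real (n + q)" using q by (simp add: commute)
    then show "Z \<in> (\<lambda>X. quotient_action \<phi> X Q) ` qball N p (n + q)"
      unfolding X(2) Xg' qball_def using g' by blast
  qed
  then have "card (orbit_ball (G Mod N) (quotient_action \<phi>) (quotient_dist d) Q n) \<le> card (qball N p (n + q))" for n
    by (rule surj_card_le[OF finite_qball[OF p]])
  then show ?thesis by blast
qed

lemma quotient_growth:
  assumes N: "N \<lhd> G" and p: "p \<in> Y" and Q: "Q \<in> quotient_space G Y \<phi> N"
  obtains \<delta> C n0 where "0 \<le> \<delta>" "0 < C"
    "growth_rate (G Mod N) (quotient_action \<phi>) (quotient_dist d) Q (carrier (G Mod N)) \<le> ereal \<delta>"
    "\<forall>n\<ge>n0. C * exp (\<delta> * real n) \<le> real (card {a. minimal N p a \<and> d p (\<phi> a p) \<le> real n})"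
proof -
  obtain D where D: "\<forall>y\<in>Y. \<exists>g\<in>carrier G. d y (\<phi> g p) \<le> real D" using orbit_codiameter[OF p] by blast
  \<comment> \<open>The shift by \<open>2 * D\<close> absorbs the error \<open>D\<close> of each
    factor and makes \<open>v\<close> exactly submultiplicative.\<close>
  define v where "v n = real (card (qball N p (n + 2 * D)))" for n
  have v1: "1 \<le> v n" for n
  proof -
    have "N #> \<one> \<in> qball N p (n + 2 * D)" unfolding qball_def using p by (intro imageI) simp
    then have "0 < card (qball N p (n + 2 * D))" using finite_qball[OF p] card_gt_0_iff by blast
    then show ?thesis unfolding v_def by simp
  qed
  have v2: "mono v" unfolding v_def
    by (intro monoI of_nat_mono card_mono finite_qball[OF p] qball_mono) simp
  have v3: "v (a + b) \<le> v a * v b" for a b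
  proof -
    have "card (qball N p ((a + D) + (b + D))) \<le> card (qball N p (a + D + D)) * card (qball N p (b + D + D))"
      by (rule qball_submultiplicative[OF N p D])
    moreover have "(a + D) + (b + D) = a + b + 2 * D" "a + D + D = a + 2 * D" "b + D + D = b + 2 * D" by simp_all
    ultimately show ?thesis unfolding v_def by (metis of_nat_le_iff of_nat_mult)
  qed
  \<comment> \<open>Being an infimum, \<delta> satisfies
    \<open>exp (\<delta> * real n) \<le> v n\<close> for every \<open>n\<close>, with no error in
    the exponent; yet it bounds the growth rate, by \<open>submultiplicative_limsup\<close>.\<close>
  define \<delta> where "\<delta> = (INF m\<in>{1..}. ln (v m) / real m)"
  have nn: "0 \<le> ln (v m) / real m" for m using v1[of m] by simp
  have bdd: "bdd_below ((\<lambda>m. ln (v m) / real m) ` {1..})" using nn by (intro bdd_belowI2[of _ 0]) auto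
  have \<delta>0: "0 \<le> \<delta>" unfolding \<delta>_def using nn by (intro cINF_greatest) auto
  have vlow: "exp (\<delta> * real n) \<le> v n" for n
  proof (cases "n = 0")
    case True then show ?thesis using v1[of 0] by simp
  next
    case False
    have "\<delta> \<le> ln (v n) / real n" unfolding \<delta>_def using bdd False by (intro cINF_lower) auto
    then have "\<delta> * real n \<le> ln (v n)" using False by (simp add: le_divide_eq)
    then have "exp (\<delta> * real n) \<le> exp (ln (v n))" by simp
    then show ?thesis using v1[of n] by simp
  qed
  obtain q where q: "\<And>n. card (orbit_ball (G Mod N) (quotient_action \<phi>) (quotient_dist d) Q n) \<le> card (qball N p (n + q))"
    using card_quotient_orbit_ball[OF N p Q] by blast
  define u where "u n = real (card (orbit_ball (G Mod N) (quotient_action \<phi>) (quotient_dist d) Q n))" for n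
  have uv: "0 \<le> u n" "u n \<le> v (n + q)" for n
  proof -
    have "card (qball N p (n + q)) \<le> card (qball N p (n + q + 2 * D))"
      by (intro card_mono finite_qball[OF p] qball_mono) simp
    then show "u n \<le> v (n + q)" unfolding u_def v_def using q[of n] by simp
  qed (simp add: u_def)
  have int: "orbit_ball (G Mod N) (quotient_action \<phi>) (quotient_dist d) Q n
      \<inter> (\<lambda>g. quotient_action \<phi> g Q) ` carrier (G Mod N)
    = orbit_ball (G Mod N) (quotient_action \<phi>) (quotient_dist d) Q n" for n
    unfolding orbit_ball_def by auto
  have "growth_rate (G Mod N) (quotient_action \<phi>) (quotient_dist d) Q (carrier (G Mod N)) \<le> ereal \<delta>"
    unfolding growth_rate_def int u_def[symmetric]
  proof (rule ereal_le_epsilon2)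
    fix e :: real assume e: "0 < e"
    have "(INF m\<in>{1..}. ln (v m) / real m) < \<delta> + e" using e unfolding \<delta>_def by simp
    then obtain m where m: "m \<in> {1..}" "ln (v m) / real m < \<delta> + e"
      using cINF_less_iff[OF _ bdd] by auto
    have "limsup (\<lambda>n. ereal (ln (u n) / real n)) \<le> ereal (ln (v m) / real m)"
      by (rule submultiplicative_limsup[of v, OF v1 v2 v3 _ uv]) (use m in simp)
    also have "\<dots> \<le> ereal \<delta> + ereal e" using m by simp
    finally show "limsup (\<lambda>n. ereal (ln (u n) / real n)) \<le> ereal \<delta> + ereal e" .
  qed
  moreover have "exp (- \<delta> * real (2 * D)) * exp (\<delta> * real n) \<le> real (card {a. minimal N p a \<and> d p (\<phi> a p) \<le> real n})"
    if n: "2 * D \<le> n" for n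
  proof -
    have "exp (- \<delta> * real (2 * D)) * exp (\<delta> * real n) = exp (\<delta> * real (n - 2 * D))"
      using n by (simp add: exp_add[symmetric] of_nat_diff algebra_simps)
    also have "\<dots> \<le> v (n - 2 * D)" by (rule vlow)
    also have "\<dots> \<le> real (card {a. minimal N p a \<and> d p (\<phi> a p) \<le> real n})"
      unfolding v_def using card_qball_le_minimal[OF N p, of n] n by simp
    finally show ?thesis .
  qed
  ultimately show thesis using that[of \<delta> "exp (- \<delta> * real (2 * D))" "2 * D"] \<delta>0 by simp
qed

end

section \<open>Ping-pong with shortest representatives\<close>

context axis_action
begin

text \<open>A geodesic from the base point to the image of a shortest coset representative cannot follow
  a translate of the axis for long, since a conjugate of a power of \<open>h\<close> would shorten it.\<close>

lemma minimal_projection: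
  assumes N: "N \<lhd> G" "h \<in> N" and a: "minimal N (c 0) a" and g: "g \<in> carrier G"
  shows "\<bar>b (\<phi> (inv g) (c 0)) - b (\<phi> (inv g) (\<phi> a (c 0)))\<bar> \<le> 4 * K + \<tau>"
proof (rule ccontr)
  interpret nrm: normal N G by (rule N(1))
  define p where "p = \<phi> (inv g) (c 0)"
  define q where "q = \<phi> (inv g) (\<phi> a (c 0))"
  assume "\<not> ?thesis"
  then have far: "4 * K + \<tau> < \<bar>b p - b q\<bar>" unfolding p_def q_def by simp
  have aG: "a \<in> carrier G" using a unfolding minimal_def by simp
  have Y: "p \<in> Y" "q \<in> Y" unfolding p_def q_def using g aG by auto
  have "K < \<bar>b p - b q\<bar>" using far K_nonneg \<tau> by linarith
  then have 1: "H p + \<bar>b p - b q\<bar> + H q - 4 * K \<le> d p q" using gate_length(2)[OF gate Y] by simp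
  \<comment> \<open>The power \<open>j\<close> moves the foot of \<open>q\<close> to within
    \<open>\<tau>\<close> of that of \<open>p\<close>, which removes almost all of the projected
    length.\<close>
  obtain j :: int where j: "of_int j * \<tau> \<le> b p - b q" "b p - b q < of_int j * \<tau> + \<tau>"
    using multiple_below[OF \<tau>] .
  define x where "x = g \<otimes> pow j \<otimes> inv g"
  have hN: "pow j \<in> N" using subgroup_int_pow_closed[OF nrm.subgroup_axioms N(2)] .
  have xN: "x \<in> N" unfolding x_def using nrm.inv_op_closed2[OF g hN] .
  have r: "\<phi> (pow j) q \<in> Y" "b (\<phi> (pow j) q) = b q + of_int j * \<tau>" "H (\<phi> (pow j) q) = H q"
    using pow_b Y by auto
  have "d (c 0) (\<phi> (x \<otimes> a) (c 0)) = d p (\<phi> (pow j) q)"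
    unfolding p_def q_def x_def using g aG act_dist_inv[of g "c 0" "\<phi> (pow j) (\<phi> (inv g) (\<phi> a (c 0)))"]
    by (simp add: act_mult)
  also have "\<dots> \<le> H p + \<bar>b p - b (\<phi> (pow j) q)\<bar> + H (\<phi> (pow j) q)"
    unfolding H_def using triangle[of p "c (b p)" "\<phi> (pow j) q"]
      triangle[of "c (b p)" "c (b (\<phi> (pow j) q))" "\<phi> (pow j) q"] Y r(1) by (simp add: commute)
  also have "\<dots> \<le> H p + \<tau> + H q" using j r by simp
  also have "\<dots> < d p q" using 1 far by linarith
  also have "d p q = d (c 0) (\<phi> a (c 0))" unfolding p_def q_def using g aG by simp
  finally show False using a xN unfolding minimal_def by (meson not_le)
qed

text \<open>If the translated axis projected far, it would pass the gate near the foot of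
  \<open>\<phi> a (c 0)\<close>, hence near \<open>c 0\<close>. Pulled back by \<open>a\<close>, the
  gate is a point of the axis near \<open>\<phi> (inv a) (c 0)\<close>, whose foot is near
  \<open>c 0\<close>, so \<open>a\<close> would move \<open>c 0\<close> only little.\<close>

lemma projection_of_translate:
  assumes a: "a \<in> carrier G" and l: "\<bar>b (\<phi> a (c 0))\<bar> \<le> l" "\<bar>b (\<phi> (inv a) (c 0))\<bar> \<le> l"
    and long: "2 * l + K < d (c 0) (\<phi> a (c 0))"
  shows "\<bar>b (\<phi> a (c t))\<bar> \<le> l + K"
proof (rule ccontr)
  assume "\<not> ?thesis"
  then have "K < \<bar>b (\<phi> a (c 0)) - b (\<phi> a (c t))\<bar>" using l(1) by linarith
  then obtain z where z: "z \<in> Y" "d (\<phi> a (c 0)) z + d z (\<phi> a (c t)) = d (\<phi> a (c 0)) (\<phi> a (c t))"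
      "d z (c (b (\<phi> a (c 0)))) \<le> K"
    using gate a unfolding gate_def by blast
  define z' where "z' = \<phi> (inv a) z"
  have z': "z' \<in> Y" "z = \<phi> a z'" unfolding z'_def using a z by auto
  have "d (c 0) z' + d z' (c t) = \<bar>0 - t\<bar>" using z(2) a z' unfolding z'(2) by simp
  then obtain s where s: "z' = c s" using between_line z' by blast
  have "d z (c 0) \<le> K + l" using triangle[of z "c (b (\<phi> a (c 0)))" "c 0"] z l(1) by simp
  then have "d (c s) (\<phi> (inv a) (c 0)) \<le> K + l"
    using act_dist[of "inv a" z "c 0"] a z(1) s unfolding z'_def by simp
  then have "H (\<phi> (inv a) (c 0)) \<le> K + l" using H_le[of "\<phi> (inv a) (c 0)" s] a by (simp add: commute)
  then have "d (\<phi> (inv a) (c 0)) (c 0) \<le> 2 * l + K"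
    using triangle[of "\<phi> (inv a) (c 0)" "c (b (\<phi> (inv a) (c 0)))" "c 0"] a l(2) unfolding H_def by simp
  moreover have "d (\<phi> (inv a) (c 0)) (c 0) = d (c 0) (\<phi> a (c 0))" using act_dist_inv[OF a] by simp
  ultimately show False using long by simp
qed

lemma minimal_transversal:
  assumes N: "N \<lhd> G" "h \<in> N" and a: "minimal N (c 0) a"
    and long: "2 * (4 * K + \<tau>) + K < d (c 0) (\<phi> a (c 0))"
  shows "transversal (4 * K + \<tau> + K) a"
proof -
  have aG: "a \<in> carrier G" using a unfolding minimal_def by simp
  have 1: "\<bar>b (\<phi> a (c 0))\<bar> \<le> 4 * K + \<tau>" "\<bar>b (\<phi> (inv a) (c 0))\<bar> \<le> 4 * K + \<tau>"
    using minimal_projection[OF N a, of \<one>] minimal_projection[OF N a, of a] aG by simp_all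
  have "d (c 0) (\<phi> (inv a) (c 0)) = d (c 0) (\<phi> a (c 0))" using act_dist_inv[OF aG, of "c 0" "c 0"] by (simp add: commute)
  then show ?thesis unfolding transversal_def
    using projection_of_translate[OF aG 1] projection_of_translate[of "inv a" "4 * K + \<tau>"] 1 aG long by simp
qed

text \<open>The common point \<open>w\<close> has its feet far out on both translated axes. So the
  geodesic from \<open>c 0\<close> to \<open>w\<close> passes near \<open>\<phi> a' (c 0)\<close>,
  and the one from \<open>\<phi> a' (c 0)\<close> to \<open>w\<close> passes near
  \<open>\<phi> a (c 0)\<close>. As \<open>a'\<close> is at least as long as \<open>a\<close>,
  adding the two estimates bounds the distance of these points.\<close>

lemma minimal_disjoint:
  assumes N: "N \<lhd> G" "h \<in> N" and a: "minimal N (c 0) a" "minimal N (c 0) a'"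
    and le: "d (c 0) (\<phi> a (c 0)) \<le> d (c 0) (\<phi> a' (c 0))"
    and n: "4 * (4 * K + \<tau>) + 8 * K < \<bar>of_int n\<bar> * \<tau>"
    and e: "e \<in> Y" "\<bar>b e\<bar> \<le> 4 * K + \<tau> + K + K" and e': "e' \<in> Y" "\<bar>b e'\<bar> \<le> 4 * K + \<tau> + K + K"
    and eq: "\<phi> (a \<otimes> pow n) e = \<phi> (a' \<otimes> pow n) e'"
  shows "d (\<phi> a (c 0)) (\<phi> a' (c 0)) \<le> 6 * (4 * K + \<tau>) + 4 * K"
proof -
  define l where "l = 4 * K + \<tau>"
  have l0: "0 \<le> l" "0 \<le> K" using K_nonneg \<tau> unfolding l_def by auto
  have G: "a \<in> carrier G" "a' \<in> carrier G" using a unfolding minimal_def by simp_all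
  define w where "w = \<phi> (a \<otimes> pow n) e"
  have w: "w \<in> Y" unfolding w_def using G e by auto
  have nt: "\<bar>of_int n * \<tau>\<bar> = \<bar>of_int n\<bar> * \<tau>" using \<tau> by (simp add: abs_mult)
  have n': "4 * l + 8 * K < \<bar>of_int n * \<tau>\<bar>" unfolding l_def nt using n .
  have bw: "b (\<phi> (inv a) w) = b e + of_int n * \<tau>"
    unfolding w_def using G e pow_b by (simp add: act_mult)
  have bw': "b (\<phi> (inv a') w) = b e' + of_int n * \<tau>"
    unfolding w_def eq using G e' pow_b by (simp add: act_mult)
  \<comment> \<open>The gate estimate for the axis translated by \<open>g\<close>, with
    \<open>\<phi> g (c 0)\<close> in place of the foot of \<open>u\<close>.\<close>
  have pass: "d u (\<phi> g (c 0)) + d (\<phi> g (c 0)) w \<le> d u w + 2 * K + 2 * \<bar>b (\<phi> (inv g) u)\<bar>"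
    if g: "g \<in> carrier G" and u: "u \<in> Y" and far: "K < \<bar>b (\<phi> (inv g) u) - b (\<phi> (inv g) w)\<bar>" for g u
  proof -
    let ?u = "\<phi> (inv g) u" and ?w = "\<phi> (inv g) w"
    have Y: "?u \<in> Y" "?w \<in> Y" using g u w by auto
    have "d ?u (c 0) \<le> d ?u (c (b ?u)) + \<bar>b ?u\<bar>" "d (c 0) ?w \<le> \<bar>b ?u\<bar> + d (c (b ?u)) ?w"
      using triangle[of ?u "c (b ?u)" "c 0"] triangle[of "c 0" "c (b ?u)" ?w] Y by simp_all
    moreover have "d ?u (c (b ?u)) + d (c (b ?u)) ?w - 2 * K \<le> d ?u ?w" by (rule gate_length(1)[OF gate Y far])
    moreover have "d ?u ?w = d u w" "d ?u (c 0) = d u (\<phi> g (c 0))" "d (c 0) ?w = d (\<phi> g (c 0)) w"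
      using g u w act_dist_inv[OF g u, of "c 0"] act_dist_inv[OF g w, of "c 0"] by (simp_all add: commute)
    ultimately show ?thesis by linarith
  qed
  have p1: "\<bar>b (\<phi> (inv a) (c 0))\<bar> \<le> l" "\<bar>b (\<phi> (inv a') (c 0))\<bar> \<le> l"
    using minimal_projection[OF N a(1), of a] minimal_projection[OF N a(2), of a'] G unfolding l_def by simp_all
  have "\<bar>b (\<phi> (inv a) (c 0)) - b (\<phi> (inv a) (\<phi> a' (c 0)))\<bar> \<le> l"
    using minimal_projection[OF N a(2), of a] G unfolding l_def by simp
  then have p2: "\<bar>b (\<phi> (inv a) (\<phi> a' (c 0)))\<bar> \<le> 2 * l" using p1(1) by linarith
  have be: "\<bar>b e\<bar> \<le> l + 2 * K" "\<bar>b e'\<bar> \<le> l + 2 * K" using e(2) e'(2) unfolding l_def by auto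
  have "K < \<bar>b (\<phi> (inv a) (\<phi> a' (c 0))) - b (\<phi> (inv a) w)\<bar>" unfolding bw using p2 be n' l0 by linarith
  then have 1: "d (\<phi> a' (c 0)) (\<phi> a (c 0)) + d (\<phi> a (c 0)) w \<le> d (\<phi> a' (c 0)) w + 2 * K + 4 * l"
    using pass[OF G(1), of "\<phi> a' (c 0)"] p2 G by simp
  have "K < \<bar>b (\<phi> (inv a') (c 0)) - b (\<phi> (inv a') w)\<bar>" unfolding bw' using p1 be n' l0 by linarith
  then have 2: "d (c 0) (\<phi> a' (c 0)) + d (\<phi> a' (c 0)) w \<le> d (c 0) w + 2 * K + 2 * l"
    using pass[OF G(2), of "c 0"] p1(2) by simp
  have "d (c 0) w \<le> d (c 0) (\<phi> a (c 0)) + d (\<phi> a (c 0)) w" using G w by (intro triangle) auto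
  then have "d (\<phi> a' (c 0)) (\<phi> a (c 0)) \<le> 6 * l + 4 * K" using 1 2 le by linarith
  then show ?thesis unfolding l_def by (simp add: commute)
qed

definition near :: "real \<Rightarrow> 'b set" where "near m = {e \<in> Y. \<bar>b e\<bar> \<le> m}"

text \<open>Translations by \<open>n\<close> and \<open>2 * n\<close> move the ping-pong set to
  disjoint ranges of \<open>b\<close>. Two letters suffice because at \<delta> = 0 each has weight
  1.\<close>

lemma positive_growth:
  assumes a: "transversal m a" and x: "x \<in> Y"
  shows "0 < growth_rate G \<phi> d x (carrier G)"
proof -
  have aG: "a \<in> carrier G" using a unfolding transversal_def by simp
  have m0: "0 \<le> m" using a unfolding transversal_def by (meson abs_ge_zero order_trans)
  define n where "n = \<lceil>(2 * m + 2 * K) / \<tau>\<rceil> + 1"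
  have "(2 * m + 2 * K) / \<tau> < of_int n" unfolding n_def by linarith
  then have n: "2 * m + 2 * K < of_int n * \<tau>" using \<tau> by (simp add: divide_less_eq)
  then have n0: "0 < real_of_int n * \<tau>" using K_nonneg m0 by linarith
  then have npos: "0 < n" using \<tau> by (simp add: zero_less_mult_iff)
  define S where "S = {a \<otimes> pow n, a \<otimes> pow (2 * n)}"
  have ne: "\<phi> (a \<otimes> pow n) e \<noteq> \<phi> (a \<otimes> pow (2 * n)) e'" if "e \<in> near (m + K)" "e' \<in> near (m + K)" for e e'
  proof
    assume "\<phi> (a \<otimes> pow n) e = \<phi> (a \<otimes> pow (2 * n)) e'"
    then have "\<phi> (inv a) (\<phi> (a \<otimes> pow n) e) = \<phi> (inv a) (\<phi> (a \<otimes> pow (2 * n)) e')" by simp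
    then have "\<phi> (pow n) e = \<phi> (pow (2 * n)) e'" using aG that unfolding near_def by (simp add: act_mult)
    then have "b e + of_int n * \<tau> = b e' + of_int (2 * n) * \<tau>"
      using pow_b(1)[of e n] pow_b(1)[of e' "2 * n"] that unfolding near_def by simp
    then have "b e = b e' + of_int n * \<tau>" by simp
    then show False using that n unfolding near_def by auto
  qed
  have "ereal 0 < growth_rate G \<phi> d x (carrier G)"
  proof (rule ping_pong_growth_gt[where P = "near (m + K)" and ?p0.0 = "c 0" and S = S])
    show "c 0 \<in> near (m + K)" unfolding near_def using m0 K_nonneg by simp
    show "\<phi> s e \<in> near (m + K)" if "s \<in> S" "e \<in> near (m + K)" for s e
    proof -
      have "2 * m + 2 * K < \<bar>real_of_int n\<bar> * \<tau>" "2 * m + 2 * K < \<bar>real_of_int (2 * n)\<bar> * \<tau>"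
        using n n0 npos by auto
      then show ?thesis using that transversal_ping_pong(1)[OF a] aG unfolding near_def S_def by auto
    qed
    show "s = s'" if "s \<in> S" "s' \<in> S" "e \<in> near (m + K)" "e' \<in> near (m + K)" "\<phi> s e = \<phi> s' e'" for s s' e e'
      using that ne ne[symmetric] unfolding S_def by blast
    have "a \<otimes> pow n \<noteq> a \<otimes> pow (2 * n)"
      using ne[of "c 0" "c 0"] m0 K_nonneg unfolding near_def by auto
    then show "2 \<le> (\<Sum>s\<in>S. exp (- 0 * (d (c 0) (\<phi> s (c 0)) + 2)))" unfolding S_def by simp
  qed (use aG x in \<open>auto simp: S_def near_def\<close>)
  then show ?thesis by (simp add: zero_ereal_def)
qed

lemma growth_gap:
  assumes N: "N \<lhd> G" "h \<in> N" and \<delta>: "0 < \<delta>" and C: "0 < C"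
    and card: "\<And>n. n0 \<le> n \<Longrightarrow> C * exp (\<delta> * real n) \<le> real (card {a. minimal N (c 0) a \<and> d (c 0) (\<phi> a (c 0)) \<le> real n})"
    and x: "x \<in> Y"
  shows "ereal \<delta> < growth_rate G \<phi> d x (carrier G)"
proof -
  define len where "len g = d (c 0) (\<phi> g (c 0))" for g
  define l where "l = 4 * K + \<tau>"
  \<comment> \<open>The bound of \<open>minimal_disjoint\<close>: elements further apart than this
    have disjoint ping-pong images.\<close>
  define C1 where "C1 = 6 * l + 4 * K"
  have l0: "0 \<le> l" "0 \<le> K" "0 \<le> C1" using K_nonneg \<tau> unfolding l_def C1_def by auto
  define n where "n = \<lceil>(4 * l + 8 * K) / \<tau>\<rceil> + 1"
  have "(4 * l + 8 * K) / \<tau> < of_int n" unfolding n_def by linarith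
  then have n: "4 * l + 8 * K < of_int n * \<tau>" using \<tau> by (simp add: divide_less_eq)
  then have "0 < real_of_int n * \<tau>" using l0 by linarith
  then have "0 < n" using \<tau> by (simp add: zero_less_mult_iff)
  then have n': "4 * (4 * K + \<tau>) + 8 * K < \<bar>of_int n\<bar> * \<tau>" using n unfolding l_def by simp
  define U where "U = {a. minimal N (c 0) a}"
  have UG: "a \<in> carrier G" if "a \<in> U" for a using that unfolding U_def minimal_def by simp
  have fin: "finite {a \<in> U. len a \<le> r}" for r
    by (rule finite_subset[OF _ finite_displacement[OF c_in, of 0 r]]) (use UG in \<open>auto simp: len_def\<close>)
  \<comment> \<open>The threshold of length in \<open>minimal_transversal\<close>.\<close>
  define R where "R = 2 * l + K"
  define p0 where "p0 = real (card {k \<in> carrier G. len k \<le> C1})"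
  define C2 where "C2 = len (pow n) + 2"
  \<comment> \<open>The series pays for three losses: the short elements, each of weight at most 1;
    the passage to a separated subset, a factor \<open>p0 * exp (\<delta> * C1)\<close>; and the
    letter \<open>pow n\<close> together with the constant 2 of \<open>ping_pong_growth_gt\<close>,
    a factor \<open>exp (\<delta> * C2)\<close>. What remains is the 2 demanded there.\<close>
  define s0 where "s0 = real (card {a \<in> U. len a \<le> R}) + 2 * p0 * exp (\<delta> * C1) * exp (\<delta> * C2)"
  have "\<exists>k. s0 \<le> (\<Sum>a | a \<in> U \<and> len a \<le> real k. exp (- \<delta> * len a))"
  proof (rule exponential_series_unbounded[OF _ \<delta> C])
    show "C * exp (\<delta> * real k) \<le> real (card {a \<in> U. len a \<le> real k})" if "n0 \<le> k" for k
      using card[OF that] unfolding U_def len_def by simp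
  qed (rule fin)
  then obtain k where k: "s0 \<le> (\<Sum>a | a \<in> U \<and> len a \<le> real k. exp (- \<delta> * len a))" by blast
  define A where "A = {a \<in> U. R < len a \<and> len a \<le> real k}"
  have finA: "finite A" by (rule finite_subset[OF _ fin[of "real k"]]) (auto simp: A_def)
  have AG: "a \<in> carrier G" if "a \<in> A" for a using that UG unfolding A_def by simp
  have sumA: "2 * p0 * exp (\<delta> * C1) * exp (\<delta> * C2) \<le> (\<Sum>a\<in>A. exp (- \<delta> * len a))"
  proof -
    have "(\<Sum>a | a \<in> U \<and> len a \<le> real k. exp (- \<delta> * len a)) \<le> (\<Sum>a\<in>A \<union> {a \<in> U. len a \<le> R}. exp (- \<delta> * len a))"
      using finA fin by (intro sum_mono2) (auto simp: A_def)
    also have "\<dots> = (\<Sum>a\<in>A. exp (- \<delta> * len a)) + (\<Sum>a | a \<in> U \<and> len a \<le> R. exp (- \<delta> * len a))"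
      using finA fin by (intro sum.union_disjoint) (auto simp: A_def)
    also have "(\<Sum>a | a \<in> U \<and> len a \<le> R. exp (- \<delta> * len a)) \<le> (\<Sum>a | a \<in> U \<and> len a \<le> R. 1)"
      using \<delta> by (intro sum_mono) (simp add: len_def)
    finally show ?thesis using k unfolding s0_def by simp
  qed
  define r where "r a a' = d (\<phi> a (c 0)) (\<phi> a' (c 0))" for a a'
  obtain B where B: "B \<subseteq> A" "\<forall>a\<in>B. \<forall>a'\<in>B. a \<noteq> a' \<longrightarrow> C1 < r a a'" "\<forall>a\<in>A. \<exists>a'\<in>B. r a a' \<le> C1"
    using maximal_separated[OF finA, of r C1] AG l0 unfolding r_def by (auto simp: commute)
  have finB: "finite B" using finite_subset[OF B(1) finA] .
  obtain f where f: "\<And>a. a \<in> A \<Longrightarrow> f a \<in> B" "\<And>a. a \<in> A \<Longrightarrow> r a (f a) \<le> C1" using B(3) by metis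
  \<comment> \<open>Elements assigned to \<open>a'\<close> differ from it by one of
    \<open>p0\<close> elements, and their lengths are smaller by at most \<open>C1\<close>.\<close>
  have fiber: "(\<Sum>a | a \<in> A \<and> f a = a'. exp (- \<delta> * len a)) \<le> p0 * exp (\<delta> * C1) * exp (- \<delta> * len a')"
    if a': "a' \<in> B" for a'
  proof -
    have a'G: "a' \<in> carrier G" using a' B(1) AG by blast
    have each: "exp (- \<delta> * len a) \<le> exp (\<delta> * C1) * exp (- \<delta> * len a')" if a: "a \<in> A" "f a = a'" for a
    proof -
      have "len a' \<le> len a + C1"
        using triangle[of "c 0" "\<phi> a (c 0)" "\<phi> a' (c 0)"] f(2)[OF a(1)] a AG a'G unfolding len_def r_def by simp
      then have "- \<delta> * len a \<le> \<delta> * C1 + - \<delta> * len a'"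
        using mult_left_mono[of "len a'" "len a + C1" \<delta>] \<delta> by (simp add: distrib_left)
      then have "exp (- \<delta> * len a) \<le> exp (\<delta> * C1 + - \<delta> * len a')" by simp
      then show ?thesis by (simp only: exp_add)
    qed
    have "{a \<in> A. f a = a'} \<subseteq> (\<lambda>k. a' \<otimes> k) ` {k \<in> carrier G. len k \<le> C1}"
    proof
      fix a assume a: "a \<in> {a \<in> A. f a = a'}"
      then have aG: "a \<in> carrier G" using AG by blast
      have "len (inv a' \<otimes> a) = r a a'"
        unfolding len_def r_def using aG a'G act_dist_inv[of a' "\<phi> a (c 0)" "c 0"] by (simp add: act_mult commute)
      moreover have "r a a' \<le> C1" using a f(2) by auto
      moreover have "a = a' \<otimes> (inv a' \<otimes> a)" using aG a'G by (simp add: m_assoc[symmetric])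
      ultimately show "a \<in> (\<lambda>k. a' \<otimes> k) ` {k \<in> carrier G. len k \<le> C1}"
        using aG a'G by (intro image_eqI[of _ _ "inv a' \<otimes> a"]) auto
    qed
    then have "card {a \<in> A. f a = a'} \<le> card {k \<in> carrier G. len k \<le> C1}"
      using finite_displacement[OF c_in, of 0 C1] unfolding len_def by (intro surj_card_le) auto
    then have cnt: "real (card {a \<in> A. f a = a'}) \<le> p0" unfolding p0_def by simp
    have "(\<Sum>a | a \<in> A \<and> f a = a'. exp (- \<delta> * len a)) \<le> (\<Sum>a | a \<in> A \<and> f a = a'. exp (\<delta> * C1) * exp (- \<delta> * len a'))"
      using each by (intro sum_mono) auto
    also have "\<dots> = real (card {a \<in> A. f a = a'}) * (exp (\<delta> * C1) * exp (- \<delta> * len a'))" by simp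
    also have "\<dots> \<le> p0 * (exp (\<delta> * C1) * exp (- \<delta> * len a'))" using cnt by (intro mult_right_mono) auto
    finally show ?thesis by simp
  qed
  have "(\<Sum>a\<in>A. exp (- \<delta> * len a)) = (\<Sum>a'\<in>B. \<Sum>a | a \<in> A \<and> f a = a'. exp (- \<delta> * len a))"
    using f(1) by (intro sum.group[symmetric, OF finA finB]) auto
  also have "\<dots> \<le> (\<Sum>a'\<in>B. p0 * exp (\<delta> * C1) * exp (- \<delta> * len a'))" by (intro sum_mono fiber)
  also have "\<dots> = p0 * exp (\<delta> * C1) * (\<Sum>a\<in>B. exp (- \<delta> * len a))" by (simp add: sum_distrib_left)
  finally have "(p0 * exp (\<delta> * C1)) * (2 * exp (\<delta> * C2)) \<le> (p0 * exp (\<delta> * C1)) * (\<Sum>a\<in>B. exp (- \<delta> * len a))"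
    using sumA by (simp add: mult_ac)
  moreover have "0 < p0"
  proof -
    have "\<one> \<in> {k \<in> carrier G. len k \<le> C1}" using l0 unfolding len_def by simp
    moreover have "finite {k \<in> carrier G. len k \<le> C1}" unfolding len_def by (rule finite_displacement) simp
    ultimately show ?thesis unfolding p0_def using card_gt_0_iff of_nat_0_less_iff by blast
  qed
  ultimately have sumB: "2 * exp (\<delta> * C2) \<le> (\<Sum>a\<in>B. exp (- \<delta> * len a))" by simp
  define m where "m = l + K"
  have trB: "transversal m a" if "a \<in> B" for a
    unfolding m_def l_def
    by (rule minimal_transversal[OF N]) (use that B(1) in \<open>auto simp: A_def U_def R_def l_def len_def\<close>)
  have minB: "minimal N (c 0) a" if "a \<in> B" for a using that B(1) unfolding A_def U_def by auto
  define S where "S = (\<lambda>a. a \<otimes> pow n) ` B"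
  have BG: "a \<in> carrier G" if "a \<in> B" for a using that B(1) AG by blast
  have injS: "inj_on (\<lambda>a. a \<otimes> pow n) B"
    by (rule inj_onI) (use right_cancel[OF int_pow_closed[OF h]] BG in blast)
  have disj: "a = a'" if a: "a \<in> B" "a' \<in> B" and e: "e \<in> near (m + K)" "e' \<in> near (m + K)"
      and eq: "\<phi> (a \<otimes> pow n) e = \<phi> (a' \<otimes> pow n) e'" for a a' e e'
  proof -
    have E: "e \<in> Y" "\<bar>b e\<bar> \<le> 4 * K + \<tau> + K + K" "e' \<in> Y" "\<bar>b e'\<bar> \<le> 4 * K + \<tau> + K + K"
      using e unfolding near_def m_def l_def by auto
    have "r a a' \<le> C1"
    proof (cases "len a \<le> len a'")
      case True
      then show ?thesis
        using minimal_disjoint[OF N minB[OF a(1)] minB[OF a(2)] _ n' E eq] unfolding len_def r_def C1_def l_def by simp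
    next
      case False
      then show ?thesis
        using minimal_disjoint[OF N minB[OF a(2)] minB[OF a(1)] _ n' E(3,4,1,2) eq[symmetric]]
        unfolding len_def r_def C1_def l_def by (simp add: commute)
    qed
    then show ?thesis using B(2) a by (meson not_le)
  qed
  show ?thesis
  proof (rule ping_pong_growth_gt[where P = "near (m + K)" and ?p0.0 = "c 0" and S = S])
    show "c 0 \<in> near (m + K)" unfolding near_def m_def using l0 by simp
    show "\<phi> s e \<in> near (m + K)" if "s \<in> S" "e \<in> near (m + K)" for s e
    proof -
      obtain a where a: "a \<in> B" "s = a \<otimes> pow n" using \<open>s \<in> S\<close> unfolding S_def by blast
      have "2 * m + 2 * K < \<bar>of_int n\<bar> * \<tau>" using n' l0 unfolding m_def l_def by simp
      then show ?thesis using transversal_ping_pong(1)[OF trB[OF a(1)]] a that AG B(1) unfolding near_def by auto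
    qed
    show "s = s'" if "s \<in> S" "s' \<in> S" "e \<in> near (m + K)" "e' \<in> near (m + K)" "\<phi> s e = \<phi> s' e'" for s s' e e'
      using that disj unfolding S_def by blast
    have "2 = exp (- \<delta> * C2) * (2 * exp (\<delta> * C2))" by (simp add: exp_minus)
    also have "\<dots> \<le> exp (- \<delta> * C2) * (\<Sum>a\<in>B. exp (- \<delta> * len a))" using sumB by (intro mult_left_mono) auto
    also have "\<dots> = (\<Sum>a\<in>B. exp (- \<delta> * (len a + C2)))"
      unfolding sum_distrib_left by (simp add: exp_add[symmetric] algebra_simps)
    also have "\<dots> \<le> (\<Sum>a\<in>B. exp (- \<delta> * (len (a \<otimes> pow n) + 2)))"
    proof (rule sum_mono)
      fix a assume "a \<in> B"
      then have aG: "a \<in> carrier G" using B(1) AG by blast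
      have "len (a \<otimes> pow n) \<le> len a + len (pow n)"
        using triangle[of "c 0" "\<phi> a (c 0)" "\<phi> a (\<phi> (pow n) (c 0))"] aG unfolding len_def by (simp add: act_mult)
      then show "exp (- \<delta> * (len a + C2)) \<le> exp (- \<delta> * (len (a \<otimes> pow n) + 2))"
        using \<delta> unfolding C2_def by simp
    qed
    also have "\<dots> = (\<Sum>s\<in>S. exp (- \<delta> * (d (c 0) (\<phi> s (c 0)) + 2)))"
      unfolding S_def sum.reindex[OF injS] len_def by simp
    finally show "2 \<le> (\<Sum>s\<in>S. exp (- \<delta> * (d (c 0) (\<phi> s (c 0)) + 2)))" .
  qed (use finB AG B(1) x \<delta> in \<open>auto simp: S_def near_def\<close>)
qed

end

theorem corollary1p5:
  fixes G :: "('a, 'c) monoid_scheme" and Y :: "'b set" and d :: "'b \<Rightarrow> 'b \<Rightarrow> real"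
    and \<phi> :: "'a \<Rightarrow> 'b \<Rightarrow> 'b"
  assumes "CAT0_space Y d"
    and "geometric_action Y d G \<phi>"
    and "non_elementary G"
    and "\<exists>g\<in>carrier G. Metric_space.rank_one Y d (\<phi> g)"
  shows "growth_tight G Y \<phi> d"
  unfolding growth_tight_def
proof (intro allI impI ballI)
  fix N x Q
  assume N: "N \<lhd> G \<and> infinite N" and x: "x \<in> Y" and Q: "Q \<in> quotient_space G Y \<phi> N"
  interpret CAT0_action Y d G \<phi> using assms(1,2) by (simp add: CAT0_action_def)
  obtain f where f: "f \<in> N" "rank_one (\<phi> f)" using rank_one_in_normal assms(3,4) N by blast
  have fG: "f \<in> carrier G" using f N by (meson normal_imp_subgroup subgroup.mem_carrier)
  obtain c \<tau> K where "axis_action Y d G \<phi> c f \<tau> K" using rank_one_axis[OF fG f(2)] .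
  then interpret axis_action Y d G \<phi> c f \<tau> K .
  \<comment> \<open>Shortest representatives refer to the point \<open>c 0\<close> of the axis,
    while \<open>x\<close> and \<open>Q\<close> are arbitrary; the changes of base point are made in
    \<open>quotient_growth\<close> and \<open>ping_pong_growth\<close>.\<close>
  obtain \<delta> C n0 where \<delta>: "0 \<le> \<delta>" "0 < C"
    "growth_rate (G Mod N) (quotient_action \<phi>) (quotient_dist d) Q (carrier (G Mod N)) \<le> ereal \<delta>"
    "\<forall>n\<ge>n0. C * exp (\<delta> * real n) \<le> real (card {a. minimal N (c 0) a \<and> d (c 0) (\<phi> a (c 0)) \<le> real n})"
    using quotient_growth[OF conjunct1[OF N] c_in Q] by blast
  have "ereal \<delta> < growth_rate G \<phi> d x (carrier G)"
  proof (cases "\<delta> = 0")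
    case True
    obtain y m where "y \<in> N" "transversal m y" using transversal_in_normal N assms(3) by blast
    then show ?thesis using positive_growth x True by (simp add: zero_ereal_def)
  next
    case False
    then show ?thesis using growth_gap[of N \<delta> C n0 x] N f(1) \<delta> x by simp
  qed
  then show "growth_rate (G Mod N) (quotient_action \<phi>) (quotient_dist d) Q (carrier (G Mod N))
      < growth_rate G \<phi> d x (carrier G)"
    using \<delta>(3) by (rule le_less_trans[rotated])
qed

end
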